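(* Let $G$ be a connected one-ended graph whose end $\omega$ is undominated and has finite vertex degree. Then $G$ has a tree-decomposition that displays $\omega$ and that is $\operatorname{Aut}(G)$-invariant.
   Context: Ends: A ray is a one-way infinite path. For a finite vertex set $S$, a ray lies in the unique component of $G-S$ containing all but finitely many of its vertices. Two rays are in the same end if they lie in the same component of $G-S$ for every finite $S\subseteq V(G)$; ends are the equivalence classes. $G$ is one-ended if it has exactly one end. A separation of $G$ is a pair $(A,B)$ of subsets of $V(G)$ with $A\cup B=V(G)$ and no edge between $A\setminus B$ and $B\setminus A$; its order is $|A\cap B|$; it is proper if $A\setminus B$ and $B\setminus A$ are both non-empty. For a separation of finite order, an end $\omega$ lies in $B$ if the component of $G-(A\cap B)$ in which its rays lie is contained in $B\setminus A$ (similarly for $A$). A vertex $v$ dominates $\omega$ if there is no separation $(A,B)$ of finite order with $v\in A\setminus B$ and $\omega$ lying in $B$; $\omega$ is undominated if no vertex dominates it. The vertex degree of $\omega$ is the maximal cardinality of a family of pairwise disjoint rays belonging to $\omega$ (finite vertex degree: this is a natural number). A tree-decomposition of $G$ consists of a tree $T$ (the decomposition tree) and a family $(P_t)_{t\in V(T)}$ of subsets of $V(G)$ (parts) such that (T1) $V(G)=\bigcup_{t}P_t$; (T2) every edge of $G$ has both endpoints in some $P_t$; (T3) $P_{t_1}\cap P_{t_3}\subseteq P_{t_2}$ whenever $t_2$ lies on the path in $T$ from $t_1$ to $t_3$. For an edge $st$ of $T$, let $T_s,T_t$ be the components of $T-st$ containing $s$ and $t$ respectively, and $X_s=\bigcup_{u\in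 T_s}P_u$, $X_t=\bigcup_{u\in T_t}P_u$. For all tree-decompositions considered, $X_s\setminus X_t$ and $X_t\setminus X_s$ are non-empty, so $(X_s,X_t)$ is a proper separation of $G$, called the separation associated to $st$ (read in either orientation). The sets $X_s\cap X_t$ are the adhesion sets, and the adhesion of the tree-decomposition is the supremum of their sizes. A tree-decomposition of finite adhesion of a graph $G$ with only one end $\omega$ displays $\omega$ if $T$ has exactly one end $\mu$, and for every edge $st$ of $T$ with $\mu$ in $T_t$, the end $\omega$ lies in $X_t$ with respect to the associated separation $(X_s,X_t)$. A tree-decomposition is $\operatorname{Aut}(G)$-invariant if the set of all separations associated to it is closed under the natural action $(A,B)\mapsto(\varphi(A),\varphi(B))$ of $\operatorname{Aut}(G)$. *)

theory Defs
  imports Main "HOL-Library.Extended_Nat" "HOL-Library.Disjoint_Sets"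
begin

section \<open>Graphs\<close>

record 'a graph =
  verts :: "'a set"
  edges :: "'a set set"

definition simple_graph :: "'a graph \<Rightarrow> bool" where
  "simple_graph G \<longleftrightarrow> (\<forall>e\<in>edges G. \<exists>u\<in>verts G. \<exists>v\<in>verts G. u \<noteq> v \<and> e = {u, v})"

definition adjacent :: "'a graph \<Rightarrow> 'a \<Rightarrow> 'a \<Rightarrow> bool" where
  "adjacent G u v \<longleftrightarrow> {u, v} \<in> edges G"

definition delete_verts :: "'a graph \<Rightarrow> 'a set \<Rightarrow> 'a graph" where
  "delete_verts G S = \<lparr>verts = verts G - S, edges = {e \<in> edges G. e \<inter> S = {}}\<rparr>"

definition delete_edge :: "'a graph \<Rightarrow> 'a \<Rightarrow> 'a \<Rightarrow> 'a graph" where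
  "delete_edge G u v = \<lparr>verts = verts G, edges = edges G - {{u, v}}\<rparr>"

text \<open>A finite path is given by the list of its vertices.\<close>

definition is_path :: "'a graph \<Rightarrow> 'a list \<Rightarrow> bool" where
  "is_path G p \<longleftrightarrow> p \<noteq> [] \<and> distinct p \<and> set p \<subseteq> verts G \<and> successively (adjacent G) p"

definition linked :: "'a graph \<Rightarrow> 'a \<Rightarrow> 'a \<Rightarrow> bool" where
  "linked G u v \<longleftrightarrow> (\<exists>p. is_path G p \<and> hd p = u \<and> last p = v)"

definition component_of :: "'a graph \<Rightarrow> 'a \<Rightarrow> 'a set" where
  "component_of G u = {v. linked G u v}"

definition components :: "'a graph \<Rightarrow> 'a set set" where
  "components G = component_of G ` verts G"

definition connected_graph :: "'a graph \<Rightarrow> bool" where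
  "connected_graph G \<longleftrightarrow> verts G \<noteq> {} \<and> (\<forall>u\<in>verts G. \<forall>v\<in>verts G. linked G u v)"

text \<open>Connected, and without a cycle; a cycle is a path on at least three vertices whose
  last vertex is adjacent to its first one.\<close>

definition is_tree :: "'a graph \<Rightarrow> bool" where
  "is_tree T \<longleftrightarrow> simple_graph T \<and> connected_graph T \<and>
     \<not> (\<exists>p. is_path T p \<and> 3 \<le> length p \<and> adjacent T (last p) (hd p))"

text \<open>The values of \<open>\<phi>\<close> outside \<open>verts G\<close> are arbitrary and are never used.\<close>

definition automorphism :: "'a graph \<Rightarrow> ('a \<Rightarrow> 'a) \<Rightarrow> bool" where
  "automorphism G \<phi> \<longleftrightarrow> bij_betw \<phi> (verts G) (verts G) \<and>
     (\<forall>u\<in>verts G. \<forall>v\<in>verts G. adjacent G (\<phi> u) (\<phi> v) \<longleftrightarrow> adjacent G u v)"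


section \<open>Rays and ends\<close>

text \<open>A ray is enumerated starting from its unique vertex of degree one, so rays as subgraphs
  and rays as sequences correspond one-to-one.\<close>

definition rays :: "'a graph \<Rightarrow> (nat \<Rightarrow> 'a) set" where
  "rays G = {r. inj r \<and> range r \<subseteq> verts G \<and> (\<forall>n. adjacent G (r n) (r (Suc n)))}"

definition eventually_in :: "(nat \<Rightarrow> 'a) \<Rightarrow> 'a set \<Rightarrow> bool" where
  "eventually_in r C \<longleftrightarrow> finite {n. r n \<notin> C}"

definition end_equiv :: "'a graph \<Rightarrow> ((nat \<Rightarrow> 'a) \<times> (nat \<Rightarrow> 'a)) set" where
  "end_equiv G = {(r, s). r \<in> rays G \<and> s \<in> rays G \<and>
     (\<forall>S. finite S \<and> S \<subseteq> verts G \<longrightarrow>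
       (\<exists>C\<in>components (delete_verts G S). eventually_in r C \<and> eventually_in s C))}"

definition ends :: "'a graph \<Rightarrow> (nat \<Rightarrow> 'a) set set" where
  "ends G = rays G // end_equiv G"

definition one_ended :: "'a graph \<Rightarrow> bool" where
  "one_ended G \<longleftrightarrow> (\<exists>!\<omega>. \<omega> \<in> ends G)"

definition ecard :: "'a set \<Rightarrow> enat" where
  "ecard S = (if finite S then enat (card S) else \<infinity>)"

text \<open>All infinite cardinalities are identified with \<open>\<infinity>\<close>.  If the supremum is finite, it is
  attained; hence the vertex degree is finite iff a maximal cardinality exists and is a natural
  number, and in that case it equals this maximum.\<close>

definition vertex_degree :: "(nat \<Rightarrow> 'a) set \<Rightarrow> enat" where
  "vertex_degree \<omega> = (SUP R \<in> {R. R \<subseteq> \<omega> \<and> disjoint_family_on range R}. ecard R)"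


section \<open>Separations\<close>

definition separation :: "'a graph \<Rightarrow> 'a set \<Rightarrow> 'a set \<Rightarrow> bool" where
  "separation G A B \<longleftrightarrow> A \<union> B = verts G \<and> (\<forall>u\<in>A - B. \<forall>v\<in>B - A. \<not> adjacent G u v)"

text \<open>The end \<open>\<omega>\<close> lies in \<open>B\<close>, with respect to a separation \<open>(A, B)\<close> of finite order; the
  component \<open>C\<close> is unique since ends are non-empty.  That \<open>\<omega>\<close> lies in \<open>A\<close> is obtained by
  swapping \<open>A\<close> and \<open>B\<close>.\<close>

definition end_lies_in :: "'a graph \<Rightarrow> (nat \<Rightarrow> 'a) set \<Rightarrow> 'a set \<Rightarrow> 'a set \<Rightarrow> bool" where
  "end_lies_in G \<omega> A B \<longleftrightarrow>
     (\<exists>C\<in>components (delete_verts G (A \<inter> B)). (\<forall>r\<in>\<omega>. eventually_in r C) \<and> C \<subseteq> B - A)"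

definition dominates :: "'a graph \<Rightarrow> 'a \<Rightarrow> (nat \<Rightarrow> 'a) set \<Rightarrow> bool" where
  "dominates G v \<omega> \<longleftrightarrow> v \<in> verts G \<and>
     \<not> (\<exists>A B. separation G A B \<and> finite (A \<inter> B) \<and> v \<in> A - B \<and> end_lies_in G \<omega> A B)"

definition undominated :: "'a graph \<Rightarrow> (nat \<Rightarrow> 'a) set \<Rightarrow> bool" where
  "undominated G \<omega> \<longleftrightarrow> \<not> (\<exists>v. dominates G v \<omega>)"


section \<open>Tree-decompositions\<close>

text \<open>For an edge \<open>st\<close> of \<open>T\<close>, \<open>tree_side T s t\<close> is the component \<open>T\<^sub>s\<close> of \<open>T - st\<close>
  that contains \<open>s\<close>, and \<open>part_side T P s t\<close> is the union \<open>X\<^sub>s\<close> of the parts on that side.\<close>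

definition tree_side :: "'t graph \<Rightarrow> 't \<Rightarrow> 't \<Rightarrow> 't set" where
  "tree_side T s t = component_of (delete_edge T s t) s"

definition part_side :: "'t graph \<Rightarrow> ('t \<Rightarrow> 'a set) \<Rightarrow> 't \<Rightarrow> 't \<Rightarrow> 'a set" where
  "part_side T P s t = (\<Union>u\<in>tree_side T s t. P u)"

text \<open>The last conjunct, read for both orientations of each edge of \<open>T\<close>, says that the
  associated separations are proper.\<close>

definition tree_decomposition :: "'a graph \<Rightarrow> 't graph \<Rightarrow> ('t \<Rightarrow> 'a set) \<Rightarrow> bool" where
  "tree_decomposition G T P \<longleftrightarrow> is_tree T \<and>
     verts G = (\<Union>t\<in>verts T. P t) \<and>
     (\<forall>e\<in>edges G. \<exists>t\<in>verts T. e \<subseteq> P t) \<and>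
     (\<forall>p. is_path T p \<longrightarrow> (\<forall>t\<in>set p. P (hd p) \<inter> P (last p) \<subseteq> P t)) \<and>
     (\<forall>s t. adjacent T s t \<longrightarrow> part_side T P s t - part_side T P t s \<noteq> {})"

definition adhesion :: "'t graph \<Rightarrow> ('t \<Rightarrow> 'a set) \<Rightarrow> enat" where
  "adhesion T P =
     (SUP (s, t) \<in> {(s, t). adjacent T s t}. ecard (part_side T P s t \<inter> part_side T P t s))"

definition associated_separations :: "'t graph \<Rightarrow> ('t \<Rightarrow> 'a set) \<Rightarrow> ('a set \<times> 'a set) set" where
  "associated_separations T P =
     {(part_side T P s t, part_side T P t s) | s t. adjacent T s t}"

definition displays :: "'a graph \<Rightarrow> 't graph \<Rightarrow> ('t \<Rightarrow> 'a set) \<Rightarrow> (nat \<Rightarrow> 'a) set \<Rightarrow> bool" where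
  "displays G T P \<omega> \<longleftrightarrow> adhesion T P \<noteq> \<infinity> \<and>
     (\<exists>\<mu>. ends T = {\<mu>} \<and>
       (\<forall>s t. adjacent T s t \<and> (\<forall>r\<in>\<mu>. eventually_in r (tree_side T t s)) \<longrightarrow>
         end_lies_in G \<omega> (part_side T P s t) (part_side T P t s)))"

definition Aut_invariant :: "'a graph \<Rightarrow> 't graph \<Rightarrow> ('t \<Rightarrow> 'a set) \<Rightarrow> bool" where
  "Aut_invariant G T P \<longleftrightarrow>
     (\<forall>\<phi>. automorphism G \<phi> \<longrightarrow>
       (\<forall>(A, B) \<in> associated_separations T P. (\<phi> ` A, \<phi> ` B) \<in> associated_separations T P))"

text \<open>HOL cannot quantify existentially over the type of tree nodes, so a concrete one has to be
  chosen.  Nothing is lost for infinite \<open>G\<close>: root \<open>T\<close> anywhere and send each node \<open>t\<close> other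
  than the root, with parent \<open>s\<close>, to a vertex in \<open>X\<^sub>t - X\<^sub>s\<close>.  Every fibre of this map lies on a
  finite path, so \<open>T\<close> has at most \<open>|V(G)|\<close> nodes and can be relabelled by elements of any type
  at least as large as \<open>'a\<close>.  Sets of oriented separations are such a type, and the usual one
  for nodes of trees built from separations.\<close>

type_synonym 'a tree_node = "('a set \<times> 'a set) set"

end

theory Submission
  imports Defs
begin

text \<open>Call a set of vertices \<open>inner\<close> if it has finite neighbourhood and the end lies outside of it.
  By Menger's theorem, finite vertex degree yields a least \<open>k\<close> such that every finite set lies in
  an inner set with at most \<open>k\<close> neighbours.  Consider the critical sets: the connected inner sets
  with exactly \<open>k\<close> neighbours none of whose inner supersets has fewer.  No automorphism maps one
  properly into itself, since its iterates would give a ray in an inner set; and only finitely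
  many critical sets cross a given one, since their neighbourhoods are tight separators.  Hence for
  each critical \<open>D\<close> some critical \<open>E \<supseteq> D\<close> has a neighbourhood avoiding the whole orbit of \<open>D\<close>; the
  least such \<open>E\<close> exists by submodularity, and its translates are pairwise equal or far apart.
  Repeating this with a critical set containing \<open>E\<close> and its neighbourhood gives an invariant
  laminar family exhausting the graph, in which levels increase strictly with inclusion.  Its
  members are the nodes of the tree, each joined to the least member properly containing it.\<close>


section \<open>Neighbourhoods and connected sets\<close>

text \<open>Orbits may be infinite and vertices may have infinite degree, so neither compactness nor
  counting vertices yields a minimal set. What replaces them is rigidity at the value k: a vertex in
  the neighbourhood S of a critical set E without a neighbour on the side of the end could be
  absorbed, giving an inner superset of E with fewer than k neighbours. So S is minimal seen from
  both sides, and only finitely many such separators of size k lie between two given vertices. Every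
  finiteness claim reduces to this one. The orbit is avoided for the sake of nestedness across
  levels. The sets chosen at earlier levels lie in the base set of a later level, so all their
  translates lie in its orbit; being connected, these lie inside or away from each member of the
  later level. Within one level the translates are uncrossed: union against intersection yields a
  least set, and the two differences separate translates that are not comparable. Far apart means
  without an edge between the sets, since the separations of two disjoint members joined by an edge
  need not be nested.\<close>

definition nbhd :: "'a graph \<Rightarrow> 'a set \<Rightarrow> 'a set" where
  "nbhd G X = {v \<in> verts G - X. \<exists>u\<in>X. adjacent G u v}"

text \<open>Every step stays in X, but the starting vertex is unrestricted:
  \<open>reach G X x x\<close> holds for all x. Hence the side condition that x lies in X in many
  later lemmas.\<close>

definition reach :: "'a graph \<Rightarrow> 'a set \<Rightarrow> 'a \<Rightarrow> 'a \<Rightarrow> bool" where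
  "reach G X = (\<lambda>u v. u \<in> X \<and> v \<in> X \<and> adjacent G u v)\<^sup>*\<^sup>*"

definition conn :: "'a graph \<Rightarrow> 'a set \<Rightarrow> bool" where
  "conn G X \<longleftrightarrow> (\<forall>x\<in>X. \<forall>y\<in>X. reach G X x y)"

definition component_in :: "'a graph \<Rightarrow> 'a set \<Rightarrow> 'a \<Rightarrow> 'a set" where
  "component_in G X x = {y. reach G X x y}"

lemma adjacent_symD: "adjacent G u v \<Longrightarrow> adjacent G v u"
  by (simp add: adjacent_def insert_commute)

lemma adjacent_in_verts:
  assumes "simple_graph G" "adjacent G u v"
  shows "u \<in> verts G" "v \<in> verts G" "u \<noteq> v"
  using assms unfolding simple_graph_def adjacent_def by (fastforce simp: doubleton_eq_iff)+

lemma nbhd_subset: "nbhd G X \<subseteq> verts G" "nbhd G X \<inter> X = {}"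
  by (auto simp: nbhd_def)

lemma nbhdI: "u \<in> X \<Longrightarrow> adjacent G u v \<Longrightarrow> v \<in> verts G \<Longrightarrow> v \<notin> X \<Longrightarrow> v \<in> nbhd G X"
  by (auto simp: nbhd_def)

lemma nbhdE:
  assumes "v \<in> nbhd G X"
  obtains u where "u \<in> X" "adjacent G u v" "v \<in> verts G" "v \<notin> X"
  using assms by (auto simp: nbhd_def)

lemma reach_refl [simp]: "reach G X x x"
  by (simp add: reach_def)

lemma reach_trans: "reach G X x y \<Longrightarrow> reach G X y z \<Longrightarrow> reach G X x z"
  by (simp add: reach_def)

lemma reach_step: "u \<in> X \<Longrightarrow> v \<in> X \<Longrightarrow> adjacent G u v \<Longrightarrow> reach G X u v"
  unfolding reach_def by (rule r_into_rtranclp) simp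

lemma reach_sym: "reach G X x y \<Longrightarrow> reach G X y x"
  unfolding reach_def by (rule sympD[OF symp_rtranclp]) (simp add: symp_def adjacent_symD)

lemma reach_mono: "reach G X x y \<Longrightarrow> X \<subseteq> Y \<Longrightarrow> reach G Y x y"
  unfolding reach_def by (erule rtranclp_mono[THEN predicate2D, rotated]) auto

lemma reach_closed:
  assumes "reach G X x y" "x \<in> Z" "\<And>u v. u \<in> Z \<Longrightarrow> u \<in> X \<Longrightarrow> v \<in> X \<Longrightarrow> adjacent G u v \<Longrightarrow> v \<in> Z"
  shows "y \<in> Z"
  using assms(1,2) unfolding reach_def by (induction rule: rtranclp_induct) (use assms(3) in auto)

lemma reach_in: "reach G X x y \<Longrightarrow> x \<in> X \<Longrightarrow> y \<in> X"
  using reach_closed[of G X x y X] by blast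

lemma connD: "conn G X \<Longrightarrow> x \<in> X \<Longrightarrow> y \<in> X \<Longrightarrow> reach G X x y"
  by (simp add: conn_def)

lemma conn_single: "conn G {x}"
  by (simp add: conn_def)

lemma conn_pair: "adjacent G x y \<Longrightarrow> conn G {x, y}"
  unfolding conn_def using reach_step[of x "{x,y}" y G, THEN reach_sym] reach_step[of x "{x,y}" y G]
  by auto

lemma conn_if_root: "(\<And>y. y \<in> X \<Longrightarrow> reach G X x y) \<Longrightarrow> conn G X"
  unfolding conn_def by (meson reach_sym reach_trans)

lemma conn_Un:
  assumes "conn G A" "conn G B" "A \<inter> B \<noteq> {}"
  shows "conn G (A \<union> B)"
proof -
  obtain x where x: "x \<in> A" "x \<in> B" using assms(3) by blast
  show ?thesis
    by (rule conn_if_root[of _ _ x]) (use x assms(1,2) in \<open>auto intro: reach_mono[OF connD]\<close>)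
qed

text \<open>A walk that leaves Z passes through its neighbourhood. Most comparisons between
  connected sets below are instances of this.\<close>

lemma conn_subset:
  assumes "conn G E" "E \<subseteq> verts G" "E \<inter> Z \<noteq> {}" "E \<inter> nbhd G Z = {}"
  shows "E \<subseteq> Z"
proof
  fix y assume y: "y \<in> E"
  obtain x where x: "x \<in> E" "x \<in> Z" using assms(3) by blast
  show "y \<in> Z"
    by (rule reach_closed[OF connD[OF assms(1) x(1) y] x(2)]) (use assms(2,4) in \<open>auto intro: nbhdI\<close>)
qed

text \<open>The vertices of a walk, kept as a finite connected set so that no list has to be
  handled.\<close>

lemma reach_finite:
  assumes "reach G X x y" "x \<in> X"
  shows "\<exists>P\<subseteq>X. finite P \<and> x \<in> P \<and> y \<in> P \<and> conn G P"
  using assms(1) unfolding reach_def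
proof (induction rule: rtranclp_induct)
  case base
  then show ?case using assms(2) conn_single by (intro exI[of _ "{x}"]) auto
next
  case (step y z)
  then obtain P where P: "P \<subseteq> X" "finite P" "x \<in> P" "y \<in> P" "conn G P" by auto
  have "conn G (P \<union> {y, z})"
    using P step.hyps by (intro conn_Un conn_pair) auto
  then show ?case using P step.hyps by (intro exI[of _ "P \<union> {y, z}"]) auto
qed

lemma component_in_subset: "x \<in> X \<Longrightarrow> component_in G X x \<subseteq> X"
  by (auto simp: component_in_def dest: reach_in)

lemma component_in_self: "x \<in> component_in G X x"
  by (simp add: component_in_def)

lemma component_in_superset:
  assumes "conn G A" "A \<subseteq> X" "x \<in> A"
  shows "A \<subseteq> component_in G X x"
  using assms reach_mono[OF connD[OF assms(1,3)] assms(2)] by (auto simp: component_in_def)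

lemma component_in_conn: assumes "x \<in> X" shows "conn G (component_in G X x)"
proof (rule conn_if_root)
  fix y assume "y \<in> component_in G X x"
  then have "reach G X x y" by (simp add: component_in_def)
  from reach_finite[OF this assms] obtain P where P: "P \<subseteq> X" "x \<in> P" "y \<in> P" "conn G P" by auto
  show "reach G (component_in G X x) x y"
    by (rule reach_mono[OF connD[OF P(4,2,3)] component_in_superset[OF P(4,1,2)]])
qed

lemma component_in_step: "y \<in> component_in G X x \<Longrightarrow> x \<in> X \<Longrightarrow> z \<in> X \<Longrightarrow> adjacent G y z \<Longrightarrow> z \<in> component_in G X x"
  unfolding component_in_def by (metis mem_Collect_eq reach_in reach_step reach_trans)

lemma nbhd_component_in: "x \<in> X \<Longrightarrow> nbhd G (component_in G X x) \<subseteq> nbhd G X"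
  unfolding nbhd_def using component_in_step[of _ G X x] component_in_subset[of x X G] by blast

lemma conn_finite_superset:
  assumes "finite X" "X \<subseteq> V" "conn G V"
  shows "\<exists>W. finite W \<and> X \<subseteq> W \<and> W \<subseteq> V \<and> conn G W"
  using assms(1,2)
proof (induction X)
  case empty
  then show ?case by (intro exI[of _ "{}"]) (simp add: conn_def)
next
  case (insert v X)
  then obtain W where W: "finite W" "X \<subseteq> W" "W \<subseteq> V" "conn G W" by auto
  show ?case
  proof (cases "W = {}")
    case True
    then show ?thesis using W insert.prems conn_single by (intro exI[of _ "{v}"]) auto
  next
    case False
    then obtain w where w: "w \<in> W" by blast
    obtain P where P: "P \<subseteq> V" "finite P" "w \<in> P" "v \<in> P" "conn G P"
      using reach_finite[OF connD[OF assms(3), of w v]] W w insert.prems by blast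
    show ?thesis using W P w conn_Un[OF W(4) P(5)] by (intro exI[of _ "W \<union> P"]) auto
  qed
qed

section \<open>Paths and components of the given definitions in terms of
  \<open>reach\<close>\<close>

lemma linked_iff_reach:
  "linked H u v \<longleftrightarrow> u \<in> verts H \<and> reach H (verts H) u v"
proof
  assume "linked H u v"
  then obtain p where p: "is_path H p" "hd p = u" "last p = v" by (auto simp: linked_def)
  have "p \<noteq> [] \<Longrightarrow> set p \<subseteq> verts H \<Longrightarrow> successively (adjacent H) p \<Longrightarrow> reach H (verts H) (hd p) (last p)" for p
  proof (induction p rule: induct_list012)
    case (3 x y zs)
    then have "reach H (verts H) y (last (y # zs))" by simp
    with 3 show ?case using reach_trans[OF reach_step, of x "verts H" y H] by simp
  qed auto
  with p show "u \<in> verts H \<and> reach H (verts H) u v"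
    by (auto simp: is_path_def)
next
  assume a: "u \<in> verts H \<and> reach H (verts H) u v"
  have "reach H (verts H) u v \<Longrightarrow> linked H u v"
    unfolding reach_def
  proof (induction rule: rtranclp_induct)
    case base
    show ?case using a by (auto simp: linked_def is_path_def intro!: exI[of _ "[u]"])
  next
    case (step y z)
    then obtain p where p: "is_path H p" "hd p = u" "last p = y" by (auto simp: linked_def)
    show ?case
    proof (cases "z \<in> set p")
      case True
      \<comment> \<open>A walk that returns to a vertex of the path is shortened by cutting the path
        there, which keeps the list distinct.\<close>
      then obtain a b where ab: "p = a @ z # b" by (meson split_list)
      have "is_path H (a @ [z])" using p(1) unfolding ab is_path_def
        by (auto simp: successively_append_iff)
      moreover have "hd (a @ [z]) = u" using p(2) ab by (cases a) auto
      ultimately show ?thesis unfolding linked_def by (intro exI[of _ "a @ [z]"]) auto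
    next
      case False
      have "is_path H (p @ [z])" using p step.hyps False unfolding is_path_def
        by (auto simp: successively_append_iff)
      then show ?thesis using p unfolding linked_def is_path_def
        by (intro exI[of _ "p @ [z]"]) auto
    qed
  qed
  with a show "linked H u v" by blast
qed

lemma adjacent_delete_verts: "adjacent (delete_verts G S) u v \<longleftrightarrow> adjacent G u v \<and> u \<notin> S \<and> v \<notin> S"
  by (auto simp: adjacent_def delete_verts_def)

lemma verts_delete_verts [simp]: "verts (delete_verts G S) = verts G - S"
  by (simp add: delete_verts_def)

lemma verts_delete_edge [simp]: "verts (delete_edge H u v) = verts H"
  by (simp add: delete_edge_def)

lemma adjacent_delete_edge: "adjacent (delete_edge H u v) x y \<longleftrightarrow> adjacent H x y \<and> {x, y} \<noteq> {u, v}"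
  by (auto simp: adjacent_def delete_edge_def)

lemma component_of_delete_verts:
  assumes "x \<in> verts G - S"
  shows "component_of (delete_verts G S) x = component_in G (verts G - S) x"
proof -
  have "reach (delete_verts G S) (verts G - S) = reach G (verts G - S)"
    unfolding reach_def adjacent_delete_verts
    by (rule arg_cong[of _ _ rtranclp]) auto
  then show ?thesis using assms by (auto simp: component_of_def component_in_def linked_iff_reach)
qed

lemma components_delete_verts:
  "components (delete_verts G S) = component_in G (verts G - S) ` (verts G - S)"
  unfolding components_def by (auto simp: component_of_delete_verts)

lemma connected_graph_iff: "connected_graph G \<longleftrightarrow> verts G \<noteq> {} \<and> conn G (verts G)"
  by (auto simp: connected_graph_def conn_def linked_iff_reach)

section \<open>Uncrossing inequalities for neighbourhoods\<close>

lemma card_add_le: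
  assumes "finite C" "finite D" "A \<union> B \<subseteq> C \<union> D" "A \<inter> B \<subseteq> C \<inter> D"
  shows "card A + card B \<le> card C + card D"
proof -
  have f: "finite A" "finite B" using assms by (meson finite_UnI finite_subset le_sup_iff)+
  have "card A + card B = card (A \<union> B) + card (A \<inter> B)" by (rule card_Un_Int[OF f])
  also have "\<dots> \<le> card (C \<union> D) + card (C \<inter> D)"
    using assms by (intro add_mono card_mono) auto
  also have "\<dots> = card C + card D" by (rule card_Un_Int[OF assms(1,2), symmetric])
  finally show ?thesis .
qed

lemma nbhd_Un_subset: "nbhd G (X \<union> Y) \<subseteq> nbhd G X \<union> nbhd G Y"
  by (auto simp: nbhd_def)

lemma nbhd_Int_subset: "nbhd G (X \<inter> Y) \<subseteq> nbhd G X \<union> nbhd G Y"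
  by (auto simp: nbhd_def)

lemma nbhd_Diff_subset: "X \<subseteq> verts G \<Longrightarrow> nbhd G (X - (Y \<union> nbhd G Y)) \<subseteq> nbhd G X \<union> nbhd G Y"
proof
  fix v assume X: "X \<subseteq> verts G" and v: "v \<in> nbhd G (X - (Y \<union> nbhd G Y))"
  then obtain u where u: "u \<in> X" "u \<notin> Y" "u \<notin> nbhd G Y" "adjacent G u v" by (blast elim: nbhdE)
  have "v \<notin> Y" using u(1,3) X nbhdI[OF _ adjacent_symD[OF u(4)]] u(2) by auto
  then show "v \<in> nbhd G X \<union> nbhd G Y" using v u unfolding nbhd_def by auto
qed

text \<open>Submodularity: a vertex counted twice on the left is a neighbour of both X and
  Y.\<close>

lemma card_nbhd_Un_Int:
  assumes "finite (nbhd G X)" "finite (nbhd G Y)"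
  shows "card (nbhd G (X \<union> Y)) + card (nbhd G (X \<inter> Y)) \<le> card (nbhd G X) + card (nbhd G Y)"
  by (rule card_add_le[OF assms]) (auto simp: nbhd_def)

text \<open>The same inequality for the other pair of opposite corners, with Y replaced by the
  complement of its closure. It serves to pull two sets apart instead of merging them.\<close>

lemma card_nbhd_Diff:
  assumes "finite (nbhd G X)" "finite (nbhd G Y)" "X \<subseteq> verts G" "Y \<subseteq> verts G"
  shows "card (nbhd G (X - (Y \<union> nbhd G Y))) + card (nbhd G (Y - (X \<union> nbhd G X)))
    \<le> card (nbhd G X) + card (nbhd G Y)"
proof (rule card_add_le[OF assms(1,2)])
  show "nbhd G (X - (Y \<union> nbhd G Y)) \<union> nbhd G (Y - (X \<union> nbhd G X)) \<subseteq> nbhd G X \<union> nbhd G Y"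
    using nbhd_Diff_subset[OF assms(3), of Y] nbhd_Diff_subset[OF assms(4), of X] by blast
  show "nbhd G (X - (Y \<union> nbhd G Y)) \<inter> nbhd G (Y - (X \<union> nbhd G X)) \<subseteq> nbhd G X \<inter> nbhd G Y"
  proof
    fix v assume v: "v \<in> nbhd G (X - (Y \<union> nbhd G Y)) \<inter> nbhd G (Y - (X \<union> nbhd G X))"
    then obtain x y where x: "x \<in> X" "x \<notin> Y" "x \<notin> nbhd G Y" "adjacent G x v"
      and y: "y \<in> Y" "y \<notin> X" "y \<notin> nbhd G X" "adjacent G y v" by (blast elim: nbhdE)
    have "v \<notin> X" using y nbhdI[OF _ adjacent_symD[OF y(4)]] assms(4) by auto
    moreover have "v \<notin> Y" using x nbhdI[OF _ adjacent_symD[OF x(4)]] assms(3) by auto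
    ultimately show "v \<in> nbhd G X \<inter> nbhd G Y" using v x(1,4) y(1,4) by (auto elim!: nbhdE intro: nbhdI)
  qed
qed

text \<open>Stronger than disjointness, as edges between X and Y are excluded too. For sets of
  vertices this makes the relation symmetric.\<close>

definition away :: "'a graph \<Rightarrow> 'a set \<Rightarrow> 'a set \<Rightarrow> bool" where
  "away G X Y \<longleftrightarrow> X \<inter> (Y \<union> nbhd G Y) = {}"

lemma away_sym:
  assumes "X \<subseteq> verts G" "away G X Y"
  shows "away G Y X"
proof -
  have "y \<notin> nbhd G X" if y: "y \<in> Y" for y
  proof
    assume "y \<in> nbhd G X"
    then obtain x where x: "x \<in> X" "adjacent G x y" by (auto simp: nbhd_def)
    have "x \<in> Y \<union> nbhd G Y" using nbhdI[OF y adjacent_symD[OF x(2)]] x(1) assms(1) by auto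
    then show False using assms(2) x(1) by (auto simp: away_def)
  qed
  then show ?thesis using assms(2) by (auto simp: away_def)
qed

lemma conn_subset_or_away:
  assumes "conn G E" "E \<subseteq> verts G" "E \<inter> nbhd G Z = {}"
  shows "E \<subseteq> Z \<or> away G E Z"
  using conn_subset[OF assms(1,2) _ assms(3)] assms(3) unfolding away_def by blast


section \<open>Menger's theorem\<close>

text \<open>Only the end in B is normalised, because it is the target that grows in the induction:
  an old path adapts to a larger target by truncation. E is an arbitrary relation, so that a graph
  is restricted by restricting E.\<close>

definition AB_path :: "('a \<Rightarrow> 'a \<Rightarrow> bool) \<Rightarrow> 'a set \<Rightarrow> 'a set \<Rightarrow> 'a list \<Rightarrow> bool" where
  "AB_path E A B p \<longleftrightarrow> p \<noteq> [] \<and> distinct p \<and> successively E p \<and> hd p \<in> A \<and> last p \<in> B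
     \<and> set (butlast p) \<inter> B = {}"

lemma AB_path_Int:
  assumes "AB_path E A B p"
  shows "set p \<inter> B = {last p}"
proof -
  have "set p = set (butlast p) \<union> {last p}"
    using assms by (cases p rule: rev_cases) (auto simp: AB_path_def)
  then show ?thesis using assms by (auto simp: AB_path_def)
qed

lemma AB_path_truncate:
  assumes "distinct p" "successively E p" "hd p \<in> A" "set p \<inter> B \<noteq> {}"
  shows "\<exists>q. AB_path E A B q \<and> set q \<subseteq> set p"
proof -
  have "\<exists>x\<in>set p. x \<in> B" using assms by blast
  then obtain ys x zs where p: "p = ys @ x # zs" "x \<in> B" "\<forall>y\<in>set ys. y \<notin> B"
    using split_list_first_prop[of p "\<lambda>x. x \<in> B"] by blast
  have "AB_path E A B (ys @ [x])"
    using assms p by (auto simp: AB_path_def successively_append_iff hd_append split: if_splits)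
  then show ?thesis using p(1) by (intro exI[of _ "ys @ [x]"]) auto
qed

text \<open>Each path of Q meets B' only in its last vertex, so tails inside B' that avoid all these
  last vertices and each other can be appended without creating intersections.\<close>

lemma extend_paths:
  assumes path: "\<And>q. q \<in> Q \<Longrightarrow> AB_path E A B' q" and disj: "disjoint_family_on set Q"
    and tail: "\<And>q. q \<in> Q \<Longrightarrow> set (t q) \<subseteq> B'" "\<And>q. q \<in> Q \<Longrightarrow> distinct (t q)"
      "\<And>q. q \<in> Q \<Longrightarrow> set (t q) \<inter> last ` Q = {}"
      "\<And>q. q \<in> Q \<Longrightarrow> successively E (last q # t q)"
    and B: "B \<subseteq> B'" "\<And>q. q \<in> Q \<Longrightarrow> last (last q # t q) \<in> B"
      "\<And>q. q \<in> Q \<Longrightarrow> set (butlast (last q # t q)) \<inter> B = {}"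
    and disj_t: "\<And>q r. q \<in> Q \<Longrightarrow> r \<in> Q \<Longrightarrow> q \<noteq> r \<Longrightarrow> set (t q) \<inter> set (t r) = {}"
  defines "R \<equiv> (\<lambda>q. q @ t q) ` Q"
  shows "\<forall>p\<in>R. AB_path E A B p" "disjoint_family_on set R" "card R = card Q"
    "last ` R = (\<lambda>q. last (last q # t q)) ` Q"
proof -
  have ne: "q \<noteq> []" if "q \<in> Q" for q using path[OF that] by (auto simp: AB_path_def)
  have dt: "set q \<inter> set (t r) = {}" if "q \<in> Q" "r \<in> Q" for q r
    using AB_path_Int[OF path[OF that(1)]] tail(1,3)[OF that(2)] that(1) by blast
  have l: "last (q @ t q) = last (last q # t q)" for q by (simp add: last_append)
  have bl: "set (butlast (q @ t q)) = set (butlast q) \<union> set (butlast (last q # t q))" if "q \<in> Q" for q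
  proof (cases "t q = []")
    case False
    have "set q = insert (last q) (set (butlast q))"
      using ne[OF that] by (cases q rule: rev_cases) auto
    then show ?thesis using False by (auto simp: butlast_append)
  qed simp
  show "\<forall>p\<in>R. AB_path E A B p"
  proof
    fix p assume "p \<in> R"
    then obtain q where q: "q \<in> Q" "p = q @ t q" by (auto simp: R_def)
    have "set (butlast q) \<inter> B = {}" using path[OF q(1)] B(1) by (auto simp: AB_path_def)
    moreover have "successively E (q @ t q)"
      using path[OF q(1)] tail(4)[OF q(1)] by (auto simp: AB_path_def successively_append_iff successively_Cons)
    ultimately show "AB_path E A B p"
      using q path[OF q(1)] tail(2)[OF q(1)] dt[OF q(1) q(1)] B(2,3)[OF q(1)] bl[OF q(1)] l[of q]
      unfolding AB_path_def by (simp add: Int_Un_distrib2 del: last_appendR)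
  qed
  have d: "set (q @ t q) \<inter> set (r @ t r) = {}" if "q \<in> Q" "r \<in> Q" "q \<noteq> r" for q r
    using dt[of q r] dt[of r q] disj_t[OF that] disjoint_family_onD[OF disj that] that by auto
  show "disjoint_family_on set R"
    unfolding R_def disjoint_family_on_def using d by blast
  have "inj_on (\<lambda>q. q @ t q) Q"
  proof (rule inj_onI, rule ccontr)
    fix q r assume "q \<in> Q" "r \<in> Q" "q @ t q = r @ t r" "q \<noteq> r"
    then show False using d[of q r] ne[of r] by auto
  qed
  then show "card R = card Q" unfolding R_def by (rule card_image)
  show "last ` R = (\<lambda>q. last (last q # t q)) ` Q"
    unfolding R_def image_image l ..
qed

lemma inj_on_last_AB_path:
  assumes "\<And>q. q \<in> Q \<Longrightarrow> AB_path E A B q" "disjoint_family_on set Q"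
  shows "inj_on last Q"
proof (rule inj_onI, rule ccontr)
  fix q r assume "q \<in> Q" "r \<in> Q" "last q = last r" "q \<noteq> r"
  moreover from this have "set q \<inter> set r = {}" using assms(2) by (auto simp: disjoint_family_on_def)
  ultimately show False using assms(1)[of q] assms(1)[of r] unfolding AB_path_def
    by (metis IntI empty_iff last_in_set)
qed

text \<open>The induction is on the total number of vertices of the given paths, with \<open>B\<close> varying, and
  so does not need the graph to be finite.\<close>

lemma Menger_augment:
  assumes "finite P" "\<forall>p\<in>P. AB_path E A B p" "disjoint_family_on set P" "card P < n"
    "\<And>S. finite S \<Longrightarrow> card S < n \<Longrightarrow> \<exists>p. AB_path E A B p \<and> set p \<inter> S = {}"
  shows "\<exists>Q. finite Q \<and> (\<forall>p\<in>Q. AB_path E A B p) \<and> disjoint_family_on set Q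
    \<and> card Q = Suc (card P) \<and> last ` P \<subseteq> last ` Q"
  using assms
proof (induction "\<Sum>p\<in>P. length p" arbitrary: P B rule: less_induct)
  case less
  note finP = less.prems(1) and pathP = less.prems(2) and disjP = less.prems(3)
  \<comment> \<open>The end vertices of P are fewer than n, so some path R avoids them. R may still
    cross the paths of P.\<close>
  have "card (last ` P) < n" using less.prems(4) card_image_le[OF finP, of last] by linarith
  then obtain R where R: "AB_path E A B R" "set R \<inter> last ` P = {}"
    using less.prems(5) finP by blast
  show ?case
  proof (cases "set R \<inter> \<Union>(set ` P) = {}")
    case True
    have "R \<noteq> []" using R(1) by (simp add: AB_path_def)
    then have "R \<notin> P" using True hd_in_set[OF \<open>R \<noteq> []\<close>] by blast
    moreover have "disjoint_family_on set (insert R P)"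
      using disjP True \<open>R \<notin> P\<close> unfolding disjoint_family_on_def by blast
    ultimately show ?thesis using R(1) pathP finP by (intro exI[of _ "insert R P"]) auto
  next
    case False
    then have "\<exists>x\<in>set R. x \<in> \<Union>(set ` P)" by blast
    then obtain R1 x R2 where Rx: "R = R1 @ x # R2" "x \<in> \<Union>(set ` P)" "\<forall>z\<in>set R2. z \<notin> \<Union>(set ` P)"
      using split_list_last_prop[of R "\<lambda>x. x \<in> \<Union>(set ` P)"] by blast
    then obtain p where p: "p \<in> P" "x \<in> set p" by blast
    then obtain p1 p2 where px: "p = p1 @ x # p2" by (meson split_list)
    have pathp: "AB_path E A B p" using pathP p by blast
    have p2: "p2 \<noteq> []" using R(2) p(1) Rx(1) px by force
    have xB: "x \<notin> B" using pathp p2 unfolding px AB_path_def by (auto simp: butlast_append)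
    have p1B: "set p1 \<inter> B = {}" using pathp unfolding px AB_path_def by (auto simp: butlast_append)
    \<comment> \<open>From x, the last vertex of R on a path of P, two tails lead to B: the rest
      \<open>p2\<close> of p and the rest \<open>R2\<close> of R. Both join the target and p is cut
      at x. Since R avoids the last vertex of p, \<open>p2\<close> is non-empty and the total length
      drops.\<close>
    define B' where "B' = B \<union> set (x # p2) \<union> set (x # R2)"
    define p' where "p' = p1 @ [x]"
    define P0 where "P0 = P - {p}"
    define P' where "P' = insert p' P0"
    have P: "P = insert p P0" "p \<notin> P0" "finite P0" using p(1) finP by (auto simp: P0_def)
    have dp: "set q \<inter> set p = {}" if "q \<in> P0" for q
      using disjP p(1) that by (auto simp: P0_def disjoint_family_on_def)
    have R2: "set R2 \<inter> set q = {}" if "q \<in> P" for q using Rx(3) that by blast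
    have distp: "distinct (p1 @ x # p2)" using pathp by (simp add: px AB_path_def)
    have distR: "distinct (R1 @ x # R2)" using R(1) by (simp add: Rx AB_path_def)
    have p'P0: "p' \<notin> P0"
    proof
      assume "p' \<in> P0"
      from dp[OF this] show False by (auto simp: p'_def px)
    qed
    have pathP': "\<forall>q\<in>P'. AB_path E A B' q"
    proof
      fix q assume "q \<in> P'"
      then consider "q = p'" | "q \<in> P0" by (auto simp: P'_def)
      then show "AB_path E A B' q"
      proof cases
        case 1
        have "successively E p'" "hd p' \<in> A" using pathp unfolding p'_def px AB_path_def
          by (auto simp: successively_append_iff hd_append split: if_splits)
        moreover have "set p1 \<inter> B' = {}" using distp p1B R2[OF p(1)] unfolding px B'_def by auto
        ultimately show ?thesis using distp unfolding 1 AB_path_def by (auto simp: p'_def B'_def)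
      next
        case 2
        then have q: "AB_path E A B q" using pathP P by blast
        have "set q \<inter> B' = set q \<inter> B"
          using dp[OF 2] R2[of q] 2 P unfolding B'_def px by auto
        then show ?thesis using q in_set_butlastD[of _ q] unfolding AB_path_def B'_def by blast
      qed
    qed
    have disjP': "disjoint_family_on set P'"
      using disjP dp unfolding P'_def disjoint_family_on_def P p'_def px by auto
    have cardP': "card P' = card P" using P p'P0 by (simp add: P'_def)
    have len: "(\<Sum>p\<in>P'. length p) < (\<Sum>p\<in>P. length p)"
      using P p'P0 p2 by (simp add: P'_def p'_def px)
    have finP': "finite P'" using P by (simp add: P'_def)
    \<comment> \<open>Every path to B contains a path to B', because B' contains B; so the
      separation hypothesis is inherited.\<close>
    have sepn: "\<exists>q. AB_path E A B' q \<and> set q \<inter> S = {}" if S: "finite S" "card S < n" for S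
    proof -
      obtain q where q: "AB_path E A B q" "set q \<inter> S = {}" using less.prems(5)[OF S] by blast
      have "set q \<inter> B' \<noteq> {}" using AB_path_Int[OF q(1)] by (auto simp: B'_def)
      then obtain q' where "AB_path E A B' q'" "set q' \<subseteq> set q"
        using AB_path_truncate[of q E A B'] q(1) unfolding AB_path_def by blast
      then show ?thesis using q(2) by blast
    qed
    obtain Q where Q: "finite Q" "\<And>q. q \<in> Q \<Longrightarrow> AB_path E A B' q" "disjoint_family_on set Q"
      "card Q = Suc (card P')" "last ` P' \<subseteq> last ` Q"
      using less.hyps[OF len finP' pathP' disjP' _ sepn] less.prems(4) cardP' by auto
    have injQ: "inj_on last Q" by (rule inj_on_last_AB_path[OF Q(2,3)])
    have injP': "inj_on last P'" by (rule inj_on_last_AB_path[OF _ disjP']) (use pathP' in blast)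
    \<comment> \<open>Q has one path more than P' and keeps all end vertices of P'. Hence exactly
      one end vertex y is new, and its position decides which tail goes where.\<close>
    have "card (last ` Q - last ` P') = 1"
      using card_Diff_subset[of "last ` P'" "last ` Q"] Q(1,4,5) finP' card_image[OF injQ] card_image[OF injP']
      by simp
    then obtain y where y: "last ` Q - last ` P' = {y}" by (meson card_1_singletonE)
    have lastP': "last ` P' = insert x (last ` P0)" by (simp add: P'_def p'_def)
    have lastQ: "last ` Q = insert y (insert x (last ` P0))" using y Q(5) lastP' by auto
    have yx: "y \<noteq> x" "y \<notin> last ` P0" using y lastP' by auto
    obtain qx where qx: "qx \<in> Q" "last qx = x" using lastQ by (metis image_iff insertI1 insertI2)
    obtain qy where qy: "qy \<in> Q" "last qy = y" using lastQ by (metis image_iff insertI1)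
    have qxy: "qx \<noteq> qy" using qx qy yx by auto
    have yB': "y \<in> B'" using Q(2)[OF qy(1)] qy(2) by (auto simp: AB_path_def)
    have lastP0: "last q \<in> set q \<and> last q \<in> B" if "q \<in> P0" for q
      using pathP that P unfolding AB_path_def by (metis insertI2 last_in_set)
    have other: "last q \<in> last ` P0" if "q \<in> Q" "q \<noteq> qx" "q \<noteq> qy" for q
    proof -
      have "last q \<noteq> x" "last q \<noteq> y" using inj_onD[OF injQ] that qx qy by metis+
      then show ?thesis using lastQ that(1) by blast
    qed
    have sucP: "successively E (x # p2)" and sucR: "successively E (x # R2)"
      using pathp R(1) unfolding px Rx(1) AB_path_def by (auto simp: successively_append_iff)
    have lp: "last (x # p2) = last p" "last (x # R2) = last R" by (simp_all add: px Rx(1))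
    have lB: "last p \<in> B" "last R \<in> B" using pathp R(1) by (auto simp: AB_path_def)
    have blB: "set (butlast (x # p2)) \<inter> B = {}" "set (butlast (x # R2)) \<inter> B = {}"
      using pathp R(1) unfolding px Rx(1) AB_path_def by (auto simp: butlast_append)
    have lastP: "last ` P = insert (last p) (last ` P0)" by (simp add: P)
    have P0p2: "set p2 \<inter> last ` P0 = {}" using dp lastP0 unfolding px by fastforce
    have P0R2: "set R2 \<inter> last ` P0 = {}" using R2 lastP0 P by fastforce
    have p2R2: "set p2 \<inter> set R2 = {}" using R2[OF p(1)] by (auto simp: px)
    \<comment> \<open>Common conclusion of the three cases: \<open>tx\<close> and \<open>ty\<close>
      extend the paths ending in x and y, while all other paths already end in B. The last condition
      keeps the end vertex of p, as the invariant on end vertices demands.\<close>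
    have fin: ?thesis if t: "set tx \<subseteq> B'" "set ty \<subseteq> B'" "set tx \<inter> set ty = {}" "distinct tx" "distinct ty"
        "set tx \<inter> last ` Q = {}" "set ty \<inter> last ` Q = {}"
        "successively E (x # tx)" "successively E (y # ty)"
        "last (x # tx) \<in> B" "last (y # ty) \<in> B"
        "set (butlast (x # tx)) \<inter> B = {}" "set (butlast (y # ty)) \<inter> B = {}"
        "last p \<in> {last (x # tx), last (y # ty)}" for tx ty
    proof -
      define t where "t q = (if q = qx then tx else if q = qy then ty else [])" for q
      have tq: "t qx = tx" "t qy = ty" using qxy by (auto simp: t_def)
      have tq0: "t q = []" if "q \<noteq> qx" "q \<noteq> qy" for q using that by (auto simp: t_def)
      have cs: "Pr q" if "q \<in> Q" "Pr qx" "Pr qy" "\<And>q. q \<in> Q \<Longrightarrow> last q \<in> B \<Longrightarrow> t q = [] \<Longrightarrow> Pr q" for q Pr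
      proof (cases "q = qx \<or> q = qy")
        case True
        then show ?thesis using that(2,3) by blast
      next
        case False
        then have "last q \<in> last ` P0" using other that(1) by blast
        then have "last q \<in> B" using lastP0 by auto
        then show ?thesis using that(1,4) False tq0 by blast
      qed
      have e: "set (t q) \<subseteq> B'" "distinct (t q)" "set (t q) \<inter> last ` Q = {}"
        "successively E (last q # t q)" "last (last q # t q) \<in> B"
        "set (butlast (last q # t q)) \<inter> B = {}" if "q \<in> Q" for q
        by (rule cs[OF that]; use t tq qx qy in simp)+
      have e2: "set (t q) \<inter> set (t r) = {}" if "q \<noteq> r" for q r
        using that t(3) by (auto simp: t_def)
      note ext = extend_paths[of Q E A B' t B, OF Q(2,3) e(1-4) _ e(5,6) e2]
      have BB': "B \<subseteq> B'" by (auto simp: B'_def)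
      define W where "W = (\<lambda>q. q @ t q) ` Q"
      have W: "\<forall>p\<in>W. AB_path E A B p" "disjoint_family_on set W" "card W = card Q"
        "last ` W = (\<lambda>q. last (last q # t q)) ` Q"
        unfolding W_def using ext BB' by blast+
      have "last p \<in> last ` W"
        using t(14) qx qy tq unfolding W(4) by (metis (no_types, lifting) image_iff insertE singletonD)
      moreover have "last ` P0 \<subseteq> last ` W"
      proof
        fix z assume z: "z \<in> last ` P0"
        then obtain q where q: "q \<in> Q" "last q = z" using lastQ by (metis image_iff insertI2)
        have "z \<noteq> x" using z lastP0 xB by auto
        then have "q \<noteq> qx" "q \<noteq> qy" using q qx qy yx z by auto
        then show "z \<in> last ` W" unfolding W(4) using q tq0 by (metis (mono_tags, lifting) image_iff last_ConsL)
      qed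
      ultimately show ?thesis using W Q(1,4) cardP' lastP
        by (intro exI[of _ W]) (auto simp: W_def)
    qed
    \<comment> \<open>If y lies on one of the two tails, its path follows the rest of that tail and
      the path to x takes the other one. If y is an old target vertex on neither tail, only the path
      to x is extended, along \<open>p2\<close>.\<close>
    consider (a) "y \<in> set p2" | (b) "y \<in> set R2" | (c) "y \<in> B" "y \<notin> set p2" "y \<notin> set R2"
      using yB' yx by (auto simp: B'_def)
    then show ?thesis
    proof cases
      case a
      then obtain a b where ab: "p2 = a @ y # b" by (meson split_list)
      show ?thesis
      proof (rule fin[of R2 b])
        show "set R2 \<inter> last ` Q = {}" using a p2R2 P0R2 distR unfolding lastQ by auto
        show "set b \<inter> last ` Q = {}" using P0p2 distp unfolding lastQ ab by auto
        show "successively E (y # b)" using sucP unfolding ab by (auto simp: successively_append_iff successively_Cons)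
        show "last (y # b) \<in> B" using lB lp ab by auto
        show "set (butlast (y # b)) \<inter> B = {}" using blB(1) unfolding ab by (auto simp: butlast_append split: if_splits)
        show "last p \<in> {last (x # R2), last (y # b)}" using lp ab by auto
      qed (use sucR lp lB blB distR distp p2R2 in \<open>auto simp: ab B'_def\<close>)
    next
      case b
      then obtain a b where ab: "R2 = a @ y # b" by (meson split_list)
      show ?thesis
      proof (rule fin[of p2 b])
        show "set p2 \<inter> last ` Q = {}" using b p2R2 P0p2 distp unfolding lastQ by auto
        show "set b \<inter> last ` Q = {}" using P0R2 distR unfolding lastQ ab by auto
        show "successively E (y # b)" using sucR unfolding ab by (auto simp: successively_append_iff successively_Cons)
        show "last (y # b) \<in> B" using lB lp ab by auto
        show "set (butlast (y # b)) \<inter> B = {}" using blB(2) unfolding ab by (auto simp: butlast_append split: if_splits)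
      qed (use sucP lp lB blB distR distp p2R2 in \<open>auto simp: ab B'_def\<close>)
    next
      case c
      show ?thesis
      proof (rule fin[of p2 "[]"])
        show "set p2 \<inter> last ` Q = {}" using c P0p2 distp unfolding lastQ by auto
      qed (use sucP lp lB blB distp c in \<open>auto simp: B'_def\<close>)
    qed
  qed
qed

lemma Menger:
  assumes "\<And>S. finite S \<Longrightarrow> card S < n \<Longrightarrow> \<exists>p. AB_path E A B p \<and> set p \<inter> S = {}"
  shows "\<exists>Q. finite Q \<and> (\<forall>p\<in>Q. AB_path E A B p) \<and> disjoint_family_on set Q \<and> card Q = n"
proof -
  have "m \<le> n \<Longrightarrow> \<exists>Q. finite Q \<and> (\<forall>p\<in>Q. AB_path E A B p) \<and> disjoint_family_on set Q \<and> card Q = m" for m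
  proof (induction m)
    case 0
    show ?case by (intro exI[of _ "{}"]) (simp add: disjoint_family_on_def)
  next
    case (Suc m)
    then obtain P where "finite P" "\<forall>p\<in>P. AB_path E A B p" "disjoint_family_on set P" "card P = m" by auto
    from Menger_augment[OF this(1-3), of n] this(4) Suc.prems assms show ?case by fastforce
  qed
  then show ?thesis by blast
qed


section \<open>Inner sets and disjoint rays\<close>

lemma chain_less:
  fixes lt :: "'b \<Rightarrow> 'b \<Rightarrow> bool"
  assumes "\<And>x y z. lt x y \<Longrightarrow> lt y z \<Longrightarrow> lt x z" "\<And>n. lt (r n) (r (Suc n))" "m < (n::nat)"
  shows "lt (r m) (r n)"
  using assms(3)
proof (induction n)
  case (Suc n)
  show ?case
  proof (cases "m = n")
    case False
    then have "lt (r m) (r n)" using Suc by simp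
    then show ?thesis using assms(1)[OF _ assms(2)] by blast
  qed (simp add: assms(2))
qed simp

text \<open>A vertex \<open>u\<close> moves to a neighbour that either lies in a later set of the chain, or is closer
  to the next set within the last \<open>A i\<close> containing \<open>u\<close>; hence no vertex is visited twice.\<close>

lemma ray_in_chain:
  fixes A :: "nat \<Rightarrow> 'a set"
  assumes sub: "\<And>i. A i \<subseteq> verts G" and con: "\<And>i. conn G (A i)"
    and meet: "\<And>i. A i \<inter> A (Suc i) \<noteq> {}" and fin: "\<And>v. finite {i. v \<in> A i}"
  shows "\<exists>r\<in>rays G. range r \<subseteq> (\<Union>i. A i)"
proof -
  have "\<forall>i. \<exists>x. x \<in> A i \<and> x \<in> A (Suc i)" using meet by blast
  then obtain t where t: "\<And>i. t i \<in> A i" "\<And>i. t i \<in> A (Suc i)" by metis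
  define l where "l u = Max {i. u \<in> A i}" for u
  define R where "R i = (\<lambda>u v. u \<in> A i \<and> v \<in> A i \<and> adjacent G u v)" for i
  define d where "d u = (LEAST n. (R (l u) ^^ n) u (t (l u)))" for u
  have l: "u \<in> A (l u)" if "u \<in> A i" for u i
    using Max_in[OF fin, of u] that unfolding l_def by auto
  have l_ge: "i \<le> l u" if "u \<in> A i" for u i
    unfolding l_def using Max_ge[OF fin] that by blast
  have d: "(R (l u) ^^ d u) u (t (l u))" if "u \<in> A i" for u i
  proof -
    have "\<exists>n. (R (l u) ^^ n) u (t (l u))"
      using connD[OF con l[OF that] t(1)] unfolding reach_def R_def by (simp add: rtranclp_is_Sup_relpowp)
    then show ?thesis unfolding d_def by (rule LeastI_ex)
  qed
  define lt where "lt u v \<longleftrightarrow> l u < l v \<or> l u = l v \<and> d v < d u" for u v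
  have step: "\<exists>v. adjacent G u v \<and> lt u v \<and> v \<in> (\<Union>i. A i)" if u: "u \<in> A i" for u i
  proof (cases "d u")
    case 0
    \<comment> \<open>Distance 0 cannot occur: the link vertex \<open>t (l u)\<close> also lies in
      the next set, against the choice of \<open>l u\<close> as a maximum.\<close>
    then have "u = t (l u)" using d[OF u] by simp
    then have "u \<in> A (Suc (l u))" using t(2)[of "l u"] by simp
    from l_ge[OF this] show ?thesis by simp
  next
    case (Suc n)
    then obtain v where v: "R (l u) u v" "(R (l u) ^^ n) v (t (l u))"
      using d[OF u] relpowp_Suc_D2[of n "R (l u)" u] by auto
    have "v \<in> A (l u)" using v by (simp add: R_def)
    then have "l u \<le> l v" by (rule l_ge)
    moreover have "l u = l v \<Longrightarrow> d v \<le> n" using v(2) unfolding d_def by (metis Least_le)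
    ultimately have "lt u v" using Suc unfolding lt_def by force
    then show ?thesis using v by (auto simp: R_def)
  qed
  define U where "U = (\<Union>i. A i)"
  have "\<exists>r. \<forall>n. r n \<in> U \<and> (adjacent G (r n) (r (Suc n)) \<and> lt (r n) (r (Suc n)))"
  proof (rule dependent_nat_choice)
    show "\<exists>x. x \<in> U" using t(1) by (auto simp: U_def)
    show "\<exists>y. y \<in> U \<and> (adjacent G x y \<and> lt x y)" if "x \<in> U" for x n
      using that step unfolding U_def by blast
  qed
  then obtain r where r: "\<And>n. r n \<in> U" "\<And>n. adjacent G (r n) (r (Suc n))" "\<And>n. lt (r n) (r (Suc n))"
    by blast
  have "lt (r m) (r n)" if "m < n" for m n
    by (rule chain_less[of lt r, OF _ r(3) that]) (auto simp: lt_def)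
  then have "r m \<noteq> r n" if "m < n" for m n using that unfolding lt_def by fastforce
  then have "inj r" by (metis injI linorder_neqE_nat)
  then show ?thesis using r sub unfolding U_def rays_def by blast
qed

text \<open>With a finite neighbourhood, that the end lies outside can be expressed by rays alone.
  In this form the notion passes to unions, to subsets with finite neighbourhood and to images under
  automorphisms; such sets may be infinite.\<close>

definition inner :: "'a graph \<Rightarrow> 'a set \<Rightarrow> bool" where
  "inner G F \<longleftrightarrow> F \<subseteq> verts G \<and> finite (nbhd G F) \<and> (\<forall>r\<in>rays G. finite {n. r n \<in> F})"

lemma inner_empty: "inner G {}"
  by (simp add: inner_def nbhd_def)

lemma inner_subset:
  assumes "inner G F" "F' \<subseteq> F" "finite (nbhd G F')"
  shows "inner G F'"
proof -
  have "finite {n. r n \<in> F'}" if "r \<in> rays G" for r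
    by (rule finite_subset[of _ "{n. r n \<in> F}"]) (use assms that in \<open>auto simp: inner_def\<close>)
  then show ?thesis using assms by (auto simp: inner_def)
qed

lemma inner_Un: "inner G F \<Longrightarrow> inner G F' \<Longrightarrow> inner G (F \<union> F')"
  unfolding inner_def using finite_subset[OF nbhd_Un_subset[of G F F']] by (simp add: Collect_disj_eq)

lemma inner_Int: "inner G F \<Longrightarrow> inner G F' \<Longrightarrow> inner G (F \<inter> F')"
  by (rule inner_subset[of G F]) (simp_all add: inner_def finite_subset[OF nbhd_Int_subset])

lemma inner_component: "inner G F \<Longrightarrow> x \<in> F \<Longrightarrow> inner G (component_in G F x)"
  by (rule inner_subset[OF _ component_in_subset])
    (simp_all add: inner_def finite_subset[OF nbhd_component_in])

lemma inner_no_ray: "inner G F \<Longrightarrow> r \<in> rays G \<Longrightarrow> \<not> range r \<subseteq> F"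
proof
  assume "inner G F" "r \<in> rays G" "range r \<subseteq> F"
  then have "finite {n. r n \<in> F}" "{n. r n \<in> F} = UNIV" by (auto simp: inner_def)
  then show False by simp
qed

lemma conn_path: "successively (adjacent G) p \<Longrightarrow> conn G (set p)"
proof (induction p rule: induct_list012)
  case (3 x y zs)
  then have "conn G ({x, y} \<union> set (y # zs))" by (intro conn_Un conn_pair) auto
  then show ?case by (simp add: insert_commute)
qed (auto simp: conn_def)

lemma reach_path:
  assumes "reach G X x y" "x \<in> X" "X \<subseteq> verts G"
  shows "\<exists>p. p \<noteq> [] \<and> distinct p \<and> successively (adjacent G) p \<and> set p \<subseteq> X \<and> hd p = x \<and> last p = y"
proof -
  let ?H = "delete_verts G (verts G - X)"
  have X: "verts G - (verts G - X) = X" using assms(3) by blast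
  have "y \<in> component_of ?H x"
    using component_of_delete_verts[of x G "verts G - X"] assms by (simp add: X component_in_def)
  then obtain p where p: "is_path ?H p" "hd p = x" "last p = y" by (auto simp: component_of_def linked_def)
  have "successively (adjacent G) p"
    using p(1) unfolding is_path_def adjacent_delete_verts by (auto elim: successively_mono)
  then show ?thesis using p X by (intro exI[of _ p]) (auto simp: is_path_def)
qed

text \<open>All that the construction uses about the end, stated through the rays of G: they all
  belong to the only end. \<open>end_side\<close> provides the component where they live, and
  \<open>inner_cover\<close> expresses that no vertex dominates the end.\<close>

locale one_end =
  fixes G :: "'a graph"
  assumes simple: "simple_graph G" and conn_verts: "conn G (verts G)"
    and rays_nonempty: "rays G \<noteq> {}"
    and end_side: "\<And>S. finite S \<Longrightarrow> S \<subseteq> verts G \<Longrightarrow>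
      \<exists>C \<subseteq> verts G - S. conn G C \<and> nbhd G C \<subseteq> S \<and> (\<forall>r\<in>rays G. finite {n. r n \<notin> C})"
    and inner_cover: "\<And>v. v \<in> verts G \<Longrightarrow> \<exists>F. inner G F \<and> v \<in> F"
begin

lemma inner_finite_cover:
  assumes "finite X" "X \<subseteq> verts G"
  shows "\<exists>F. inner G F \<and> X \<subseteq> F"
  using assms
proof (induction X)
  case (insert v X)
  then obtain F where "inner G F" "X \<subseteq> F" by auto
  moreover obtain F' where "inner G F'" "v \<in> F'" using inner_cover insert.prems by auto
  ultimately show ?case using inner_Un[of G F F'] by blast
qed (use inner_empty in auto)

lemma inner_closure_cover:
  assumes "inner G F"
  shows "\<exists>F'. inner G F' \<and> F \<union> nbhd G F \<subseteq> F'"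
proof -
  obtain F' where "inner G F'" "nbhd G F \<subseteq> F'"
    using inner_finite_cover[of "nbhd G F"] assms nbhd_subset(1)[of G F] by (auto simp: inner_def)
  then show ?thesis using inner_Un[OF assms] by blast
qed

text \<open>Menger's theorem applies, since a small separator between the two neighbourhoods would be
  the neighbourhood of an inner set containing \<open>F\<close>.\<close>

lemma linkage:
  assumes F: "inner G F" "\<And>F''. inner G F'' \<Longrightarrow> F \<subseteq> F'' \<Longrightarrow> card (nbhd G F) \<le> card (nbhd G F'')"
    and F': "inner G F'" "F \<union> nbhd G F \<subseteq> F'"
  shows "\<exists>p. (\<forall>v\<in>nbhd G F. hd (p v) = v \<and> p v \<noteq> [] \<and> successively (adjacent G) (p v)
      \<and> set (p v) \<subseteq> F' \<union> nbhd G F' - F \<and> set (p v) \<inter> nbhd G F' = {last (p v)})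
    \<and> disjoint_family_on (\<lambda>v. set (p v)) (nbhd G F)"
proof -
  \<comment> \<open>The paths are kept between the two neighbourhoods, so that linkages of
    consecutive pairs can overlap only in the neighbourhood they share.\<close>
  define Q where "Q = F' \<union> nbhd G F' - F"
  define E where "E = (\<lambda>u v. u \<in> Q \<and> v \<in> Q \<and> adjacent G u v)"
  have QV: "Q \<subseteq> verts G" using F'(1) nbhd_subset(1)[of G F'] by (auto simp: Q_def inner_def)
  have AQ: "nbhd G F \<subseteq> Q" using F'(2) nbhd_subset(2)[of G F] by (auto simp: Q_def)
  have sep: "\<exists>p. AB_path E (nbhd G F) (nbhd G F') p \<and> set p \<inter> S = {}"
    if S: "finite S" "card S < card (nbhd G F)" for S
  proof (rule ccontr)
    assume no: "\<not> ?thesis"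
    \<comment> \<open>W is what S leaves reachable from the neighbourhood of F. It does not get to
      the neighbourhood of F', so adding W to F gives an inner set inside F' all of whose neighbours
      lie in S.\<close>
    define W where "W = {v. \<exists>a\<in>nbhd G F - S. reach G (Q - S) a v}"
    have WQ: "W \<subseteq> Q - S" using AQ by (auto simp: W_def dest!: reach_in)
    have W_B: "v \<notin> nbhd G F'" if w: "v \<in> W" for v
    proof
      assume v: "v \<in> nbhd G F'"
      obtain a where a: "a \<in> nbhd G F - S" "reach G (Q - S) a v" using w unfolding W_def by blast
      obtain p where p: "p \<noteq> []" "distinct p" "successively (adjacent G) p" "set p \<subseteq> Q - S" "hd p = a" "last p = v"
        using reach_path[OF a(2)] a(1) AQ QV by blast
      have "successively E p"
        by (rule successively_mono[OF p(3)]) (use p(4) in \<open>auto simp: E_def\<close>)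
      moreover have "set p \<inter> nbhd G F' \<noteq> {}" using v p(1,6) last_in_set by blast
      ultimately obtain q where "AB_path E (nbhd G F) (nbhd G F') q" "set q \<subseteq> set p"
        using AB_path_truncate[OF p(2), of E "nbhd G F" "nbhd G F'"] a(1) p(5) by blast
      then show False using no p(4) by blast
    qed
    have "nbhd G (F \<union> W) \<subseteq> S"
    proof
      fix v assume v: "v \<in> nbhd G (F \<union> W)"
      show "v \<in> S"
      proof (rule ccontr)
        assume vS: "v \<notin> S"
        obtain u where u: "u \<in> F \<union> W" "adjacent G u v" and v': "v \<in> verts G" "v \<notin> F" "v \<notin> W"
          using v by (blast elim: nbhdE)
        show False
        proof (cases "u \<in> F")
          case True
          then have "v \<in> nbhd G F" using u v' by (auto intro: nbhdI)
          then have "v \<in> W" unfolding W_def using vS by (intro CollectI bexI[of _ v]) auto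
          then show False using v' by blast
        next
          case False
          then have uW: "u \<in> W" using u by blast
          then have "u \<in> F'" using WQ W_B by (auto simp: Q_def)
          then have "v \<in> Q" using u v' nbhdI[of u F' G v] by (auto simp: Q_def)
          then have "reach G (Q - S) u v" using uW WQ vS u(2) by (intro reach_step) auto
          moreover obtain a where "a \<in> nbhd G F - S" "reach G (Q - S) a u" using uW unfolding W_def by blast
          ultimately have "v \<in> W" unfolding W_def by (intro CollectI bexI[of _ a]) (rule reach_trans)
          then show False using v' by blast
        qed
      qed
    qed
    moreover have "F \<union> W \<subseteq> F'" using F'(2) WQ W_B by (auto simp: Q_def)
    ultimately have "inner G (F \<union> W)" "card (nbhd G (F \<union> W)) \<le> card S"
      using S(1) by (auto intro!: inner_subset[OF F'(1)] card_mono elim: finite_subset)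
    then show False using F(2)[of "F \<union> W"] S(2) by simp
  qed
  obtain P where P: "finite P" "\<forall>p\<in>P. AB_path E (nbhd G F) (nbhd G F') p" "disjoint_family_on set P"
      "card P = card (nbhd G F)"
    using Menger[OF sep] by blast
  have "inj_on hd P"
  proof (rule inj_onI, rule ccontr)
    fix p q assume "p \<in> P" "q \<in> P" "hd p = hd q" "p \<noteq> q"
    moreover from this have "set p \<inter> set q = {}" using P(3) by (auto simp: disjoint_family_on_def)
    ultimately show False using P(2) unfolding AB_path_def by (metis IntI empty_iff hd_in_set)
  qed
  \<comment> \<open>As many disjoint paths as there are starting vertices: every vertex of the
    neighbourhood of F starts exactly one.\<close>
  then have "card (hd ` P) = card (nbhd G F)" using P(4) by (simp add: card_image)
  moreover have "hd ` P \<subseteq> nbhd G F" using P(2) by (auto simp: AB_path_def)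
  ultimately have hdP: "hd ` P = nbhd G F" using F(1) by (simp add: inner_def card_subset_eq)
  have "\<forall>v\<in>nbhd G F. \<exists>p. p \<in> P \<and> hd p = v" by (auto simp flip: hdP)
  then obtain p where p: "\<And>v. v \<in> nbhd G F \<Longrightarrow> p v \<in> P \<and> hd (p v) = v" by metis
  have "hd (p v) = v \<and> p v \<noteq> [] \<and> successively (adjacent G) (p v)
      \<and> set (p v) \<subseteq> Q \<and> set (p v) \<inter> nbhd G F' = {last (p v)}" if v: "v \<in> nbhd G F" for v
  proof -
    have pv: "AB_path E (nbhd G F) (nbhd G F') (p v)" using P(2) p v by blast
    have s: "successively E (p v)" using pv by (simp add: AB_path_def)
    have "successively E xs \<Longrightarrow> xs \<noteq> [] \<Longrightarrow> hd xs \<in> Q \<Longrightarrow> set xs \<subseteq> Q" for xs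
      by (induction xs rule: induct_list012) (auto simp: E_def)
    from this[OF s] have "set (p v) \<subseteq> Q" using pv p[OF v] AQ v by (simp add: AB_path_def subsetD)
    moreover have "successively (adjacent G) (p v)" by (rule successively_mono[OF s]) (auto simp: E_def)
    ultimately show ?thesis using AB_path_Int[OF pv] pv p[OF v] by (auto simp: AB_path_def)
  qed
  moreover have "disjoint_family_on (\<lambda>v. set (p v)) (nbhd G F)"
    unfolding disjoint_family_on_def
  proof (intro ballI impI)
    fix v w assume vw: "v \<in> nbhd G F" "w \<in> nbhd G F" "v \<noteq> w"
    then have "p v \<noteq> p w" using p[OF vw(1)] p[OF vw(2)] by auto
    then show "set (p v) \<inter> set (p w) = {}" using disjoint_family_onD[OF P(3)] p vw by blast
  qed
  ultimately show ?thesis unfolding Q_def by blast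
qed

text \<open>Supersets of F still contain X, so an F with fewest neighbours among the inner sets
  containing X cannot be improved by enlarging it. This is the hypothesis of
  \<open>linkage\<close>.\<close>

lemma least_inner:
  assumes "inner G F" "X \<subseteq> F"
  shows "\<exists>F. inner G F \<and> X \<subseteq> F \<and>
    (\<forall>F''. inner G F'' \<longrightarrow> F \<subseteq> F'' \<longrightarrow> card (nbhd G F) \<le> card (nbhd G F''))"
proof -
  have "\<exists>F. (inner G F \<and> X \<subseteq> F) \<and> (\<forall>F''. inner G F'' \<and> X \<subseteq> F'' \<longrightarrow> card (nbhd G F) \<le> card (nbhd G F''))"
    by (rule ex_has_least_nat[of _ F]) (use assms in blast)
  then show ?thesis by (meson subset_trans)
qed

text \<open>A sequence of inner sets, each with no better superset and each containing the closure
  of the previous one, has all consecutive neighbourhoods linked. Following the links outwards gives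
  one ray for every neighbour of the first set.\<close>

lemma disjoint_rays:
  assumes X: "finite X" "X \<subseteq> verts G" and n: "\<And>F. inner G F \<Longrightarrow> X \<subseteq> F \<Longrightarrow> n \<le> card (nbhd G F)"
  shows "\<exists>R \<subseteq> rays G. finite R \<and> n \<le> card R \<and> disjoint_family_on range R"
proof -
  define ok where "ok F \<longleftrightarrow> inner G F \<and> X \<subseteq> F \<and>
    (\<forall>F''. inner G F'' \<longrightarrow> F \<subseteq> F'' \<longrightarrow> card (nbhd G F) \<le> card (nbhd G F''))" for F
  have "\<exists>F. \<forall>i::nat. ok (F i) \<and> F i \<union> nbhd G (F i) \<subseteq> F (Suc i)"
  proof (rule dependent_nat_choice)
    show "\<exists>F. ok F" using inner_finite_cover[OF X] least_inner unfolding ok_def by blast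
    fix F assume "ok F"
    show "\<exists>F'. ok F' \<and> F \<union> nbhd G F \<subseteq> F'"
    proof -
      obtain F1 where F1: "inner G F1" "F \<union> nbhd G F \<subseteq> F1"
        using inner_closure_cover[of F] \<open>ok F\<close> by (auto simp: ok_def)
      obtain F2 where "inner G F2" "F \<union> nbhd G F \<subseteq> F2"
        "\<forall>F''. inner G F'' \<longrightarrow> F2 \<subseteq> F'' \<longrightarrow> card (nbhd G F2) \<le> card (nbhd G F'')"
        using least_inner[OF F1] by blast
      then show ?thesis using \<open>ok F\<close> unfolding ok_def by (intro exI[of _ F2]) auto
    qed
  qed
  then obtain F where F: "\<And>i. ok (F i)" "\<And>i::nat. F i \<union> nbhd G (F i) \<subseteq> F (Suc i)" by blast
  have inner: "inner G (F i)" for i using F(1) by (simp add: ok_def)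
  define Q where "Q i = F (Suc i) \<union> nbhd G (F (Suc i)) - F i" for i
  have mono: "F i \<subseteq> F j" if "i \<le> j" for i j
    using that by (rule lift_Suc_mono_le[of F, rotated]) (use F(2) in blast)
  have QQ: "Q i \<inter> Q j = {}" if "Suc i < j" for i j
  proof -
    have "F (Suc i) \<union> nbhd G (F (Suc i)) \<subseteq> F j" using F(2)[of "Suc i"] mono[of "Suc (Suc i)" j] that by auto
    then show ?thesis by (auto simp: Q_def)
  qed
  have QQ1: "Q i \<inter> Q (Suc i) \<subseteq> nbhd G (F (Suc i))" for i by (auto simp: Q_def)
  have "\<forall>i. \<exists>p. (\<forall>v\<in>nbhd G (F i). hd (p v) = v \<and> p v \<noteq> [] \<and> successively (adjacent G) (p v)
      \<and> set (p v) \<subseteq> Q i \<and> set (p v) \<inter> nbhd G (F (Suc i)) = {last (p v)})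
    \<and> disjoint_family_on (\<lambda>v. set (p v)) (nbhd G (F i))"
  proof
    fix i
    show "\<exists>p. (\<forall>v\<in>nbhd G (F i). hd (p v) = v \<and> p v \<noteq> [] \<and> successively (adjacent G) (p v)
      \<and> set (p v) \<subseteq> Q i \<and> set (p v) \<inter> nbhd G (F (Suc i)) = {last (p v)})
    \<and> disjoint_family_on (\<lambda>v. set (p v)) (nbhd G (F i))"
      unfolding Q_def by (rule linkage) (use F(1)[of i] F(2) inner in \<open>auto simp: ok_def\<close>)
  qed
  then obtain p where p: "\<And>i v. v \<in> nbhd G (F i) \<Longrightarrow> hd (p i v) = v \<and> p i v \<noteq> [] \<and>
        successively (adjacent G) (p i v) \<and> set (p i v) \<subseteq> Q i \<and>
        set (p i v) \<inter> nbhd G (F (Suc i)) = {last (p i v)}"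
      "\<And>i. disjoint_family_on (\<lambda>v. set (p i v)) (nbhd G (F i))"
    by metis
  \<comment> \<open>\<open>pos v i\<close> is the vertex at which the route started at v meets the
    i-th neighbourhood; the next path on this route starts there.\<close>
  define pos where "pos v = rec_nat v (\<lambda>i x. last (p i x))" for v
  have pos0: "pos v 0 = v" and posS: "pos v (Suc i) = last (p i (pos v i))" for v i
    by (simp_all add: pos_def)
  have pos_in: "pos v i \<in> nbhd G (F i)" if "v \<in> nbhd G (F 0)" for v i
  proof (induction i)
    case (Suc i)
    then show ?case using p(1)[OF Suc] unfolding posS by blast
  qed (simp add: pos0 that)
  have pos_neq: "pos v i \<noteq> pos w i" if "v \<in> nbhd G (F 0)" "w \<in> nbhd G (F 0)" "v \<noteq> w" for v w i
  proof (induction i)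
    case (Suc i)
    have "set (p i (pos v i)) \<inter> set (p i (pos w i)) = {}"
      using disjoint_family_onD[OF p(2) pos_in[OF that(1)] pos_in[OF that(2)] Suc] .
    then show ?case using p(1)[OF pos_in[OF that(1)]] p(1)[OF pos_in[OF that(2)]] unfolding posS
      by (metis disjoint_iff last_in_set)
  qed (simp add: pos0 that)
  define A where "A v i = set (p i (pos v i))" for v i
  have AQ: "A v i \<subseteq> Q i" if "v \<in> nbhd G (F 0)" for v i
    using p(1)[OF pos_in[OF that]] by (simp add: A_def)
  have posA: "pos v i \<in> A v i" if "v \<in> nbhd G (F 0)" for v i
    using p(1)[OF pos_in[OF that], of i] hd_in_set unfolding A_def by metis
  have posSA: "pos v (Suc i) \<in> A v i" if "v \<in> nbhd G (F 0)" for v i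
    using p(1)[OF pos_in[OF that], of i] last_in_set unfolding A_def posS by metis
  have disj: "A v i \<inter> A w i = {}" if "v \<in> nbhd G (F 0)" "w \<in> nbhd G (F 0)" "v \<noteq> w" for v w i
    using disjoint_family_onD[OF p(2) pos_in[OF that(1)] pos_in[OF that(2)] pos_neq[OF that]]
    by (simp add: A_def)
  \<comment> \<open>Layers with a gap between them are disjoint. Adjacent layers share only vertices
    of the neighbourhood between them, and there the path of v has a single vertex, which is also
    the start of its next path.\<close>
  have disj_less: "A v i \<inter> A w j = {}" if vw: "v \<in> nbhd G (F 0)" "w \<in> nbhd G (F 0)" "v \<noteq> w" and "i < j" for v w i j
  proof (cases "j = Suc i")
    case True
    have "A v i \<inter> A w j \<subseteq> A v i \<inter> nbhd G (F (Suc i))"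
      using AQ[OF vw(1), of i] AQ[OF vw(2), of j] QQ1[of i] True by blast
    also have "\<dots> = {pos v j}" using p(1)[OF pos_in[OF vw(1)], of i] unfolding A_def True posS by blast
    finally show ?thesis using posA[OF vw(1), of j] disj[OF vw, of j] by blast
  next
    case False
    then show ?thesis using QQ[of i j] AQ[OF vw(1), of i] AQ[OF vw(2), of j] that(4) by fastforce
  qed
  \<comment> \<open>Any ray in the union of the paths on a route will do, so the paths are treated
    as connected sets and never concatenated.\<close>
  have "\<exists>r\<in>rays G. range r \<subseteq> (\<Union>i. A v i)" if v: "v \<in> nbhd G (F 0)" for v
  proof (rule ray_in_chain)
    show "A v i \<subseteq> verts G" for i
      using AQ[OF v, of i] inner[of "Suc i"] nbhd_subset(1)[of G "F (Suc i)"] by (auto simp: Q_def inner_def)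
    show "conn G (A v i)" for i using p(1)[OF pos_in[OF v]] unfolding A_def by (intro conn_path) blast
    show "A v i \<inter> A v (Suc i) \<noteq> {}" for i using posA[OF v, of "Suc i"] posSA[OF v, of i] by blast
    show "finite {i. x \<in> A v i}" for x
    proof (cases "\<exists>i. x \<in> A v i")
      case True
      then obtain i where i: "x \<in> A v i" by blast
      have "j \<le> Suc i" if "x \<in> A v j" for j
      proof (rule ccontr)
        assume "\<not> j \<le> Suc i"
        then have "Q i \<inter> Q j = {}" by (intro QQ) simp
        then show False using AQ[OF v, of i] AQ[OF v, of j] i that by blast
      qed
      then have "{i. x \<in> A v i} \<subseteq> {..Suc i}" by blast
      then show ?thesis by (rule finite_subset) simp
    qed simp
  qed
  then obtain r where r: "\<And>v. v \<in> nbhd G (F 0) \<Longrightarrow> r v \<in> rays G \<and> range (r v) \<subseteq> (\<Union>i. A v i)" by metis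
  have rr: "range (r v) \<inter> range (r w) = {}" if vw: "v \<in> nbhd G (F 0)" "w \<in> nbhd G (F 0)" "v \<noteq> w" for v w
  proof -
    have "A v i \<inter> A w j = {}" for i j
      using disj[OF vw] disj_less[OF vw, of i j] disj_less[OF vw(2,1), of j i] vw(3)
      by (metis Int_commute linorder_neqE_nat)
    then have "(\<Union>i. A v i) \<inter> (\<Union>i. A w i) = {}" by blast
    then show ?thesis using r[OF vw(1)] r[OF vw(2)] by blast
  qed
  have "inj_on r (nbhd G (F 0))" using rr by (metis UNIV_not_empty image_is_empty inf.idem inj_onI)
  then have "card (r ` nbhd G (F 0)) = card (nbhd G (F 0))" by (rule card_image)
  moreover have "n \<le> card (nbhd G (F 0))" using n F(1)[of 0] by (simp add: ok_def)
  moreover have "disjoint_family_on range (r ` nbhd G (F 0))"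
    using rr unfolding disjoint_family_on_def by blast
  ultimately show ?thesis using r inner[of 0] by (intro exI[of _ "r ` nbhd G (F 0)"]) (auto simp: inner_def)
qed

text \<open>The vertex degree d itself is a bound: a finite set forcing d + 1 neighbours would yield
  d + 1 disjoint rays.\<close>

lemma inner_card_bound:
  assumes "vertex_degree (rays G) \<noteq> \<infinity>"
  shows "\<exists>m. \<forall>X. finite X \<longrightarrow> X \<subseteq> verts G \<longrightarrow> (\<exists>F. inner G F \<and> X \<subseteq> F \<and> card (nbhd G F) \<le> m)"
proof -
  obtain d where d: "vertex_degree (rays G) = enat d" using assms by auto
  have "\<exists>F. inner G F \<and> X \<subseteq> F \<and> card (nbhd G F) \<le> d" if X: "finite X" "X \<subseteq> verts G" for X
  proof (rule ccontr)
    assume "\<not> ?thesis"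
    then have "Suc d \<le> card (nbhd G F)" if "inner G F" "X \<subseteq> F" for F
      using that not_less_eq_eq[of "card (nbhd G F)" d] by blast
    from disjoint_rays[OF X this] obtain R where R: "R \<subseteq> rays G" "finite R" "Suc d \<le> card R"
      "disjoint_family_on range R" by blast
    have "ecard R \<le> vertex_degree (rays G)"
      unfolding vertex_degree_def by (rule SUP_upper) (use R in auto)
    then show False using R d by (simp add: ecard_def)
  qed
  then show ?thesis by blast
qed

end


section \<open>Automorphisms\<close>

lemma automorphism_id: "automorphism G id"
  by (simp add: automorphism_def)

lemma automorphism_comp:
  assumes "automorphism G \<phi>" "automorphism G \<psi>"
  shows "automorphism G (\<phi> \<circ> \<psi>)"
proof -
  have "\<psi> u \<in> verts G" if "u \<in> verts G" for u
    using assms(2) that by (auto simp: automorphism_def dest: bij_betwE)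
  then show ?thesis using assms bij_betw_trans[of \<psi> "verts G" "verts G" \<phi>]
    by (auto simp: automorphism_def)
qed

lemma automorphism_funpow: "automorphism G \<phi> \<Longrightarrow> automorphism G (\<phi> ^^ n)"
  by (induction n) (simp_all add: automorphism_id automorphism_comp)

context
  fixes G :: "'a graph" and \<phi> :: "'a \<Rightarrow> 'a"
  assumes aut: "automorphism G \<phi>"
begin

lemma automorphism_bij: "bij_betw \<phi> (verts G) (verts G)"
  using aut by (simp add: automorphism_def)

lemma automorphism_inj: "inj_on \<phi> (verts G)"
  using automorphism_bij by (rule bij_betw_imp_inj_on)

lemma automorphism_verts: "\<phi> ` verts G = verts G" "v \<in> verts G \<Longrightarrow> \<phi> v \<in> verts G"
  using automorphism_bij by (auto simp: bij_betw_def)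

lemma automorphism_adjacent:
  "u \<in> verts G \<Longrightarrow> v \<in> verts G \<Longrightarrow> adjacent G (\<phi> u) (\<phi> v) \<longleftrightarrow> adjacent G u v"
  using aut by (simp add: automorphism_def)

lemma automorphism_image_subset: "X \<subseteq> verts G \<Longrightarrow> \<phi> ` X \<subseteq> verts G"
  using automorphism_verts by blast

lemma automorphism_mem_image: "X \<subseteq> verts G \<Longrightarrow> v \<in> verts G \<Longrightarrow> \<phi> v \<in> \<phi> ` X \<longleftrightarrow> v \<in> X"
  by (rule inj_on_image_mem_iff[OF automorphism_inj])

text \<open>An automorphism is arbitrary outside the vertex set, hence the inverse relative to
  \<open>verts G\<close>.\<close>

lemma automorphism_inv: "automorphism G (inv_into (verts G) \<phi>)"
proof -
  let ?i = "inv_into (verts G) \<phi>"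
  have b: "bij_betw ?i (verts G) (verts G)" by (rule bij_betw_inv_into[OF automorphism_bij])
  have "adjacent G (?i u) (?i v) \<longleftrightarrow> adjacent G u v" if "u \<in> verts G" "v \<in> verts G" for u v
    using automorphism_adjacent[of "?i u" "?i v"] that b
    by (simp add: bij_betwE bij_betw_inv_into_right[OF automorphism_bij])
  with b show ?thesis by (simp add: automorphism_def)
qed

lemma automorphism_inv_image:
  assumes "X \<subseteq> verts G"
  shows "inv_into (verts G) \<phi> ` \<phi> ` X = X" "\<phi> ` inv_into (verts G) \<phi> ` X = X"
  by (rule inv_into_image_cancel[OF automorphism_inj assms],
      rule image_inv_into_cancel[OF automorphism_verts(1) assms])

lemma automorphism_image_subset_iff:
  "X \<subseteq> verts G \<Longrightarrow> Y \<subseteq> verts G \<Longrightarrow> \<phi> ` X \<subseteq> \<phi> ` Y \<longleftrightarrow> X \<subseteq> Y"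
  unfolding subset_Un_eq image_Un[symmetric]
  by (rule inj_on_image_eq_iff[OF automorphism_inj]) auto

lemma nbhd_image:
  assumes "X \<subseteq> verts G"
  shows "nbhd G (\<phi> ` X) = \<phi> ` nbhd G X"
proof
  show "\<phi> ` nbhd G X \<subseteq> nbhd G (\<phi> ` X)"
  proof
    fix w assume "w \<in> \<phi> ` nbhd G X"
    then obtain v where v: "v \<in> nbhd G X" "w = \<phi> v" by blast
    then obtain u where u: "u \<in> X" "adjacent G u v" "v \<in> verts G" "v \<notin> X" by (blast elim: nbhdE)
    then have "adjacent G (\<phi> u) w" using automorphism_adjacent[of u v] assms v(2) by auto
    then show "w \<in> nbhd G (\<phi> ` X)"
      using u v(2) automorphism_verts(2) automorphism_mem_image[OF assms] by (intro nbhdI) auto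
  qed
  show "nbhd G (\<phi> ` X) \<subseteq> \<phi> ` nbhd G X"
  proof
    fix w assume "w \<in> nbhd G (\<phi> ` X)"
    then obtain u where u: "u \<in> X" "adjacent G (\<phi> u) w" "w \<in> verts G" "w \<notin> \<phi> ` X" by (blast elim: nbhdE)
    obtain v where v: "v \<in> verts G" "w = \<phi> v" using u(3) automorphism_verts(1) by blast
    have "adjacent G u v" using u(1,2) v assms automorphism_adjacent[of u v] by auto
    then show "w \<in> \<phi> ` nbhd G X" using u v by (auto intro!: imageI nbhdI)
  qed
qed

lemma conn_image:
  assumes "conn G X" "X \<subseteq> verts G"
  shows "conn G (\<phi> ` X)"
proof -
  have "reach G (\<phi> ` X) (\<phi> x) (\<phi> y)" if "reach G X x y" "x \<in> X" for x y
    using that(1) unfolding reach_def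
  proof (induction rule: rtranclp_induct)
    case (step y z)
    then have "adjacent G (\<phi> y) (\<phi> z)" using automorphism_adjacent[of y z] assms(2) by auto
    with step show ?case by (auto intro: rtranclp.rtrancl_into_rtrancl)
  qed simp
  then show ?thesis using assms(1) unfolding conn_def by blast
qed

lemma rays_image:
  assumes "r \<in> rays G"
  shows "\<phi> \<circ> r \<in> rays G"
proof -
  have r: "range r \<subseteq> verts G" "inj r" "\<And>n. adjacent G (r n) (r (Suc n))" using assms by (auto simp: rays_def)
  have "inj (\<phi> \<circ> r)" using comp_inj_on[OF r(2), of \<phi>] inj_on_subset[OF automorphism_inj r(1)] by blast
  moreover have "r n \<in> verts G" for n using r(1) by blast
  ultimately show ?thesis using r(3) automorphism_verts(2) automorphism_adjacent by (auto simp: rays_def)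
qed

end

lemma inner_image:
  assumes aut: "automorphism G \<phi>" and F: "inner G F"
  shows "inner G (\<phi> ` F)"
proof -
  let ?i = "inv_into (verts G) \<phi>"
  have FV: "F \<subseteq> verts G" using F by (simp add: inner_def)
  have "finite {n. r n \<in> \<phi> ` F}" if r: "r \<in> rays G" for r
  proof (rule finite_subset)
    have "?i \<circ> r \<in> rays G" by (rule rays_image[OF automorphism_inv[OF aut] r])
    then show "finite {n. (?i \<circ> r) n \<in> F}" using F unfolding inner_def by blast
    show "{n. r n \<in> \<phi> ` F} \<subseteq> {n. (?i \<circ> r) n \<in> F}"
    proof
      fix n assume "n \<in> {n. r n \<in> \<phi> ` F}"
      then have "?i (r n) \<in> ?i ` \<phi> ` F" by blast
      then show "n \<in> {n. (?i \<circ> r) n \<in> F}" by (simp add: automorphism_inv_image(1)[OF aut FV])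
    qed
  qed
  then show ?thesis
    using F automorphism_image_subset[OF aut FV] by (auto simp: inner_def nbhd_image[OF aut])
qed

text \<open>Otherwise the sets \<open>\<phi>\<^sup>n D\<close> strictly decrease.  By pigeonhole a vertex of \<open>D\<close> adjacent to
  their intersection would be fixed by a power of \<open>\<phi>\<close>, so the intersection is empty, and the chain
  yields a ray in \<open>D\<close>.\<close>

lemma no_shift:
  assumes aut: "automorphism G \<phi>" and D: "inner G D" "conn G D" "D \<noteq> {}" and sub: "\<phi> ` D \<subseteq> D"
  shows "\<phi> ` D = D"
proof (rule ccontr)
  assume neq: "\<phi> ` D \<noteq> D"
  define A where "A n = (\<phi> ^^ n) ` D" for n
  note autn = automorphism_funpow[OF aut]
  have DV: "D \<subseteq> verts G" using D(1) by (simp add: inner_def)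
  have A0: "A 0 = D" by (simp add: A_def)
  have "A (Suc n) \<subseteq> A n" for n
  proof -
    have "A (Suc n) = (\<phi> ^^ n) ` (\<phi> ` D)" unfolding A_def by (simp add: image_comp funpow_swap1 comp_def)
    then show ?thesis using sub unfolding A_def by (simp add: image_mono)
  qed
  then have anti: "A n \<subseteq> A m" if "m \<le> n" for m n using that by (rule lift_Suc_antimono_le)
  have empty: "(\<Inter>n. A n) = {}"
  proof (rule ccontr)
    let ?I = "\<Inter>n. A n"
    assume ne: "?I \<noteq> {}"
    have "D \<inter> nbhd G ?I = {}"
    proof (rule ccontr)
      assume "D \<inter> nbhd G ?I \<noteq> {}"
      then obtain y where yD: "y \<in> D" and y: "y \<in> nbhd G ?I" by blast
      from y obtain x where x: "x \<in> ?I" "adjacent G x y" "y \<in> verts G" "y \<notin> ?I" by (rule nbhdE)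
      then obtain m where m: "y \<notin> A m" by blast
      \<comment> \<open>For all exponents from m on, y is outside the image of D but adjacent to x
        inside it, so y is the image of a neighbour of D. There are only finitely many of
        these.\<close>
      have "\<exists>s. s \<in> nbhd G D \<and> (\<phi> ^^ (m + n)) s = y" for n
      proof -
        have "y \<notin> A (m + n)" using m anti[of m "m + n"] by auto
        then have "y \<in> nbhd G (A (m + n))" using x by (auto intro: nbhdI)
        then show ?thesis unfolding A_def nbhd_image[OF autn DV] by blast
      qed
      then obtain s where s: "\<And>n. s n \<in> nbhd G D" "\<And>n. (\<phi> ^^ (m + n)) (s n) = y" by metis
      have "finite (range s)" using s(1) D(1) by (auto simp: inner_def intro: finite_subset)
      then have "\<not> inj s" using infinite_UNIV_nat finite_imageD by blast
      then obtain a b where ab: "a < b" "s a = s b" unfolding inj_def by (metis linorder_neqE_nat)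
      define p where "p = b - a"
      have "m + b = p + (m + a)" using ab(1) by (simp add: p_def)
      then have "(\<phi> ^^ (m + b)) (s a) = (\<phi> ^^ p) ((\<phi> ^^ (m + a)) (s a))"
        by (simp only: funpow_add comp_apply)
      then have py: "(\<phi> ^^ p) y = y" using s(2)[of a] s(2)[of b] ab(2) by simp
      have "(\<phi> ^^ (p * n)) y = y" for n
        by (induction n) (simp_all add: py funpow_add)
      \<comment> \<open>p is a positive period of y, and p * m is a multiple of it that is at least
        m. So y lies in \<open>A (p * m)\<close> and thus in \<open>A m\<close>, contrary to the
        choice of m.\<close>
      then have "y \<in> A (p * m)" using yD unfolding A_def by (metis imageI)
      moreover have "1 * m \<le> p * m" using ab(1) by (intro mult_right_mono) (auto simp: p_def)
      ultimately show False using anti[of m "p * m"] m by auto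
    qed
    then have "D \<subseteq> ?I" using ne A0 by (intro conn_subset[OF D(2) DV]) blast+
    then have "D \<subseteq> A 1" by blast
    then show False using neq sub by (simp add: A_def)
  qed
  have "\<exists>r\<in>rays G. range r \<subseteq> (\<Union>n. A n)"
  proof (rule ray_in_chain)
    show "A n \<subseteq> verts G" for n using anti[of 0 n] A0 DV by auto
    show "conn G (A n)" for n unfolding A_def by (rule conn_image[OF autn D(2) DV])
    show "A n \<inter> A (Suc n) \<noteq> {}" for n using anti[of n "Suc n"] D(3) by (auto simp: A_def)
    fix v
    obtain m where "v \<notin> A m" using empty by blast
    then have "n < m" if "v \<in> A n" for n using anti[of m n] that by (meson not_le subsetD)
    then have "{n. v \<in> A n} \<subseteq> {..<m}" by blast
    then show "finite {n. v \<in> A n}" by (rule finite_subset) simp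
  qed
  moreover have "(\<Union>n. A n) \<subseteq> D" using anti[of 0] A0 by auto
  ultimately show False using inner_no_ray[OF D(1)] by blast
qed

section \<open>Critical sets\<close>

text \<open>S separates x from y in the graph induced on U, and every vertex of S has a neighbour on
  both sides. U is a parameter because the counting argument deletes vertices. C and D need not be
  full components, so the same witnesses survive the deletion.\<close>

definition tight :: "'a graph \<Rightarrow> 'a set \<Rightarrow> 'a \<Rightarrow> 'a \<Rightarrow> 'a set \<Rightarrow> bool" where
  "tight G U x y S \<longleftrightarrow> S \<subseteq> U \<and> finite S \<and> \<not> reach G (U - S) x y \<and>
    (\<exists>C D. C \<subseteq> U - S \<and> D \<subseteq> U - S \<and> conn G C \<and> conn G D \<and> x \<in> C \<and> y \<in> D \<and>
      (\<forall>s\<in>S. (\<exists>u\<in>C. adjacent G u s) \<and> (\<exists>u\<in>D. adjacent G u s)))"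

text \<open>Every separator meets a fixed finite path between the two vertices, and deleting a common
  vertex \<open>p\<close> leaves tight separators of \<open>U - {p}\<close>.\<close>

lemma finite_tight: "finite {S. tight G U x y S \<and> card S = n}"
proof (induction n arbitrary: U)
  case 0
  have "{S. tight G U x y S \<and> card S = 0} \<subseteq> {{}}" by (auto simp: tight_def)
  then show ?case by (rule finite_subset) simp
next
  case (Suc n)
  show ?case
  proof (cases "\<exists>S. tight G U x y S \<and> card S = Suc n")
    case True
    then obtain S C D s where S: "S \<subseteq> U" "C \<subseteq> U - S" "D \<subseteq> U - S" "conn G C" "conn G D" "x \<in> C" "y \<in> D"
      "s \<in> S" "\<forall>s\<in>S. (\<exists>u\<in>C. adjacent G u s) \<and> (\<exists>u\<in>D. adjacent G u s)"
      unfolding tight_def by (metis card.empty ex_in_conv nat.distinct(1))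
    \<comment> \<open>One vertex s of a non-empty tight separator already joins its two sides, which
      yields the fixed connected set P from x to y.\<close>
    then obtain u v where uv: "u \<in> C" "v \<in> D" "adjacent G u s" "adjacent G v s" by blast
    have "reach G U x u" "reach G U v y"
      using S uv by (auto intro!: reach_mono[OF connD[of G C x u]] reach_mono[OF connD[of G D v y]])
    moreover have "reach G U u s" "reach G U s v"
      using S uv by (auto intro!: reach_step adjacent_symD[OF uv(4)])
    ultimately have "reach G U x y" using reach_trans by metis
    then obtain P where P: "P \<subseteq> U" "finite P" "x \<in> P" "y \<in> P" "conn G P"
      using reach_finite[of G U x y] S(2,6) by blast
    have "{S. tight G U x y S \<and> card S = Suc n}
        \<subseteq> (\<Union>p\<in>P. insert p ` {S. tight G (U - {p}) x y S \<and> card S = n})"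
    proof
      fix S assume "S \<in> {S. tight G U x y S \<and> card S = Suc n}"
      then have S: "tight G U x y S" "card S = Suc n" by auto
      have "\<not> P \<subseteq> U - S"
        using S(1) reach_mono[OF connD[OF P(5,3,4)]] by (auto simp: tight_def)
      then obtain p where p: "p \<in> P" "p \<in> S" using P(1) by blast
      \<comment> \<open>Removing p from both U and S leaves the remaining graph unchanged, hence
        also the two sides.\<close>
      have eq: "U - {p} - (S - {p}) = U - S" using p by auto
      have "S - {p} \<subseteq> U - {p}" "finite (S - {p})" using S(1) by (auto simp: tight_def)
      then have "tight G (U - {p}) x y (S - {p})" using S(1) unfolding tight_def eq by blast
      moreover have "card (S - {p}) = n" using S p by (simp add: tight_def)
      moreover have "insert p (S - {p}) = S" using p by blast
      ultimately show "S \<in> (\<Union>p\<in>P. insert p ` {S. tight G (U - {p}) x y S \<and> card S = n})"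
        using p(1) by (intro UN_I[of p]) (auto intro!: image_eqI[of _ _ "S - {p}"])
    qed
    then show ?thesis by (rule finite_subset) (use P(2) Suc.IH in blast)
  next
    case False
    then have "{S. tight G U x y S \<and> card S = Suc n} = {}" by blast
    then show ?thesis by (simp only: finite.emptyI)
  qed
qed

lemma conn_closure:
  assumes "conn G D" "D \<noteq> {}"
  shows "conn G (D \<union> nbhd G D)"
proof -
  obtain x where x: "x \<in> D" using assms(2) by blast
  have r: "reach G (D \<union> nbhd G D) x y" if "y \<in> D" for y
    by (rule reach_mono[OF connD[OF assms(1) x that]]) blast
  show ?thesis
  proof (rule conn_if_root)
    fix y assume y: "y \<in> D \<union> nbhd G D"
    show "reach G (D \<union> nbhd G D) x y"
    proof (cases "y \<in> D")
      case False
      then obtain u where u: "u \<in> D" "adjacent G u y" using y by (blast elim: nbhdE)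
      show ?thesis by (rule reach_trans[OF r[OF u(1)] reach_step]) (use u y in auto)
    qed (rule r)
  qed
qed

locale one_end_crit = one_end +
  fixes k :: nat
  assumes cover_k: "\<And>X. finite X \<Longrightarrow> X \<subseteq> verts G \<Longrightarrow> \<exists>F. inner G F \<and> X \<subseteq> F \<and> card (nbhd G F) \<le> k"
    and least_k: "\<exists>X. finite X \<and> X \<subseteq> verts G \<and> (\<forall>F. inner G F \<longrightarrow> X \<subseteq> F \<longrightarrow> k \<le> card (nbhd G F))"
begin

text \<open>Inherited by supersets: an inner set with a big connected core can be modified freely
  outside the core without dropping below k neighbours.\<close>

definition big :: "'a set \<Rightarrow> bool" where
  "big B \<longleftrightarrow> (\<forall>F. inner G F \<longrightarrow> B \<subseteq> F \<longrightarrow> k \<le> card (nbhd G F))"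

definition crit :: "'a set \<Rightarrow> bool" where
  "crit E \<longleftrightarrow> inner G E \<and> conn G E \<and> E \<noteq> {} \<and> big E \<and> card (nbhd G E) = k"

lemma big_mono: "big B \<Longrightarrow> B \<subseteq> B' \<Longrightarrow> big B'"
  unfolding big_def by blast

lemma critD:
  assumes "crit E"
  shows "inner G E" "conn G E" "E \<noteq> {}" "big E" "card (nbhd G E) = k" "E \<subseteq> verts G" "finite (nbhd G E)"
  using assms by (auto simp: crit_def inner_def)

text \<open>The component of F around B has its neighbours among those of F, so at most k of them,
  and bigness of B forces k. New critical sets are extracted from inner sets in this way.\<close>

lemma crit_component:
  assumes F: "inner G F" "card (nbhd G F) \<le> k" and B: "B \<subseteq> F" "conn G B" "B \<noteq> {}" "big B"
  shows "\<exists>E. crit E \<and> B \<subseteq> E \<and> E \<subseteq> F \<and> nbhd G E \<subseteq> nbhd G F"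
proof -
  obtain b where b: "b \<in> B" using B(3) by blast
  define E where "E = component_in G F b"
  have bF: "b \<in> F" using b B(1) by blast
  have BE: "B \<subseteq> E" unfolding E_def by (rule component_in_superset[OF B(2,1) b])
  have nE: "nbhd G E \<subseteq> nbhd G F" unfolding E_def by (rule nbhd_component_in[OF bF])
  have iE: "inner G E" unfolding E_def by (rule inner_component[OF F(1) bF])
  have "card (nbhd G E) \<le> k" using card_mono[OF _ nE] F by (auto simp: inner_def)
  moreover have "k \<le> card (nbhd G E)" using B(4) iE BE by (simp add: big_def)
  moreover have "conn G E" unfolding E_def by (rule component_in_conn[OF bF])
  ultimately have "crit E"
    using iE big_mono[OF B(4) BE] BE B(3) unfolding crit_def by auto
  then show ?thesis using BE nE component_in_subset[OF bF] unfolding E_def by blast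
qed

lemma crit_exists: "\<exists>D. crit D"
proof -
  obtain X where X: "finite X" "X \<subseteq> verts G" "big X" using least_k unfolding big_def by blast
  \<comment> \<open>The vertex \<open>r 0\<close> guarantees a non-empty core.\<close>
  obtain r where "r \<in> rays G" using rays_nonempty by blast
  then have v: "r 0 \<in> verts G" by (auto simp: rays_def)
  obtain W where W: "finite W" "insert (r 0) X \<subseteq> W" "W \<subseteq> verts G" "conn G W"
    using conn_finite_superset[OF _ _ conn_verts, of "insert (r 0) X"] X v by auto
  obtain F where "inner G F" "W \<subseteq> F" "card (nbhd G F) \<le> k" using cover_k[OF W(1,3)] by blast
  then show ?thesis using crit_component[of F W] W big_mono[OF X(3), of W] by blast
qed

text \<open>Cover the neighbourhood of D by an inner set with at most k neighbours. Adding D creates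
  no further neighbours, as those of D are already covered.\<close>

lemma crit_extend:
  assumes D: "crit D"
  shows "\<exists>E. crit E \<and> D \<union> nbhd G D \<subseteq> E"
proof -
  obtain F where F: "inner G F" "nbhd G D \<subseteq> F" "card (nbhd G F) \<le> k"
    using cover_k[OF critD(7)[OF D] nbhd_subset(1)] by blast
  have "nbhd G (F \<union> D) \<subseteq> nbhd G F" using F(2) by (auto simp: nbhd_def)
  then have "card (nbhd G (F \<union> D)) \<le> k" using F card_mono[of "nbhd G F" "nbhd G (F \<union> D)"] by (auto simp: inner_def)
  then show ?thesis
    using crit_component[OF inner_Un[OF F(1) critD(1)[OF D]], of "D \<union> nbhd G D"] F(2) critD[OF D]
      conn_closure[of G D] big_mono[of D "D \<union> nbhd G D"] by blast
qed

lemma crit_image: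
  assumes aut: "automorphism G \<phi>" and D: "crit D"
  shows "crit (\<phi> ` D)"
proof -
  let ?i = "inv_into (verts G) \<phi>"
  note DV = critD(6)[OF D]
  have card: "card (nbhd G (\<psi> ` F)) = card (nbhd G F)" if "automorphism G \<psi>" "F \<subseteq> verts G" for \<psi> F
    unfolding nbhd_image[OF that] by (rule card_image[OF inj_on_subset[OF automorphism_inj[OF that(1)] nbhd_subset(1)]])
  have "k \<le> card (nbhd G F)" if F: "inner G F" "\<phi> ` D \<subseteq> F" for F
  proof -
    have FV: "F \<subseteq> verts G" using F by (simp add: inner_def)
    have "D \<subseteq> ?i ` F" using automorphism_inv_image(1)[OF aut DV] F(2) by blast
    then have "k \<le> card (nbhd G (?i ` F))"
      using critD(4)[OF D] inner_image[OF automorphism_inv[OF aut] F(1)] by (simp add: big_def)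
    then show ?thesis using card[OF automorphism_inv[OF aut] FV] by simp
  qed
  then show ?thesis
    using critD[OF D] inner_image[OF aut] conn_image[OF aut] card[OF aut DV] by (simp add: crit_def big_def)
qed

text \<open>Otherwise D would be the whole connected graph and contain a ray. This makes the
  inclusion of D in any set containing its closure proper.\<close>

lemma nbhd_nonempty:
  assumes "inner G D" "D \<noteq> {}"
  shows "nbhd G D \<noteq> {}"
proof
  assume n: "nbhd G D = {}"
  have "verts G \<inter> D \<noteq> {}" using assms by (auto simp: inner_def)
  then have "verts G \<subseteq> D" by (intro conn_subset[OF conn_verts order_refl]) (simp_all add: n)
  moreover obtain r where r: "r \<in> rays G" using rays_nonempty by blast
  moreover have "range r \<subseteq> verts G" using r by (simp add: rays_def)
  ultimately show False using inner_no_ray[OF assms(1)] by blast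
qed

text \<open>Describes the component of G minus the neighbourhood of E in which the end lives;
  \<open>outer_component\<close> identifies it as such.\<close>

definition outer :: "'a set \<Rightarrow> 'a set \<Rightarrow> bool" where
  "outer E C \<longleftrightarrow> C \<subseteq> verts G - nbhd G E \<and> conn G C \<and> nbhd G C \<subseteq> nbhd G E \<and> (\<forall>r\<in>rays G. finite {n. r n \<notin> C})"

lemma outer_exists: "inner G E \<Longrightarrow> \<exists>C. outer E C"
  using end_side[of "nbhd G E"] nbhd_subset(1)[of G E] by (auto simp: outer_def inner_def)

lemma outer_not_subset_inner:
  assumes "outer E C" "inner G F"
  shows "\<not> C \<subseteq> F"
proof
  assume "C \<subseteq> F"
  obtain r where r: "r \<in> rays G" using rays_nonempty by blast
  have "finite ({n. r n \<notin> C} \<union> {n. r n \<in> F})" using assms r by (auto simp: outer_def inner_def)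
  moreover have "{n. r n \<notin> C} \<union> {n. r n \<in> F} = UNIV" using \<open>C \<subseteq> F\<close> by blast
  ultimately show False by simp
qed

lemma outer_disjoint:
  assumes "outer E C" "inner G E"
  shows "C \<inter> E = {}"
proof (rule ccontr)
  assume "C \<inter> E \<noteq> {}"
  then have "C \<subseteq> E" using assms(1) by (intro conn_subset[of G C E]) (auto simp: outer_def)
  then show False using outer_not_subset_inner[OF assms] by blast
qed

text \<open>The complement of \<open>C\<close> and its neighbourhood is inner and contains \<open>E\<close>, so that bigness
  of \<open>E\<close> forces equality.\<close>

lemma nbhd_outer:
  assumes E: "crit E" and C: "outer E C"
  shows "nbhd G C = nbhd G E"
proof -
  define E' where "E' = verts G - (C \<union> nbhd G C)"
  have fC: "finite (nbhd G C)" "nbhd G C \<subseteq> nbhd G E"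
    using C critD(7)[OF E] finite_subset by (auto simp: outer_def)
  have nE': "nbhd G E' \<subseteq> nbhd G C"
  proof
    fix v assume "v \<in> nbhd G E'"
    then obtain u where u: "u \<in> E'" "adjacent G u v" "v \<in> verts G" "v \<notin> E'" by (blast elim: nbhdE)
    have "v \<notin> C" using nbhdI[of v C G u] adjacent_symD[OF u(2)] u(1) by (auto simp: E'_def)
    then show "v \<in> nbhd G C" using u by (auto simp: E'_def)
  qed
  have "finite {n. r n \<in> E'}" if "r \<in> rays G" for r
    by (rule finite_subset[of _ "{n. r n \<notin> C}"]) (use C that in \<open>auto simp: outer_def E'_def\<close>)
  then have "inner G E'" using finite_subset[OF nE' fC(1)] by (auto simp: inner_def E'_def)
  moreover have "E \<subseteq> E'"
    using critD(6)[OF E] outer_disjoint[OF C critD(1)[OF E]] fC(2) nbhd_subset(2)[of G E]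
    by (auto simp: E'_def)
  ultimately have "k \<le> card (nbhd G E')" using critD(4)[OF E] by (simp add: big_def)
  also have "\<dots> \<le> card (nbhd G C)" by (rule card_mono[OF fC(1) nE'])
  finally show ?thesis using card_seteq[OF critD(7)[OF E] fC(2)] critD(5)[OF E] by simp
qed

text \<open>By \<open>nbhd_outer\<close> the neighbourhood of E is a tight separator of x and y with
  k vertices, and E is recovered from it as the component of x.\<close>

lemma finite_crit_between: "finite {E. crit E \<and> x \<in> E \<and> (\<exists>C. outer E C \<and> y \<in> C)}"
proof (rule finite_subset)
  show "{E. crit E \<and> x \<in> E \<and> (\<exists>C. outer E C \<and> y \<in> C)}
    \<subseteq> (\<lambda>S. component_in G (verts G - S) x) ` {S. tight G (verts G) x y S \<and> card S = k}"
  proof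
    fix E assume "E \<in> {E. crit E \<and> x \<in> E \<and> (\<exists>C. outer E C \<and> y \<in> C)}"
    then obtain C where E: "crit E" "x \<in> E" and C: "outer E C" "y \<in> C" by blast
    have EV: "E \<subseteq> verts G - nbhd G E" using critD(6)[OF E(1)] nbhd_subset(2)[of G E] by blast
    have stay: "z \<in> E" if "reach G (verts G - nbhd G E) x z" for z
      by (rule reach_closed[OF that E(2)]) (auto intro: nbhdI)
    have comp: "E = component_in G (verts G - nbhd G E) x"
      using stay component_in_superset[OF critD(2)[OF E(1)] EV E(2)] by (auto simp: component_in_def)
    have "\<not> reach G (verts G - nbhd G E) x y"
      using stay[of y] outer_disjoint[OF C(1) critD(1)[OF E(1)]] C(2) by blast
    moreover have "\<forall>s\<in>nbhd G E. (\<exists>u\<in>E. adjacent G u s) \<and> (\<exists>u\<in>C. adjacent G u s)"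
      using nbhd_outer[OF E(1) C(1)] by (blast elim: nbhdE)
    moreover have "C \<subseteq> verts G - nbhd G E" "conn G C" using C(1) by (auto simp: outer_def)
    ultimately have "tight G (verts G) x y (nbhd G E)"
      unfolding tight_def using EV E C critD[OF E(1)] nbhd_subset(1)[of G E] by blast
    then show "E \<in> (\<lambda>S. component_in G (verts G - S) x) ` {S. tight G (verts G) x y S \<and> card S = k}"
      using comp critD(5)[OF E(1)] by blast
  qed
  show "finite ((\<lambda>S. component_in G (verts G - S) x) ` {S. tight G (verts G) x y S \<and> card S = k})"
    by (intro finite_imageI finite_tight)
qed

text \<open>Let F be an inner set around s. The side C of the end contains a neighbour of s, hence
  meets the closure of F. Being connected and not contained in F, it meets the finite neighbourhood
  of F, so finitely many choices of y suffice in \<open>finite_crit_between\<close>.\<close>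

lemma finite_crit_at:
  assumes "s \<in> verts G"
  shows "finite {E. crit E \<and> x \<in> E \<and> s \<in> nbhd G E}"
proof -
  obtain F where F: "inner G F" "s \<in> F" using inner_cover assms by blast
  have "{E. crit E \<and> x \<in> E \<and> s \<in> nbhd G E} \<subseteq> (\<Union>y\<in>nbhd G F. {E. crit E \<and> x \<in> E \<and> (\<exists>C. outer E C \<and> y \<in> C)})"
  proof
    fix E assume "E \<in> {E. crit E \<and> x \<in> E \<and> s \<in> nbhd G E}"
    then have E: "crit E" "x \<in> E" "s \<in> nbhd G E" by auto
    obtain C where C: "outer E C" using outer_exists critD(1)[OF E(1)] by blast
    have CV: "C \<subseteq> verts G" "conn G C" using C by (auto simp: outer_def)
    obtain u where u: "u \<in> C" "adjacent G u s" using E(3) nbhd_outer[OF E(1) C] by (blast elim: nbhdE)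
    have "u \<in> F \<union> nbhd G F" using u CV(1) F(2) adjacent_symD[OF u(2)] by (auto intro: nbhdI)
    moreover have "C \<inter> F \<noteq> {} \<Longrightarrow> C \<inter> nbhd G F \<noteq> {}"
      using conn_subset[OF CV(2,1)] outer_not_subset_inner[OF C F(1)] by blast
    ultimately have "C \<inter> nbhd G F \<noteq> {}" using u(1) by blast
    then show "E \<in> (\<Union>y\<in>nbhd G F. {E. crit E \<and> x \<in> E \<and> (\<exists>C. outer E C \<and> y \<in> C)})"
      using C E by blast
  qed
  moreover have "finite (\<Union>y\<in>nbhd G F. {E. crit E \<and> x \<in> E \<and> (\<exists>C. outer E C \<and> y \<in> C)})"
    using F(1) finite_crit_between by (auto simp: inner_def)
  ultimately show ?thesis by (rule finite_subset)
qed

text \<open>A finite connected set W around the neighbourhood of D meets both E and the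
  neighbourhood of E, which leaves finitely many pairs for \<open>finite_crit_at\<close>.\<close>

lemma finite_crossing:
  assumes D: "crit D"
  shows "finite {E. crit E \<and> nbhd G E \<inter> D \<noteq> {} \<and> \<not> E \<subseteq> D}"
proof -
  obtain W where W: "finite W" "nbhd G D \<subseteq> W" "W \<subseteq> verts G" "conn G W"
    using conn_finite_superset[OF critD(7)[OF D] nbhd_subset(1) conn_verts] by blast
  have "{E. crit E \<and> nbhd G E \<inter> D \<noteq> {} \<and> \<not> E \<subseteq> D} \<subseteq> (\<Union>x\<in>W. \<Union>s\<in>W. {E. crit E \<and> x \<in> E \<and> s \<in> nbhd G E})"
  proof
    fix E assume "E \<in> {E. crit E \<and> nbhd G E \<inter> D \<noteq> {} \<and> \<not> E \<subseteq> D}"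
    then have E: "crit E" "nbhd G E \<inter> D \<noteq> {}" "\<not> E \<subseteq> D" by auto
    have "E \<inter> nbhd G D \<noteq> {}"
    proof (cases "E \<inter> D = {}")
      case True
      obtain s where s: "s \<in> nbhd G E" "s \<in> D" using E(2) by blast
      then obtain e where e: "e \<in> E" "adjacent G e s" by (blast elim: nbhdE)
      then have "e \<in> nbhd G D" using s(2) True critD(6)[OF E(1)] adjacent_symD[OF e(2)] by (auto intro: nbhdI)
      then show ?thesis using e(1) by blast
    next
      case False
      then show ?thesis using conn_subset[OF critD(2,6)[OF E(1)]] E(3) by blast
    qed
    then obtain x where x: "x \<in> E" "x \<in> nbhd G D" by blast
    \<comment> \<open>If E contained all neighbours of D, then adding D to E would absorb a
      neighbour of E lying in D and leave fewer than k.\<close>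
    have "\<not> nbhd G D \<subseteq> E"
    proof
      assume "nbhd G D \<subseteq> E"
      then have "nbhd G (E \<union> D) \<subseteq> nbhd G E - D" by (auto simp: nbhd_def)
      then have "card (nbhd G (E \<union> D)) \<le> card (nbhd G E - D)" using critD(7)[OF E(1)] by (simp add: card_mono)
      moreover have "card (nbhd G E - D) < card (nbhd G E)"
        using E(2) critD(7)[OF E(1)] by (intro psubset_card_mono) blast+
      moreover have "k \<le> card (nbhd G (E \<union> D))"
        using critD(4)[OF E(1)] inner_Un[OF critD(1)[OF E(1)] critD(1)[OF D]] by (auto simp: big_def)
      ultimately show False using critD(5)[OF E(1)] by simp
    qed
    then have "W \<inter> nbhd G E \<noteq> {}" using conn_subset[OF W(4,3)] x W(2) by blast
    then show "E \<in> (\<Union>x\<in>W. \<Union>s\<in>W. {E. crit E \<and> x \<in> E \<and> s \<in> nbhd G E})" using x W(2) E(1) by blast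
  qed
  moreover have "finite (\<Union>x\<in>W. \<Union>s\<in>W. {E. crit E \<and> x \<in> E \<and> s \<in> nbhd G E})"
    using W(1,3) finite_crit_at by blast
  ultimately show ?thesis by (rule finite_subset)
qed

end


section \<open>The laminar family\<close>

context one_end_crit
begin

text \<open>Infinitely many obstructions \<open>\<phi>\<^sub>n\<close> along an increasing sequence \<open>D\<^sub>n\<close> would give the
  infinitely many sets \<open>\<phi>\<^sub>n\<^sup>-\<^sup>1 D\<^sub>n\<close> crossing \<open>D\<close>; by \<open>no_shift\<close> these are distinct.\<close>

lemma crit_avoiding_orbit:
  assumes D: "crit D"
  shows "\<exists>E. crit E \<and> D \<subseteq> E \<and> (\<forall>\<phi>. automorphism G \<phi> \<longrightarrow> nbhd G E \<inter> \<phi> ` D = {})"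
proof (rule ccontr)
  assume no: "\<not> ?thesis"
  have "\<exists>A. \<forall>n::nat. (crit (A n) \<and> D \<union> nbhd G D \<subseteq> A n) \<and> A n \<union> nbhd G (A n) \<subseteq> A (Suc n)"
  proof (rule dependent_nat_choice)
    show "\<exists>x. crit x \<and> D \<union> nbhd G D \<subseteq> x" by (rule crit_extend[OF D])
    fix x :: "'a set" and n :: nat
    assume x: "crit x \<and> D \<union> nbhd G D \<subseteq> x"
    then obtain y where "crit y" "x \<union> nbhd G x \<subseteq> y" using crit_extend by blast
    then show "\<exists>y. (crit y \<and> D \<union> nbhd G D \<subseteq> y) \<and> x \<union> nbhd G x \<subseteq> y" using x by blast
  qed
  then obtain A where A: "\<And>n. crit (A n)" "\<And>n. D \<union> nbhd G D \<subseteq> A n"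
    "\<And>n::nat. A n \<union> nbhd G (A n) \<subseteq> A (Suc n)" by blast
  have "A n \<subset> A (Suc n)" for n
    using nbhd_nonempty[of "A n"] critD[OF A(1)[of n]] A(3)[of n] nbhd_subset(2)[of G "A n"] by blast
  then have less: "A m \<subset> A n" if "m < n" for m n using that by (rule lift_Suc_mono_less)
  have DA: "D \<subset> A n" for n
    using nbhd_nonempty[of D] critD[OF D] A(2)[of n] nbhd_subset(2)[of G D] by blast
  have "\<forall>n. \<exists>\<phi>. automorphism G \<phi> \<and> nbhd G (A n) \<inter> \<phi> ` D \<noteq> {}"
  proof
    fix n
    show "\<exists>\<phi>. automorphism G \<phi> \<and> nbhd G (A n) \<inter> \<phi> ` D \<noteq> {}"
      using no A(1)[of n] psubset_imp_subset[OF DA[of n]] by metis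
  qed
  then obtain f where f: "\<And>n. automorphism G (f n)" "\<And>n. nbhd G (A n) \<inter> f n ` D \<noteq> {}" by metis
  define i where "i n = inv_into (verts G) (f n)" for n
  have i: "automorphism G (i n)" for n unfolding i_def by (rule automorphism_inv[OF f(1)])
  have shift: False if "automorphism G \<phi>" "\<phi> ` A n \<subset> A n" for \<phi> n
    using no_shift[OF that(1), of "A n"] critD[OF A(1)[of n]] that(2) by blast
  \<comment> \<open>Undoing the n-th automorphism moves all obstructions to the one fixed set
    D.\<close>
  define B where "B n = i n ` A n" for n
  have "B n \<in> {E. crit E \<and> nbhd G E \<inter> D \<noteq> {} \<and> \<not> E \<subseteq> D}" for n
  proof -
    obtain x where x: "x \<in> D" "f n x \<in> nbhd G (A n)" using f(2)[of n] by blast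
    have "i n (f n x) = x"
      unfolding i_def by (rule inv_into_f_f[OF automorphism_inj[OF f(1)]]) (use x(1) critD(6)[OF D] in blast)
    then have "x \<in> nbhd G (B n)"
      unfolding B_def nbhd_image[OF i critD(6)[OF A(1)]] using x(2) by force
    \<comment> \<open>Otherwise \<open>i n\<close> would map \<open>A n\<close> into D, and so
      properly into itself.\<close>
    moreover have "\<not> B n \<subseteq> D" using shift[OF i, of n n] DA[of n] unfolding B_def by blast
    ultimately show ?thesis using crit_image[OF i A(1)] x(1) unfolding B_def by blast
  qed
  then have "range B \<subseteq> {E. crit E \<and> nbhd G E \<inter> D \<noteq> {} \<and> \<not> E \<subseteq> D}" by blast
  then have "finite (range B)" using finite_crossing[OF D] finite_subset by blast
  then have "\<not> inj B" using finite_imageD infinite_UNIV_nat by blast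
  then obtain m n where mn: "m < n" "B m = B n" unfolding inj_def by (metis linorder_neqE_nat)
  \<comment> \<open>A coincidence of \<open>B m\<close> and \<open>B n\<close> gives an automorphism
    that maps \<open>A n\<close> onto the smaller set \<open>A m\<close>.\<close>
  have "(f m \<circ> i n) ` A n = f m ` i m ` A m" unfolding image_comp[symmetric] using mn(2) by (simp add: B_def)
  also have "\<dots> = A m"
    unfolding i_def by (rule automorphism_inv_image(2)[OF f(1) critD(6)[OF A(1)]])
  finally show False using shift[OF automorphism_comp[OF f(1) i], of m n n] less[OF mn(1)] by simp
qed

section \<open>Least critical sets relative to an orbit\<close>

definition orbit :: "'a set \<Rightarrow> 'a set" where
  "orbit D = \<Union>{\<phi> ` D | \<phi>. automorphism G \<phi>}"

lemma subset_orbit: "automorphism G \<phi> \<Longrightarrow> \<phi> ` D \<subseteq> orbit D" "D \<subseteq> orbit D"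
  using automorphism_id[of G] unfolding orbit_def by fastforce+

lemma orbit_subset: "D \<subseteq> verts G \<Longrightarrow> orbit D \<subseteq> verts G"
  using automorphism_image_subset unfolding orbit_def by blast

lemma orbit_image:
  assumes "automorphism G \<phi>" "D \<subseteq> verts G"
  shows "\<phi> ` orbit D = orbit D"
proof -
  have sub: "\<psi> ` orbit D \<subseteq> orbit D" if "automorphism G \<psi>" for \<psi>
  proof
    fix x assume "x \<in> \<psi> ` orbit D"
    then obtain \<chi> where "automorphism G \<chi>" "x \<in> (\<psi> \<circ> \<chi>) ` D" unfolding orbit_def by auto
    then show "x \<in> orbit D" using subset_orbit(1)[OF automorphism_comp[OF that]] by blast
  qed
  have "\<phi> ` inv_into (verts G) \<phi> ` orbit D \<subseteq> \<phi> ` orbit D"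
    by (rule image_mono[OF sub[OF automorphism_inv[OF assms(1)]]])
  then show ?thesis using sub[OF assms(1)] automorphism_inv_image(2)[OF assms(1) orbit_subset[OF assms(2)]] by simp
qed

text \<open>Y and D are separate arguments because translates of D share the same invariant Y; this
  makes the passage from D to L commute with automorphisms.\<close>

definition least_crit :: "'a set \<Rightarrow> 'a set \<Rightarrow> 'a set \<Rightarrow> bool" where
  "least_crit Y D L \<longleftrightarrow> crit L \<and> D \<subseteq> L \<and> nbhd G L \<inter> Y = {} \<and>
    (\<forall>E. crit E \<longrightarrow> D \<subseteq> E \<longrightarrow> nbhd G E \<inter> Y = {} \<longrightarrow> L \<subseteq> E)"

text \<open>C contains the tail of a ray that also lies in C', and it avoids the neighbours of C',
  since these lie in the closure of E.\<close>

lemma outer_subset_outer: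
  assumes "inner G E" "outer E C" "inner G E'" "E' \<subseteq> E" "outer E' C'"
  shows "C \<subseteq> C'"
proof (rule conn_subset)
  show "conn G C" "C \<subseteq> verts G" using assms(2) by (auto simp: outer_def)
  obtain r where r: "r \<in> rays G" using rays_nonempty by blast
  have "finite ({n. r n \<notin> C} \<union> {n. r n \<notin> C'})" using r assms(2,5) by (auto simp: outer_def)
  moreover have "{n. r n \<notin> C} \<union> {n. r n \<notin> C'} = UNIV" if "C \<inter> C' = {}" using that by blast
  ultimately show "C \<inter> C' \<noteq> {}" using infinite_UNIV_nat by metis
  have "nbhd G C' \<subseteq> E \<union> nbhd G E" using assms(4,5) unfolding outer_def nbhd_def by blast
  then show "C \<inter> nbhd G C' = {}" using outer_disjoint[OF assms(2,1)] assms(2) by (auto simp: outer_def)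
qed

lemma least_crit_exists:
  assumes D: "crit D"
  shows "\<exists>L. least_crit (orbit D) D L"
proof -
  define \<E> where "\<E> = {E. crit E \<and> D \<subseteq> E \<and> nbhd G E \<inter> orbit D = {}}"
  obtain E0 where "crit E0" "D \<subseteq> E0" and E0': "\<And>\<phi>. automorphism G \<phi> \<Longrightarrow> nbhd G E0 \<inter> \<phi> ` D = {}"
    using crit_avoiding_orbit[OF D] by metis
  moreover have "nbhd G E0 \<inter> orbit D = {}" using E0' unfolding orbit_def by blast
  ultimately have E0: "E0 \<in> \<E>" by (simp add: \<E>_def)
  then have cE0: "crit E0" by (simp add: \<E>_def)
  obtain C0 where C0: "outer E0 C0" using outer_exists[OF critD(1)[OF cE0]] by blast
  then obtain y where y: "y \<in> C0" using outer_not_subset_inner[OF C0 inner_empty] by blast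
  obtain x where x: "x \<in> D" using critD(3)[OF D] by blast
  \<comment> \<open>Every candidate inside E0 separates x from y: its side of the end contains that
    of E0.\<close>
  have "{E \<in> \<E>. E \<subseteq> E0} \<subseteq> {E. crit E \<and> x \<in> E \<and> (\<exists>C. outer E C \<and> y \<in> C)}"
  proof
    fix E assume "E \<in> {E \<in> \<E>. E \<subseteq> E0}"
    then have E: "crit E" "D \<subseteq> E" "E \<subseteq> E0" by (auto simp: \<E>_def)
    obtain C where "outer E C" using outer_exists[OF critD(1)[OF E(1)]] by blast
    then show "E \<in> {E. crit E \<and> x \<in> E \<and> (\<exists>C. outer E C \<and> y \<in> C)}"
      using outer_subset_outer[OF critD(1)[OF cE0] C0 critD(1)[OF E(1)] E(3)] y x E by blast
  qed
  then have "finite {E \<in> \<E>. E \<subseteq> E0}" using finite_crit_between finite_subset by blast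
  then obtain L where L: "L \<in> {E \<in> \<E>. E \<subseteq> E0}" "\<forall>E\<in>{E \<in> \<E>. E \<subseteq> E0}. E \<subseteq> L \<longrightarrow> L = E"
    using finite_has_minimal[of "{E \<in> \<E>. E \<subseteq> E0}"] E0 by blast
  have cL: "crit L" "D \<subseteq> L" "nbhd G L \<inter> orbit D = {}" using L(1) by (auto simp: \<E>_def)
  have "L \<subseteq> E" if E: "crit E" "D \<subseteq> E" "nbhd G E \<inter> orbit D = {}" for E
  proof -
    \<comment> \<open>Bigness bounds the union from below, so submodularity leaves at most k
      neighbours to the intersection. Its component around D is again a candidate, and minimality of
      L makes it equal to L.\<close>
    have "k \<le> card (nbhd G (E \<union> L))"
      using critD(4)[OF E(1)] inner_Un[OF critD(1)[OF E(1)] critD(1)[OF cL(1)]] by (auto simp: big_def)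
    then have "card (nbhd G (E \<inter> L)) \<le> k"
      using card_nbhd_Un_Int[OF critD(7)[OF E(1)] critD(7)[OF cL(1)]] critD(5)[OF E(1)] critD(5)[OF cL(1)] by simp
    then obtain I where I: "crit I" "D \<subseteq> I" "I \<subseteq> E \<inter> L" "nbhd G I \<subseteq> nbhd G (E \<inter> L)"
      using crit_component[OF inner_Int[OF critD(1)[OF E(1)] critD(1)[OF cL(1)]], of D] critD[OF D] E(2) cL(2)
      by blast
    have "nbhd G I \<inter> orbit D = {}" using I(4) nbhd_Int_subset[of G E L] E(3) cL(3) by blast
    then have "I \<in> {E \<in> \<E>. E \<subseteq> E0}" using I L(1) by (auto simp: \<E>_def)
    then show "L \<subseteq> E" using L(2) I(3) by blast
  qed
  then show ?thesis using cL unfolding least_crit_def by blast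
qed

lemma least_crit_image:
  assumes aut: "automorphism G \<phi>" and Y: "Y \<subseteq> verts G" "\<And>\<psi>. automorphism G \<psi> \<Longrightarrow> \<psi> ` Y = Y"
    and L: "least_crit Y D L"
  shows "least_crit Y (\<phi> ` D) (\<phi> ` L)"
proof -
  let ?i = "inv_into (verts G) \<phi>"
  have cL: "crit L" "D \<subseteq> L" "nbhd G L \<inter> Y = {}" using L by (auto simp: least_crit_def)
  note LV = critD(6)[OF cL(1)]
  have av: "\<psi> ` nbhd G E \<inter> Y = {}" if "automorphism G \<psi>" "nbhd G E \<inter> Y = {}" for \<psi> E
    using inj_on_image_Int[OF automorphism_inj[OF that(1)] nbhd_subset(1)[of G E] Y(1)] that Y(2)[OF that(1)]
    by simp
  have "\<phi> ` L \<subseteq> E" if E: "crit E" "\<phi> ` D \<subseteq> E" "nbhd G E \<inter> Y = {}" for E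
  proof -
    note i = automorphism_inv[OF aut]
    have "?i ` \<phi> ` D \<subseteq> ?i ` E" using E(2) by (rule image_mono)
    then have "D \<subseteq> ?i ` E" using automorphism_inv_image(1)[OF aut, of D] cL(2) LV by auto
    moreover have "nbhd G (?i ` E) \<inter> Y = {}"
      unfolding nbhd_image[OF i critD(6)[OF E(1)]] by (rule av[OF i E(3)])
    ultimately have "L \<subseteq> ?i ` E" using L crit_image[OF i E(1)] unfolding least_crit_def by blast
    then have "\<phi> ` L \<subseteq> \<phi> ` ?i ` E" by (rule image_mono)
    then show ?thesis using automorphism_inv_image(2)[OF aut critD(6)[OF E(1)]] by simp
  qed
  moreover have "crit (\<phi> ` L)" "\<phi> ` D \<subseteq> \<phi> ` L" "nbhd G (\<phi> ` L) \<inter> Y = {}"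
    using crit_image[OF aut cL(1)] image_mono[OF cL(2)] av[OF aut cL(3)]
    by (simp_all add: nbhd_image[OF aut LV])
  ultimately show ?thesis unfolding least_crit_def by simp
qed

text \<open>D avoids the neighbourhood of L' because that neighbourhood avoids Y; so D is inside L'
  or away from it, and likewise for D' and L. An inclusion makes one of L, L' a candidate for the
  other. If both are away, the differences contain D and D' and are uncrossed.\<close>

lemma least_crit_nested:
  assumes D: "crit D" "D \<subseteq> Y" and D': "crit D'" "D' \<subseteq> Y" and L: "least_crit Y D L" and L': "least_crit Y D' L'"
  shows "away G L L' \<or> L \<subseteq> L' \<or> L' \<subseteq> L"
proof -
  have cL: "crit L" "D \<subseteq> L" "nbhd G L \<inter> Y = {}" using L by (auto simp: least_crit_def)
  have cL': "crit L'" "D' \<subseteq> L'" "nbhd G L' \<inter> Y = {}" using L' by (auto simp: least_crit_def)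
  consider (a) "D' \<subseteq> L" | (b) "D \<subseteq> L'" | (c) "away G D' L" "away G D L'"
    using conn_subset_or_away[OF critD(2,6)[OF D(1)], of L'] conn_subset_or_away[OF critD(2,6)[OF D'(1)], of L]
      D(2) D'(2) cL(3) cL'(3) by blast
  then show ?thesis
  proof cases
    case a
    then show ?thesis using L' cL unfolding least_crit_def by blast
  next
    case b
    then show ?thesis using L cL' unfolding least_crit_def by blast
  next
    case c
    let ?M = "L - (L' \<union> nbhd G L')" and ?M' = "L' - (L \<union> nbhd G L)"
    have n: "nbhd G ?M \<subseteq> nbhd G L \<union> nbhd G L'" "nbhd G ?M' \<subseteq> nbhd G L' \<union> nbhd G L"
      by (rule nbhd_Diff_subset[OF critD(6)[OF cL(1)]], rule nbhd_Diff_subset[OF critD(6)[OF cL'(1)]])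
    have f: "finite (nbhd G L \<union> nbhd G L')" using critD(7)[OF cL(1)] critD(7)[OF cL'(1)] by simp
    have M: "inner G ?M" "inner G ?M'"
      using inner_subset[OF critD(1)[OF cL(1)], of ?M] inner_subset[OF critD(1)[OF cL'(1)], of ?M']
        finite_subset[OF n(1) f] finite_subset[OF n(2)] f by (auto simp: Un_commute)
    have DM: "D \<subseteq> ?M" "D' \<subseteq> ?M'" using c cL(2) cL'(2) by (auto simp: away_def)
    \<comment> \<open>Bigness of D' bounds one difference from below, hence the other from above. A
      component of the latter competes with L, and leastness of L then puts all of L away from
      L'.\<close>
    have "k \<le> card (nbhd G ?M')" using M(2) DM(2) critD(4)[OF D'(1)] by (simp add: big_def)
    then have "card (nbhd G ?M) \<le> k"
      using card_nbhd_Diff[OF critD(7)[OF cL(1)] critD(7)[OF cL'(1)] critD(6)[OF cL(1)] critD(6)[OF cL'(1)]]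
        critD(5)[OF cL(1)] critD(5)[OF cL'(1)] by simp
    then obtain I where I: "crit I" "D \<subseteq> I" "I \<subseteq> ?M" "nbhd G I \<subseteq> nbhd G ?M"
      using crit_component[OF M(1) _ DM(1)] critD[OF D(1)] by blast
    have "nbhd G I \<inter> Y = {}" using I(4) n(1) cL(3) cL'(3) by blast
    then have "L \<subseteq> I" using L I unfolding least_crit_def by blast
    then show ?thesis using I(3) by (auto simp: away_def)
  qed
qed

text \<open>Collects what the tree needs, so that the critical sets and orbits behind the family can
  be forgotten afterwards.\<close>

lemma laminar_family:
  "\<exists>(\<L> :: 'a set set) (lev :: 'a set \<Rightarrow> nat). \<L> \<noteq> {} \<and> (\<forall>X\<in>\<L>. inner G X \<and> X \<noteq> {} \<and> card (nbhd G X) \<le> k) \<and>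
    (\<forall>X\<in>\<L>. \<forall>\<phi>. automorphism G \<phi> \<longrightarrow> \<phi> ` X \<in> \<L>) \<and>
    (\<forall>X\<in>\<L>. \<forall>Y\<in>\<L>. X \<subset> Y \<longrightarrow> lev X < lev Y) \<and>
    (\<forall>X\<in>\<L>. \<forall>Y\<in>\<L>. away G X Y \<or> X \<subseteq> Y \<or> Y \<subseteq> X) \<and>
    (\<forall>v\<in>verts G. \<exists>X\<in>\<L>. v \<in> X) \<and> (\<forall>X\<in>\<L>. \<forall>Y\<in>\<L>. \<exists>Z\<in>\<L>. X \<subset> Z \<and> Y \<subset> Z)"
proof -
  define ok where "ok p \<longleftrightarrow> crit (fst p) \<and> least_crit (orbit (fst p)) (fst p) (snd p)" for p
  have "\<exists>p. \<forall>n::nat. ok (p n) \<and> snd (p n) \<union> nbhd G (snd (p n)) \<subseteq> fst (p (Suc n))"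
  proof (rule dependent_nat_choice)
    obtain D where "crit D" using crit_exists by blast
    then show "\<exists>p. ok p" using least_crit_exists[of D] unfolding ok_def by auto
    fix p :: "'a set \<times> 'a set" and n assume "ok p"
    then have "crit (snd p)" by (auto simp: ok_def least_crit_def)
    then obtain D where D: "crit D" "snd p \<union> nbhd G (snd p) \<subseteq> D" using crit_extend by blast
    obtain L where "least_crit (orbit D) D L" using least_crit_exists[OF D(1)] by blast
    then show "\<exists>q. ok q \<and> snd p \<union> nbhd G (snd p) \<subseteq> fst q"
      using D unfolding ok_def by (intro exI[of _ "(D, L)"]) simp
  qed
  then obtain p where p: "\<And>n. ok (p n)" "\<And>n::nat. snd (p n) \<union> nbhd G (snd (p n)) \<subseteq> fst (p (Suc n))" by blast
  define D where "D n = fst (p n)" for n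
  define L where "L n = snd (p n)" for n
  have D: "crit (D n)" and least: "least_crit (orbit (D n)) (D n) (L n)" for n
    using p(1) by (auto simp: ok_def D_def L_def)
  have LD: "L n \<union> nbhd G (L n) \<subseteq> D (Suc n)" for n using p(2) by (simp add: D_def L_def)
  have L: "crit (L n)" "D n \<subseteq> L n" for n using least by (auto simp: least_crit_def)
  note LV = critD(6)[OF L(1)] and DV = critD(6)[OF D]
  have "L n \<subset> L (Suc n)" for n
    using nbhd_nonempty[of "L n"] critD[OF L(1)[of n]] LD[of n] L(2)[of "Suc n"] nbhd_subset(2)[of G "L n"] by blast
  then have less: "L m \<subset> L n" if "m < n" for m n using that by (rule lift_Suc_mono_less)
  have LlessD: "L m \<subseteq> D n" if mn: "m < n" for m n
  proof -
    obtain n' where n': "n = Suc n'" "m \<le> n'" using mn by (cases n) auto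
    then have "L m \<subseteq> L n'" using less[of m n'] by (cases "m = n'") auto
    then show ?thesis using LD[of n'] n'(1) by auto
  qed
  define \<L> where "\<L> = {\<phi> ` L n | \<phi> n. automorphism G \<phi>}"
  have \<L>I: "\<phi> ` L n \<in> \<L>" if "automorphism G \<phi>" for \<phi> n using that unfolding \<L>_def by blast
  have LL: "L n \<in> \<L>" for n using \<L>I[OF automorphism_id, of n] by simp
  have crit: "crit X" if "X \<in> \<L>" for X using that crit_image[OF _ L(1)] unfolding \<L>_def by blast
  \<comment> \<open>Were n at most m, a translate of \<open>L m\<close> would lie properly inside
    another translate of \<open>L m\<close>, against \<open>no_shift\<close>.\<close>
  have strict: "m < n" if "automorphism G \<phi>" "automorphism G \<psi>" "\<phi> ` L m \<subset> \<psi> ` L n" for \<phi> \<psi> m n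
  proof (rule ccontr)
    assume "\<not> m < n"
    then have "L n \<subseteq> L m" using less[of n m] by (cases "m = n") auto
    then have "\<phi> ` L m \<subset> \<psi> ` L m" using that(3) by blast
    then have "inv_into (verts G) \<psi> ` \<phi> ` L m \<subset> inv_into (verts G) \<psi> ` \<psi> ` L m"
      unfolding less_le_not_le using automorphism_image_subset[OF that(1) LV] automorphism_image_subset[OF that(2) LV]
      by (simp add: automorphism_image_subset_iff[OF automorphism_inv[OF that(2)]])
    then have "(inv_into (verts G) \<psi> \<circ> \<phi>) ` L m \<subset> L m"
      unfolding automorphism_inv_image(1)[OF that(2) LV] image_comp[symmetric] .
    then show False
      using no_shift[OF automorphism_comp[OF automorphism_inv[OF that(2)] that(1)], of "L m"] critD[OF L(1)[of m]]
      by blast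
  qed
  \<comment> \<open>All translates of \<open>L m\<close> lie in the orbit of \<open>D n\<close>,
    which the neighbourhoods of all translates of \<open>L n\<close> avoid.\<close>
  have nested_less: "\<phi> ` L m \<subseteq> \<psi> ` L n \<or> away G (\<phi> ` L m) (\<psi> ` L n)"
    if "automorphism G \<phi>" "automorphism G \<psi>" "m < n" for \<phi> \<psi> m n
  proof (rule conn_subset_or_away)
    show "conn G (\<phi> ` L m)" "\<phi> ` L m \<subseteq> verts G" using critD[OF crit_image[OF that(1) L(1)]] by auto
    have "\<phi> ` L m \<subseteq> orbit (D n)" using subset_orbit(1)[OF that(1), of "D n"] LlessD[OF that(3)] by blast
    moreover have "nbhd G (\<psi> ` L n) \<inter> orbit (D n) = {}"
      using least_crit_image[OF that(2) orbit_subset[OF DV] orbit_image[OF _ DV] least, of n] by (simp add: least_crit_def)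
    ultimately show "\<phi> ` L m \<inter> nbhd G (\<psi> ` L n) = {}" by blast
  qed
  have nested: "away G X Y \<or> X \<subseteq> Y \<or> Y \<subseteq> X" if XY: "X \<in> \<L>" "Y \<in> \<L>" for X Y
  proof -
    obtain \<phi> m where X: "automorphism G \<phi>" "X = \<phi> ` L m" using XY unfolding \<L>_def by blast
    obtain \<psi> n where Y: "automorphism G \<psi>" "Y = \<psi> ` L n" using XY unfolding \<L>_def by blast
    consider "m < n" | "n < m" | "m = n" by linarith
    then show ?thesis
    proof cases
      case 1
      then show ?thesis using nested_less[OF X(1) Y(1)] X(2) Y(2) by blast
    next
      case 2
      then show ?thesis using nested_less[OF Y(1) X(1)] X(2) Y(2) away_sym[of Y G X] critD(6)[OF crit[OF XY(2)]] by blast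
    next
      case 3
      show ?thesis unfolding X(2) Y(2) 3
        by (rule least_crit_nested[OF crit_image[OF X(1) D] subset_orbit(1)[OF X(1)] crit_image[OF Y(1) D] subset_orbit(1)[OF Y(1)]
              least_crit_image[OF X(1) orbit_subset[OF DV] orbit_image[OF _ DV] least]
              least_crit_image[OF Y(1) orbit_subset[OF DV] orbit_image[OF _ DV] least]])
    qed
  qed
  \<comment> \<open>Any index representing X may be chosen, since \<open>strict\<close> holds for
    all representations.\<close>
  define lev where "lev X = (SOME n. \<exists>\<phi>. automorphism G \<phi> \<and> X = \<phi> ` L n)" for X
  have lev: "\<exists>\<phi>. automorphism G \<phi> \<and> X = \<phi> ` L (lev X)" if "X \<in> \<L>" for X
    unfolding lev_def by (rule someI_ex) (use that in \<open>auto simp: \<L>_def\<close>)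
  have lev_less: "lev X < lev Y" if "X \<in> \<L>" "Y \<in> \<L>" "X \<subset> Y" for X Y
    using lev[OF that(1)] lev[OF that(2)] strict that(3) by metis
  let ?Z = "\<Union>n. L n"
  have cover: "verts G \<subseteq> ?Z"
  proof (rule conn_subset[OF conn_verts order_refl])
    show "verts G \<inter> ?Z \<noteq> {}" using critD(3,6)[OF L(1)[of 0]] by blast
    have "nbhd G ?Z \<subseteq> ?Z"
    proof
      fix v assume v: "v \<in> nbhd G ?Z"
      then obtain u where u: "u \<in> ?Z" "adjacent G u v" "v \<in> verts G" "v \<notin> ?Z" by (rule nbhdE)
      then obtain n where "u \<in> L n" by blast
      then have "v \<in> nbhd G (L n)" using u by (auto intro: nbhdI)
      then show "v \<in> ?Z" using LD[of n] L(2)[of "Suc n"] by blast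
    qed
    then show "verts G \<inter> nbhd G ?Z = {}" using nbhd_subset(2)[of G ?Z] by blast
  qed
  \<comment> \<open>Once \<open>L n\<close> contains a vertex of X and n exceeds the level of X, the
    two are not away from each other, so X is inside.\<close>
  have up: "\<exists>m. \<forall>n>m. X \<subseteq> L n" if X: "X \<in> \<L>" for X
  proof -
    obtain \<phi> i where i: "automorphism G \<phi>" "X = \<phi> ` L i" using X unfolding \<L>_def by blast
    obtain x where x: "x \<in> X" using critD(3)[OF crit[OF X]] by blast
    then obtain j where j: "x \<in> L j" using cover critD(6)[OF crit[OF X]] by blast
    have "X \<subseteq> L n" if "n > max i j" for n
    proof -
      have "x \<in> L n" using j less[of j n] that by auto
      then show ?thesis
        using nested_less[OF i(1) automorphism_id, of i n] that x unfolding i(2) away_def by auto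
    qed
    then show ?thesis by blast
  qed
  have directed: "\<exists>Z\<in>\<L>. X \<subset> Z \<and> Y \<subset> Z" if XY: "X \<in> \<L>" "Y \<in> \<L>" for X Y
  proof -
    obtain m m' where "\<forall>n>m. X \<subseteq> L n" "\<forall>n>m'. Y \<subseteq> L n" using up XY by meson
    then have "X \<subseteq> L (Suc (max m m'))" "Y \<subseteq> L (Suc (max m m'))" by auto
    then have "X \<subset> L (Suc (Suc (max m m')))" "Y \<subset> L (Suc (Suc (max m m')))"
      using less[of "Suc (max m m')" "Suc (Suc (max m m'))"] by auto
    then show ?thesis using LL by blast
  qed
  have inv: "\<phi> ` X \<in> \<L>" if X: "X \<in> \<L>" and \<phi>: "automorphism G \<phi>" for X \<phi>
  proof -
    obtain \<psi> i where i: "automorphism G \<psi>" "X = \<psi> ` L i" using X unfolding \<L>_def by blast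
    show ?thesis using \<L>I[OF automorphism_comp[OF \<phi> i(1)], of i] i(2) by (simp add: image_comp)
  qed
  have "\<forall>v\<in>verts G. \<exists>X\<in>\<L>. v \<in> X" using cover LL by blast
  moreover have "\<forall>X\<in>\<L>. inner G X \<and> X \<noteq> {} \<and> card (nbhd G X) \<le> k" using critD(1,3,5)[OF crit] by simp
  moreover have "\<L> \<noteq> {}" using LL by blast
  moreover have "\<forall>X\<in>\<L>. \<forall>\<phi>. automorphism G \<phi> \<longrightarrow> \<phi> ` X \<in> \<L>" using inv by simp
  moreover have "\<forall>X\<in>\<L>. \<forall>Y\<in>\<L>. X \<subset> Y \<longrightarrow> lev X < lev Y" using lev_less by simp
  moreover have "\<forall>X\<in>\<L>. \<forall>Y\<in>\<L>. away G X Y \<or> X \<subseteq> Y \<or> Y \<subseteq> X" using nested by simp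
  moreover have "\<forall>X\<in>\<L>. \<forall>Y\<in>\<L>. \<exists>Z\<in>\<L>. X \<subset> Z \<and> Y \<subset> Z" using directed by simp
  ultimately show ?thesis by (intro exI[of _ \<L>] exI[of _ lev] conjI)
qed

end


section \<open>Trees given by parent functions\<close>

text \<open>A tree without a root: parents have strictly larger levels, so every branch climbs
  forever, and \<open>coalesce\<close> makes all branches merge towards one end.\<close>

locale upward_tree =
  fixes N :: "'n set" and par :: "'n \<Rightarrow> 'n" and lev :: "'n \<Rightarrow> nat"
  assumes N_nonempty: "N \<noteq> {}" and par_in: "\<And>x. x \<in> N \<Longrightarrow> par x \<in> N"
    and lev_par: "\<And>x. x \<in> N \<Longrightarrow> lev x < lev (par x)"
    and coalesce: "\<And>x y. x \<in> N \<Longrightarrow> y \<in> N \<Longrightarrow> \<exists>i j. (par ^^ i) x = (par ^^ j) y"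
begin

definition T :: "'n graph" where
  "T = \<lparr>verts = N, edges = {{x, par x} | x. x \<in> N}\<rparr>"

definition below :: "'n \<Rightarrow> 'n set" where
  "below s = {x \<in> N. \<exists>i. (par ^^ i) x = s}"

lemma verts_T [simp]: "verts T = N"
  by (simp add: T_def)

lemma adjacent_T: "adjacent T x y \<longleftrightarrow> x \<in> N \<and> y = par x \<or> y \<in> N \<and> x = par y"
  by (auto simp: adjacent_def T_def doubleton_eq_iff)

lemma pow_in: "x \<in> N \<Longrightarrow> (par ^^ i) x \<in> N"
  by (induction i) (auto intro: par_in)

lemma lev_pow: "x \<in> N \<Longrightarrow> lev x + i \<le> lev ((par ^^ i) x)"
proof (induction i)
  case (Suc i)
  then show ?case using lev_par[OF pow_in[OF Suc.prems, of i]] by simp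
qed simp

lemma par_par: "x \<in> N \<Longrightarrow> par (par x) \<noteq> x"
  using lev_par[of x] lev_par[OF par_in, of x] by auto

lemma par_neq: "x \<in> N \<Longrightarrow> par x \<noteq> x"
  using lev_par[of x] by auto

lemma reach_pow:
  assumes "x \<in> N" "\<And>j. j \<le> i \<Longrightarrow> (par ^^ j) x \<in> X"
  shows "reach T X x ((par ^^ i) x)"
  using assms(2)
proof (induction i)
  case (Suc i)
  then have "reach T X x ((par ^^ i) x)" by simp
  moreover have "reach T X ((par ^^ i) x) ((par ^^ Suc i) x)"
    using Suc.prems[of i] Suc.prems[of "Suc i"] pow_in[OF assms(1), of i] by (intro reach_step) (auto simp: adjacent_T)
  ultimately show ?case by (rule reach_trans)
qed simp

lemma simple_T: "simple_graph T"
proof -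
  have "\<exists>u\<in>N. \<exists>v\<in>N. u \<noteq> v \<and> {x, par x} = {u, v}" if "x \<in> N" for x
    using that par_in par_neq[OF that] by (intro bexI[of _ x] bexI[of _ "par x"]) auto
  then show ?thesis unfolding simple_graph_def by (auto simp: T_def)
qed

lemma connected_T: "connected_graph T"
proof -
  have "reach T N x y" if xy: "x \<in> N" "y \<in> N" for x y
  proof -
    obtain i j where ij: "(par ^^ i) x = (par ^^ j) y" using coalesce[OF xy] by blast
    have "reach T N x ((par ^^ i) x)" "reach T N y ((par ^^ j) y)"
      by (rule reach_pow[OF xy(1) pow_in[OF xy(1)]], rule reach_pow[OF xy(2) pow_in[OF xy(2)]])
    then show ?thesis unfolding ij using reach_sym reach_trans by metis
  qed
  then show ?thesis using N_nonempty by (simp add: connected_graph_iff conn_def)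
qed

text \<open>In a cycle, both neighbours of a vertex of least level would be its parent.\<close>

lemma acyclic_T: "\<not> (\<exists>p. is_path T p \<and> 3 \<le> length p \<and> adjacent T (last p) (hd p))"
proof
  assume "\<exists>p. is_path T p \<and> 3 \<le> length p \<and> adjacent T (last p) (hd p)"
  then obtain p where p: "is_path T p" "3 \<le> length p" "adjacent T (last p) (hd p)" by blast
  define n where "n = length p"
  have dist: "distinct p" and suc: "successively (adjacent T) p" and ne: "p \<noteq> []" and pN: "set p \<subseteq> N"
    using p(1) by (auto simp: is_path_def)
  have cyc: "adjacent T (p ! i) (p ! (Suc i mod n))" if "i < n" for i
  proof (cases "Suc i = n")
    case True
    then have "i = length p - 1" "Suc i mod n = 0" by (simp_all add: n_def)
    then have "p ! i = last p" "p ! (Suc i mod n) = hd p"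
      using last_conv_nth[OF ne] hd_conv_nth[OF ne] by metis+
    then show ?thesis using p(3) by simp
  next
    case False
    then show ?thesis using that suc by (simp add: successively_conv_nth n_def)
  qed
  obtain x where x: "x \<in> set p" "\<And>y. y \<in> set p \<Longrightarrow> lev x \<le> lev y"
    using ex_has_least_nat[of "\<lambda>x. x \<in> set p" _ lev, OF hd_in_set[OF ne]] by blast
  obtain i where i: "i < n" "x = p ! i" using x(1) by (auto simp: in_set_conv_nth n_def)
  define j where "j = (if i = 0 then n - 1 else i - 1)"
  have j: "j < n" "Suc j mod n = i" using i(1) by (auto simp: j_def)
  have up: "y = par x" if "adjacent T x y \<or> adjacent T y x" "y \<in> set p" for y
  proof (rule ccontr)
    assume "y \<noteq> par x"
    then have "y \<in> N" "x = par y" using that(1) by (auto simp: adjacent_T)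
    then show False using lev_par[of y] x(2)[OF that(2)] by simp
  qed
  have k: "Suc i mod n < n" using i(1) by simp
  have "p ! (Suc i mod n) = par x" using up cyc[OF i(1)] i(2) k by (auto simp: n_def)
  moreover have "p ! j = par x" using up cyc[OF j(1)] i(2) j by (auto simp: n_def)
  ultimately have "Suc i mod n = j" using nth_eq_iff_index_eq[OF dist, of "Suc i mod n" j] j(1) k by (simp add: n_def)
  \<comment> \<open>The cyclic predecessor and successor of a position differ when there are at
    least three positions.\<close>
  then show False using i(1) p(2) unfolding j_def n_def by (auto simp: mod_Suc split: if_splits)
qed

lemma tree_T: "is_tree T"
  using simple_T connected_T acyclic_T by (simp add: is_tree_def)

section \<open>The two sides of a tree edge\<close>

lemma below_self: "s \<in> N \<Longrightarrow> s \<in> below s"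
  unfolding below_def by (auto intro!: exI[of _ 0])

lemma below_lev: "x \<in> below s \<Longrightarrow> lev x \<le> lev s"
  using lev_pow unfolding below_def by (auto dest: add_leD1)

text \<open>Shows that the descendants of b form one side of the edge from b to its parent; it
  controls both the graph without this edge and the course of paths.\<close>

lemma below_exit:
  assumes "adjacent T u v" "u \<in> below b" "v \<notin> below b"
  shows "u = b \<and> v = par b"
proof -
  obtain i where i: "u \<in> N" "(par ^^ i) u = b" using assms(2) by (auto simp: below_def)
  show ?thesis
  proof (cases "v = par u")
    case True
    have "i = 0"
    proof (rule ccontr)
      assume "i \<noteq> 0"
      then obtain j where "i = Suc j" by (cases i) auto
      then have "(par ^^ j) v = b" using i(2) True by (simp add: funpow_swap1)
      then show False using assms(3) par_in[OF i(1)] True by (auto simp: below_def)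
    qed
    then show ?thesis using i(2) True by simp
  next
    case False
    then have v: "v \<in> N" "u = par v" using assms(1) by (auto simp: adjacent_T)
    then have "(par ^^ Suc i) v = b" using i(2) by (simp add: funpow_swap1)
    then show ?thesis using assms(3) v(1) unfolding below_def by blast
  qed
qed

text \<open>An upward step can use the deleted edge only when it starts at s, because the parent of
  s does not have s as its own parent.\<close>

lemma reach_pow_delete:
  assumes "x \<in> N" "s \<in> N" "\<And>j. j < i \<Longrightarrow> (par ^^ j) x \<noteq> s"
  shows "reach (delete_edge T s (par s)) N x ((par ^^ i) x)"
  using assms(3)
proof (induction i)
  case (Suc i)
  let ?y = "(par ^^ i) x"
  have y: "?y \<in> N" "?y \<noteq> s" using pow_in[OF assms(1)] Suc.prems[of i] by auto
  then have "{?y, par ?y} \<noteq> {s, par s}" using par_par[OF assms(2)] by (auto simp: doubleton_eq_iff)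
  then have "reach (delete_edge T s (par s)) N ?y (par ?y)"
    using y par_in by (intro reach_step) (auto simp: adjacent_delete_edge adjacent_T)
  moreover have "reach (delete_edge T s (par s)) N x ?y" using Suc by simp
  ultimately show ?case unfolding funpow.simps comp_apply by (rule reach_trans[rotated])
qed simp

lemma reach_delete_below:
  assumes "reach (delete_edge T s (par s)) N x y" "x \<in> below s"
  shows "y \<in> below s"
  by (rule reach_closed[OF assms]) (use below_exit in \<open>auto simp: adjacent_delete_edge\<close>)

lemma tree_side_below:
  assumes s: "s \<in> N"
  shows "tree_side T s (par s) = below s"
proof -
  have "reach (delete_edge T s (par s)) N s x" if x: "x \<in> below s" for x
  proof -
    obtain i where i: "x \<in> N" "(par ^^ i) x = s" using x by (auto simp: below_def)
    \<comment> \<open>An earlier visit to s would make s its own proper ancestor, against the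
      increase of levels.\<close>
    have neq: "(par ^^ j) x \<noteq> s" if "j < i" for j
    proof -
      have "s = (par ^^ (i - j)) ((par ^^ j) x)"
        using i(2) that by (metis add_diff_inverse_nat comp_apply funpow_add less_imp_not_less add.commute)
      then show ?thesis using lev_pow[OF pow_in[OF i(1)], of j "i - j"] that by auto
    qed
    have "reach (delete_edge T s (par s)) N x ((par ^^ i) x)" by (rule reach_pow_delete[OF i(1) s neq])
    then show ?thesis unfolding i(2) by (rule reach_sym)
  qed
  then show ?thesis
    using reach_delete_below[OF _ below_self[OF s]] s
    by (auto simp: tree_side_def component_of_def linked_iff_reach)
qed

lemma par_not_below: "s \<in> N \<Longrightarrow> par s \<notin> below s"
  using below_lev lev_par by (meson not_le)

lemma tree_side_above:
  assumes s: "s \<in> N"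
  shows "tree_side T (par s) s = N - below s"
proof -
  have sym: "delete_edge T (par s) s = delete_edge T s (par s)" by (simp add: delete_edge_def insert_commute)
  let ?H = "delete_edge T s (par s)"
  have "reach ?H N (par s) x" if x: "x \<in> N" "x \<notin> below s" for x
  proof -
    obtain i j where ij: "(par ^^ i) x = (par ^^ j) (par s)" using coalesce[OF x(1) par_in[OF s]] by blast
    have "reach ?H N x ((par ^^ i) x)"
      by (rule reach_pow_delete[OF x(1) s]) (use x in \<open>auto simp: below_def\<close>)
    moreover have "reach ?H N (par s) ((par ^^ j) (par s))"
    proof (rule reach_pow_delete[OF par_in[OF s] s])
      show "(par ^^ m) (par s) \<noteq> s" for m using lev_pow[OF par_in[OF s], of m] lev_par[OF s] by auto
    qed
    ultimately show ?thesis unfolding ij using reach_sym reach_trans by metis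
  qed
  moreover have "x \<in> N \<and> x \<notin> below s" if "reach ?H N (par s) x" for x
    using reach_in[OF that par_in[OF s]] reach_delete_below[OF reach_sym[OF that]] par_not_below[OF s] by blast
  ultimately show ?thesis using par_in[OF s]
    by (auto simp: tree_side_def component_of_def linked_iff_reach sym)
qed

lemma path_stays_below:
  assumes "successively (adjacent T) p" "p \<noteq> []" "hd p \<in> below b" "par b \<notin> set p"
  shows "last p \<in> below b"
  using assms
proof (induction p rule: induct_list012)
  case (3 x y zs)
  then have "y \<in> below b" using below_exit[of x y b] by auto
  then show ?case using 3 by simp
qed auto

lemma path_stays_outside:
  assumes "successively (adjacent T) p" "p \<noteq> []" "hd p \<notin> below a" "a \<notin> set p"
  shows "last p \<notin> below a"
  using assms
proof (induction p rule: induct_list012)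
  case (3 x y zs)
  then have "adjacent T y x" by (simp add: adjacent_symD)
  then have "y \<notin> below a" using below_exit[of y x a] 3 by auto
  then show ?case using 3 by simp
qed auto

section \<open>The rays and the end of the tree\<close>

lemma pow_inj: "x \<in> N \<Longrightarrow> inj (\<lambda>n. (par ^^ n) x)"
proof (rule injI, rule ccontr)
  fix m n assume x: "x \<in> N" and eq: "(par ^^ m) x = (par ^^ n) x" and "m \<noteq> n"
  have "(par ^^ a) x \<noteq> (par ^^ b) x" if "a < b" for a b
  proof -
    have "(par ^^ b) x = (par ^^ (b - a)) ((par ^^ a) x)"
      using that by (metis add_diff_inverse_nat comp_apply funpow_add less_imp_not_less add.commute)
    then show ?thesis using lev_pow[OF pow_in[OF x], of a "b - a"] that by auto
  qed
  then show False using eq \<open>m \<noteq> n\<close> by (metis linorder_neqE_nat)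
qed

lemma pow_ray: "x \<in> N \<Longrightarrow> (\<lambda>n. (par ^^ n) x) \<in> rays T"
  using pow_inj pow_in by (auto simp: rays_def adjacent_T)

text \<open>After a downward step, going up would mean returning to the vertex just left. So a ray
  that descends once descends forever, which levels in the natural numbers forbid.\<close>

lemma ray_pow:
  assumes r: "r \<in> rays T"
  shows "r n = (par ^^ n) (r 0)"
proof -
  have rN: "r n \<in> N" and adj: "adjacent T (r n) (r (Suc n))" for n using r by (auto simp: rays_def)
  have inj: "inj r" using r by (simp add: rays_def)
  have up: "r (Suc n) = par (r n)" for n
  proof (rule ccontr)
    assume n: "r (Suc n) \<noteq> par (r n)"
    have down: "r (n + i) = par (r (Suc (n + i)))" for i
    proof (induction i)
      case 0
      then show ?case using n adj[of n] by (auto simp: adjacent_T)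
    next
      case (Suc i)
      have "r (Suc (Suc (n + i))) \<noteq> r (n + i)" using inj by (simp add: inj_eq)
      then show ?case using Suc adj[of "Suc (n + i)"] by (auto simp: adjacent_T)
    qed
    have "lev (r (n + i)) + i \<le> lev (r n)" for i
    proof (induction i)
      case (Suc i)
      then show ?case using lev_par[OF rN, of "Suc (n + i)"] down[of i] by simp
    qed simp
    from this[of "Suc (lev (r n))"] show False by simp
  qed
  show ?thesis by (induction n) (simp_all add: up)
qed

lemma ends_T: "ends T = {rays T}"
proof -
  have eq: "(r, s) \<in> end_equiv T" if rs: "r \<in> rays T" "s \<in> rays T" for r s
  proof -
    have rN: "r 0 \<in> N" "s 0 \<in> N" using rs by (auto simp: rays_def)
    obtain i j where ij: "(par ^^ i) (r 0) = (par ^^ j) (s 0)" using coalesce[OF rN] by blast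
    have "\<exists>C\<in>components (delete_verts T S). eventually_in r C \<and> eventually_in s C"
      if S: "finite S" "S \<subseteq> verts T" for S
    proof -
      obtain m where m: "\<And>x. x \<in> S \<Longrightarrow> lev x \<le> m" using finite_nat_set_iff_bounded_le[of "lev ` S"] S(1) by auto
      \<comment> \<open>Start m + 1 steps above a common vertex of the two rays: from there on all
        levels exceed the maximum over S, so the common tail misses S.\<close>
      define z where "z = (par ^^ Suc m) ((par ^^ i) (r 0))"
      have zN: "z \<in> N" unfolding z_def by (intro pow_in rN)
      have high: "(par ^^ n) z \<in> verts T - S" for n
      proof -
        have "m < lev z" unfolding z_def using lev_pow[OF pow_in[OF rN(1)], of i "Suc m"] by simp
        also have "lev z \<le> lev ((par ^^ n) z)" using lev_pow[OF zN, of n] by simp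
        finally show ?thesis using m pow_in[OF zN] by fastforce
      qed
      define C where "C = component_in T (verts T - S) z"
      have zC: "(par ^^ n) z \<in> C" for n
        unfolding C_def component_in_def using reach_pow[OF zN, of n "verts T - S"] high by simp
      have ev: "eventually_in q C" if q: "q \<in> rays T" "(par ^^ l) (q 0) = (par ^^ i) (r 0)" for q l
      proof -
        have "q n \<in> C" if "n \<ge> Suc m + l" for n
        proof -
          have "n = (n - (Suc m + l)) + (Suc m + l)" using that by simp
          then have "q n = (par ^^ (n - (Suc m + l))) ((par ^^ Suc m) ((par ^^ l) (q 0)))"
            using ray_pow[OF q(1), of n] by (metis comp_apply funpow_add)
          then show ?thesis using zC q(2) unfolding z_def by simp
        qed
        then have "{n. q n \<notin> C} \<subseteq> {..<Suc m + l}" by (auto simp: not_le[symmetric])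
        then show ?thesis unfolding eventually_in_def by (rule finite_subset) simp
      qed
      have "C \<in> components (delete_verts T S)"
        unfolding components_delete_verts C_def using high[of 0] by auto
      then show ?thesis using ev[OF rs(1) refl] ev[OF rs(2) ij[symmetric]] by blast
    qed
    then show ?thesis using rs by (simp add: end_equiv_def)
  qed
  have "end_equiv T = rays T \<times> rays T" using eq by (auto simp: end_equiv_def)
  moreover obtain x where "x \<in> N" using N_nonempty by blast
  ultimately show ?thesis using pow_ray[of x] unfolding ends_def quotient_def by auto
qed

end


section \<open>The tree-decomposition\<close>

locale laminar = one_end_crit +
  fixes \<L> :: "'a set set" and lev :: "'a set \<Rightarrow> nat"
  assumes \<L>_nonempty: "\<L> \<noteq> {}"
    and \<L>_inner: "\<And>X. X \<in> \<L> \<Longrightarrow> inner G X \<and> X \<noteq> {} \<and> card (nbhd G X) \<le> k"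
    and \<L>_image: "\<And>X \<phi>. X \<in> \<L> \<Longrightarrow> automorphism G \<phi> \<Longrightarrow> \<phi> ` X \<in> \<L>"
    and lev_less: "\<And>X Y. X \<in> \<L> \<Longrightarrow> Y \<in> \<L> \<Longrightarrow> X \<subset> Y \<Longrightarrow> lev X < lev Y"
    and nested: "\<And>X Y. X \<in> \<L> \<Longrightarrow> Y \<in> \<L> \<Longrightarrow> away G X Y \<or> X \<subseteq> Y \<or> Y \<subseteq> X"
    and cover: "\<And>v. v \<in> verts G \<Longrightarrow> \<exists>X\<in>\<L>. v \<in> X"
    and directed: "\<And>X Y. X \<in> \<L> \<Longrightarrow> Y \<in> \<L> \<Longrightarrow> \<exists>Z\<in>\<L>. X \<subset> Z \<and> Y \<subset> Z"
begin

definition closure :: "'a set \<Rightarrow> 'a set" where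
  "closure X = X \<union> nbhd G X"

definition parent :: "'a set \<Rightarrow> 'a set" where
  "parent X = (SOME Y. Y \<in> \<L> \<and> X \<subset> Y \<and> (\<forall>Z\<in>\<L>. X \<subset> Z \<longrightarrow> Y \<subseteq> Z))"

text \<open>Smaller members are removed, but not their neighbours outside of them; the neighbours of
  a child remain and form the adhesion set towards it.\<close>

definition part :: "'a set \<Rightarrow> 'a set" where
  "part X = closure X - \<Union>{Y \<in> \<L>. Y \<subset> X}"

lemma \<L>_verts: "X \<in> \<L> \<Longrightarrow> X \<subseteq> verts G"
  using \<L>_inner by (auto simp: inner_def)

lemma closure_verts: "X \<in> \<L> \<Longrightarrow> closure X \<subseteq> verts G"
  using \<L>_verts nbhd_subset(1)[of G X] by (auto simp: closure_def)

lemma closure_mono: "X \<subseteq> Y \<Longrightarrow> closure X \<subseteq> closure Y"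
  unfolding closure_def nbhd_def by blast

lemma nested_or_disjoint:
  assumes "X \<in> \<L>" "Y \<in> \<L>"
  shows "X \<inter> closure Y = {} \<and> closure X \<inter> Y = {} \<or> X \<subseteq> Y \<or> Y \<subseteq> X"
  using nested[OF assms] away_sym[OF \<L>_verts[OF assms(1)], of Y] unfolding away_def closure_def by blast

text \<open>Members with a common vertex are pairwise comparable, so one of least level is contained
  in all the others.\<close>

lemma least_superset:
  assumes "S \<subseteq> \<L>" "S \<noteq> {}" "v \<in> \<Inter>S"
  shows "\<exists>X\<in>S. \<forall>Y\<in>S. X \<subseteq> Y"
proof -
  obtain X where X: "X \<in> S" "\<And>Y. Y \<in> S \<Longrightarrow> lev X \<le> lev Y"
    using assms(2) ex_has_least_nat[of "\<lambda>X. X \<in> S" _ lev] by blast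
  have "X \<subseteq> Y" if Y: "Y \<in> S" for Y
  proof -
    have "v \<in> X" "v \<in> Y" using assms(3) X(1) Y by auto
    then have "X \<subseteq> Y \<or> Y \<subseteq> X"
      using nested_or_disjoint[of X Y] X(1) Y assms(1) by (auto simp: closure_def)
    moreover have "\<not> Y \<subset> X" using lev_less[of Y X] X Y assms(1) by (meson not_le subsetD)
    ultimately show ?thesis by blast
  qed
  then show ?thesis using X(1) by blast
qed

lemma parent:
  assumes X: "X \<in> \<L>"
  shows "parent X \<in> \<L>" "X \<subset> parent X" "\<And>Z. Z \<in> \<L> \<Longrightarrow> X \<subset> Z \<Longrightarrow> parent X \<subseteq> Z"
proof -
  obtain v where v: "v \<in> X" using \<L>_inner[OF X] by blast
  have "\<exists>Y\<in>{Y \<in> \<L>. X \<subset> Y}. \<forall>Z\<in>{Y \<in> \<L>. X \<subset> Y}. Y \<subseteq> Z"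
    by (rule least_superset[of _ v]) (use directed[OF X X] v in blast)+
  then have "\<exists>Y. Y \<in> \<L> \<and> X \<subset> Y \<and> (\<forall>Z\<in>\<L>. X \<subset> Z \<longrightarrow> Y \<subseteq> Z)" by blast
  from someI_ex[OF this] show "parent X \<in> \<L>" "X \<subset> parent X" "\<And>Z. Z \<in> \<L> \<Longrightarrow> X \<subset> Z \<Longrightarrow> parent X \<subseteq> Z"
    unfolding parent_def[symmetric] by auto
qed

lemma parent_pow_in: "X \<in> \<L> \<Longrightarrow> (parent ^^ i) X \<in> \<L>"
  by (induction i) (auto intro: parent(1))

lemma parent_pow_superset: "X \<in> \<L> \<Longrightarrow> X \<subseteq> (parent ^^ i) X"
proof (induction i)
  case (Suc i)
  then show ?case using parent(2)[OF parent_pow_in[OF Suc.prems, of i]] by auto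
qed simp

lemma parent_pow_reaches:
  assumes "X \<in> \<L>" "Y \<in> \<L>" "X \<subseteq> Y"
  shows "\<exists>i. (parent ^^ i) X = Y"
  using assms
proof (induction "lev Y - lev X" arbitrary: X rule: less_induct)
  case less
  show ?case
  proof (cases "X = Y")
    case True
    then show ?thesis by (intro exI[of _ 0]) simp
  next
    case False
    then have sub: "X \<subset> Y" using less.prems by blast
    have "lev X < lev (parent X)" "lev X < lev Y"
      using lev_less parent[OF less.prems(1)] less.prems sub by auto
    then have "lev Y - lev (parent X) < lev Y - lev X" by (intro diff_less_mono2)
    from less.hyps[OF this parent(1)[OF less.prems(1)] less.prems(2) parent(3)[OF less.prems(1,2) sub]]
    obtain i where "(parent ^^ i) (parent X) = Y" by blast
    then show ?thesis by (intro exI[of _ "Suc i"]) (simp add: funpow_swap1)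
  qed
qed

lemma least_containing: "v \<in> verts G \<Longrightarrow> \<exists>X\<in>\<L>. v \<in> X \<and> (\<forall>Y\<in>\<L>. v \<in> Y \<longrightarrow> X \<subseteq> Y)"
  using least_superset[of "{X \<in> \<L>. v \<in> X}" v] cover by blast

lemma in_part_least:
  assumes "X \<in> \<L>" "v \<in> closure X" "\<And>Y. Y \<in> \<L> \<Longrightarrow> v \<in> Y \<Longrightarrow> X \<subseteq> Y"
  shows "v \<in> part X"
  using assms unfolding part_def by blast

section \<open>Unions of parts on the two sides of an edge, and the axioms of a
  tree-decomposition\<close>

lemma Union_part_subset:
  assumes X: "X \<in> \<L>"
  shows "(\<Union>Y\<in>{Y \<in> \<L>. Y \<subseteq> X}. part Y) = closure X"
proof
  have "part Y \<subseteq> closure X" if "Y \<subseteq> X" for Y using closure_mono[OF that] by (auto simp: part_def)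
  then show "(\<Union>Y\<in>{Y \<in> \<L>. Y \<subseteq> X}. part Y) \<subseteq> closure X" by blast
  show "closure X \<subseteq> (\<Union>Y\<in>{Y \<in> \<L>. Y \<subseteq> X}. part Y)"
  proof
    fix v assume v: "v \<in> closure X"
    show "v \<in> (\<Union>Y\<in>{Y \<in> \<L>. Y \<subseteq> X}. part Y)"
    proof (cases "v \<in> X")
      case True
      then obtain Y where Y: "Y \<in> \<L>" "v \<in> Y" "\<And>Z. Z \<in> \<L> \<Longrightarrow> v \<in> Z \<Longrightarrow> Y \<subseteq> Z"
        using least_containing[of v] \<L>_verts[OF X] by blast
      then have "v \<in> part Y" by (intro in_part_least) (auto simp: closure_def)
      then show ?thesis using Y True X by blast
    next
      case False
      then have "v \<in> part X" using v unfolding part_def by blast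
      then show ?thesis using X by blast
    qed
  qed
qed

text \<open>With \<open>Union_part_subset\<close>, this gives the edge from X to its parent the
  separation into the closure of X and the complement of X, with the neighbours of X as adhesion
  set.\<close>

lemma Union_part_not_subset:
  assumes X: "X \<in> \<L>"
  shows "(\<Union>Y\<in>{Y \<in> \<L>. \<not> Y \<subseteq> X}. part Y) = verts G - X"
proof
  show "(\<Union>Y\<in>{Y \<in> \<L>. \<not> Y \<subseteq> X}. part Y) \<subseteq> verts G - X"
  proof
    fix v assume "v \<in> (\<Union>Y\<in>{Y \<in> \<L>. \<not> Y \<subseteq> X}. part Y)"
    then obtain Y where Y: "Y \<in> \<L>" "\<not> Y \<subseteq> X" "v \<in> part Y" by blast
    then have "v \<in> closure Y" by (simp add: part_def)
    moreover have "v \<notin> X"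
      using nested_or_disjoint[OF X Y(1)] Y X \<open>v \<in> closure Y\<close> unfolding part_def by blast
    ultimately show "v \<in> verts G - X" using closure_verts[OF Y(1)] by blast
  qed
  show "verts G - X \<subseteq> (\<Union>Y\<in>{Y \<in> \<L>. \<not> Y \<subseteq> X}. part Y)"
  proof
    fix v assume v: "v \<in> verts G - X"
    then obtain Y where Y: "Y \<in> \<L>" "v \<in> Y" "\<And>Z. Z \<in> \<L> \<Longrightarrow> v \<in> Z \<Longrightarrow> Y \<subseteq> Z"
      using least_containing[of v] by blast
    then have "v \<in> part Y" by (intro in_part_least) (auto simp: closure_def)
    then show "v \<in> (\<Union>Y\<in>{Y \<in> \<L>. \<not> Y \<subseteq> X}. part Y)" using Y v by blast
  qed
qed

lemma Union_part: "(\<Union>X\<in>\<L>. part X) = verts G"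
proof
  show "(\<Union>X\<in>\<L>. part X) \<subseteq> verts G" using closure_verts unfolding part_def by blast
  show "verts G \<subseteq> (\<Union>X\<in>\<L>. part X)"
  proof
    fix v assume "v \<in> verts G"
    then obtain X where "X \<in> \<L>" "v \<in> X" using cover by blast
    then show "v \<in> (\<Union>X\<in>\<L>. part X)" using Union_part_subset[of X] by (auto simp: closure_def)
  qed
qed

text \<open>The least members containing u and v are comparable, since the closure of each contains
  both vertices. The part of the smaller one contains the edge.\<close>

lemma edge_in_part:
  assumes "adjacent G u v"
  shows "\<exists>X\<in>\<L>. {u, v} \<subseteq> part X"
proof -
  note uv = adjacent_in_verts[OF simple assms]
  obtain X where X: "X \<in> \<L>" "u \<in> X" "\<And>Y. Y \<in> \<L> \<Longrightarrow> u \<in> Y \<Longrightarrow> X \<subseteq> Y"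
    using least_containing[OF uv(1)] by blast
  obtain Y where Y: "Y \<in> \<L>" "v \<in> Y" "\<And>Z. Z \<in> \<L> \<Longrightarrow> v \<in> Z \<Longrightarrow> Y \<subseteq> Z"
    using least_containing[OF uv(2)] by blast
  have vX: "v \<in> closure X" using nbhdI[OF X(2) assms uv(2)] by (auto simp: closure_def)
  have uY: "u \<in> closure Y" using nbhdI[OF Y(2) adjacent_symD[OF assms] uv(1)] by (auto simp: closure_def)
  have "X \<subseteq> Y \<or> Y \<subseteq> X" using nested_or_disjoint[OF X(1) Y(1)] X(2) uY by blast
  then show ?thesis
  proof
    assume sub: "X \<subseteq> Y"
    have "v \<in> part X" using in_part_least[OF X(1) vX] Y(3) sub by blast
    moreover have "u \<in> part X" using in_part_least[OF X(1) _ X(3)] X(2) by (auto simp: closure_def)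
    ultimately show ?thesis using X(1) by blast
  next
    assume sub: "Y \<subseteq> X"
    have "u \<in> part Y" using in_part_least[OF Y(1) uY] X(3) sub by blast
    moreover have "v \<in> part Y" using in_part_least[OF Y(1) _ Y(3)] Y(2) by (auto simp: closure_def)
    ultimately show ?thesis using Y(1) by blast
  qed
qed

lemma part_convex:
  assumes "v \<in> part X" "v \<in> part Z" "X \<subseteq> Y" "Y \<subseteq> Z"
  shows "v \<in> part Y"
  using assms closure_mono[OF assms(3)] unfolding part_def by blast

text \<open>The upward step for the intersection axiom. If v is in A, then C lies above A and
  convexity applies. If v is a neighbour of A, a member properly inside the parent that contained v
  would be comparable with A, and there is none between A and its parent.\<close>

lemma part_parent:
  assumes A: "A \<in> \<L>" and v: "v \<in> part A" and C: "C \<in> \<L>" "v \<in> part C" "\<not> C \<subseteq> A"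
  shows "v \<in> part (parent A)"
proof (cases "v \<in> A")
  case True
  then have "A \<subset> C" using nested_or_disjoint[OF A C(1)] C(2,3) unfolding part_def by blast
  then show ?thesis using part_convex[OF v C(2)] parent[OF A] C(1) by blast
next
  case False
  have vA: "v \<in> closure A" using v by (simp add: part_def)
  have "v \<notin> Z" if Z: "Z \<in> \<L>" "Z \<subset> parent A" for Z
    using nested_or_disjoint[OF A Z(1)] vA False parent(3)[OF A Z(1)] Z(2) by blast
  moreover have "v \<in> closure (parent A)" using vA closure_mono parent(2)[OF A] by blast
  ultimately show ?thesis unfolding part_def by blast
qed

text \<open>Any injection into the prescribed type of nodes would do.\<close>

definition node :: "'a set \<Rightarrow> 'a tree_node" where
  "node X = {(X, {})}"

definition set_of :: "'a tree_node \<Rightarrow> 'a set" where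
  "set_of t = fst (the_elem t)"

lemma set_of_node [simp]: "set_of (node X) = X"
  by (simp add: set_of_def node_def)

lemma node_eq [simp]: "node X = node Y \<longleftrightarrow> X = Y"
  by (simp add: node_def)

definition par :: "'a tree_node \<Rightarrow> 'a tree_node" where
  "par t = node (parent (set_of t))"

definition P :: "'a tree_node \<Rightarrow> 'a set" where
  "P t = part (set_of t)"

lemma par_node [simp]: "par (node X) = node (parent X)"
  by (simp add: par_def)

lemma par_pow_node: "(par ^^ i) (node X) = node ((parent ^^ i) X)"
  by (induction i) simp_all

lemma P_node [simp]: "P (node X) = part X"
  by (simp add: P_def)

sublocale tree: upward_tree "node ` \<L>" par "\<lambda>t. lev (set_of t)"
proof
  show "node ` \<L> \<noteq> {}" using \<L>_nonempty by simp
  show "par t \<in> node ` \<L>" if "t \<in> node ` \<L>" for t using that parent(1) by auto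
  show "lev (set_of t) < lev (set_of (par t))" if "t \<in> node ` \<L>" for t
    using that parent(1,2) lev_less by auto
  fix s t assume "s \<in> node ` \<L>" "t \<in> node ` \<L>"
  then obtain X Y where XY: "X \<in> \<L>" "s = node X" "Y \<in> \<L>" "t = node Y" by blast
  obtain Z where "Z \<in> \<L>" "X \<subset> Z" "Y \<subset> Z" using directed[OF XY(1,3)] by blast
  then obtain i j where "(parent ^^ i) X = Z" "(parent ^^ j) Y = Z"
    using parent_pow_reaches[of X Z] parent_pow_reaches[of Y Z] XY by blast
  then show "\<exists>i j. (par ^^ i) s = (par ^^ j) t"
    unfolding XY par_pow_node by (intro exI[of _ i] exI[of _ j]) simp
qed

lemma below_node:
  assumes "X \<in> \<L>"
  shows "tree.below (node X) = node ` {Y \<in> \<L>. Y \<subseteq> X}"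
proof -
  have "(\<exists>i. (parent ^^ i) Y = X) \<longleftrightarrow> Y \<subseteq> X" if "Y \<in> \<L>" for Y
    using parent_pow_reaches[OF that assms] parent_pow_superset[OF that] by blast
  then have "{Y \<in> \<L>. \<exists>i. (parent ^^ i) Y = X} = {Y \<in> \<L>. Y \<subseteq> X}" by blast
  moreover have "tree.below (node X) = node ` {Y \<in> \<L>. \<exists>i. (parent ^^ i) Y = X}"
    unfolding tree.below_def by (auto simp: par_pow_node intro!: imageI)
  ultimately show ?thesis by (rule subst)
qed

lemma part_side_node:
  assumes X: "X \<in> \<L>"
  shows "part_side tree.T P (node X) (par (node X)) = closure X"
    "part_side tree.T P (par (node X)) (node X) = verts G - X"
proof -
  have n: "node X \<in> node ` \<L>" using X by blast
  show "part_side tree.T P (node X) (par (node X)) = closure X"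
    unfolding part_side_def tree.tree_side_below[OF n] below_node[OF X] Union_part_subset[OF X, symmetric] by simp
  have "node ` \<L> - node ` {Y \<in> \<L>. Y \<subseteq> X} = node ` {Y \<in> \<L>. \<not> Y \<subseteq> X}" by auto
  then show "part_side tree.T P (par (node X)) (node X) = verts G - X"
    unfolding part_side_def tree.tree_side_above[OF n] below_node[OF X] Union_part_not_subset[OF X, symmetric] by simp
qed

lemma adjacent_cases:
  assumes "adjacent tree.T s t"
  obtains X where "X \<in> \<L>" "s = node X" "t = par (node X)" | X where "X \<in> \<L>" "t = node X" "s = par (node X)"
  using assms unfolding tree.adjacent_T by blast

lemma associated_separations_T:
  "associated_separations tree.T P = (\<lambda>X. (closure X, verts G - X)) ` \<L> \<union> (\<lambda>X. (verts G - X, closure X)) ` \<L>"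
    (is "?L = ?R")
proof
  show "?L \<subseteq> ?R"
    unfolding associated_separations_def by (auto elim!: adjacent_cases simp: part_side_node simp del: par_node)
  show "?R \<subseteq> ?L"
  proof
    fix q assume "q \<in> ?R"
    then obtain X where X: "X \<in> \<L>" "q = (closure X, verts G - X) \<or> q = (verts G - X, closure X)" by blast
    have "adjacent tree.T (node X) (par (node X))" "adjacent tree.T (par (node X)) (node X)"
      using X(1) by (auto simp: tree.adjacent_T)
    then show "q \<in> ?L" using X(2) unfolding associated_separations_def part_side_node[OF X(1), symmetric] by blast
  qed
qed

text \<open>A separation depends only on X and its closure, and both commute with
  automorphisms.\<close>

lemma Aut_invariant_T: "Aut_invariant G tree.T P"
proof -
  have "(\<phi> ` closure X = closure (\<phi> ` X)) \<and> \<phi> ` (verts G - X) = verts G - \<phi> ` X \<and> \<phi> ` X \<in> \<L>"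
    if X: "X \<in> \<L>" and aut: "automorphism G \<phi>" for X \<phi>
    using inj_on_image_set_diff[OF automorphism_inj[OF aut], of "verts G" X] \<L>_verts[OF X] \<L>_image[OF X aut]
      automorphism_verts(1)[OF aut] nbhd_image[OF aut \<L>_verts[OF X]]
    by (auto simp: closure_def image_Un)
  then show ?thesis unfolding Aut_invariant_def associated_separations_T by auto
qed

lemma closure_Int: "X \<in> \<L> \<Longrightarrow> closure X \<inter> (verts G - X) = nbhd G X"
  using nbhd_subset[of G X] \<L>_verts[of X] by (auto simp: closure_def)

lemma outer_subset_side: "X \<in> \<L> \<Longrightarrow> outer X C \<Longrightarrow> C \<subseteq> verts G - closure X"
  using outer_disjoint[of X C] \<L>_inner[of X] by (auto simp: closure_def outer_def)

lemma outer_component: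
  assumes C: "outer X C"
  shows "C \<in> components (delete_verts G (nbhd G X))"
proof -
  have C': "C \<subseteq> verts G - nbhd G X" "conn G C" "nbhd G C \<subseteq> nbhd G X" using C by (auto simp: outer_def)
  obtain c where c: "c \<in> C" using outer_not_subset_inner[OF C inner_empty] by blast
  have cV: "c \<in> verts G - nbhd G X" using c C'(1) by blast
  have "component_in G (verts G - nbhd G X) c \<subseteq> C"
  proof (rule conn_subset[OF component_in_conn[OF cV]])
    show "component_in G (verts G - nbhd G X) c \<subseteq> verts G" "component_in G (verts G - nbhd G X) c \<inter> nbhd G C = {}"
      using component_in_subset[OF cV, of G] C'(3) by auto
    show "component_in G (verts G - nbhd G X) c \<inter> C \<noteq> {}" using c component_in_self[of c G] by blast
  qed
  moreover have "C \<subseteq> component_in G (verts G - nbhd G X) c" by (rule component_in_superset[OF C'(2,1) c])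
  ultimately show ?thesis unfolding components_delete_verts using cV by blast
qed

lemma tree_decomposition_T: "tree_decomposition G tree.T P"
proof -
  have conv: "\<forall>t\<in>set p. v \<in> P t"
    if "p \<noteq> []" "distinct p" "successively (adjacent tree.T) p" "set p \<subseteq> node ` \<L>" "v \<in> P (hd p)" "v \<in> P (last p)" for p v
    using that
  proof (induction p rule: induct_list012)
    case (3 a b q)
    have bq: "b # q \<noteq> []" "successively (adjacent tree.T) (b # q)" "a \<notin> set (b # q)" using "3.prems" by auto
    obtain C where C: "C \<in> \<L>" "last (b # q) = node C" using "3.prems"(4) last_in_set[OF bq(1)] by fastforce
    have vC: "v \<in> part C" using "3.prems"(6) C(2) by simp
    have "adjacent tree.T a b" using "3.prems"(3) by simp
    then have "v \<in> P b"
    proof (cases rule: adjacent_cases)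
      case (1 A)
      \<comment> \<open>The path has gone up from a and does not return to it, so its last node
        stays outside the descendants of a.\<close>
      have "b \<notin> tree.below a" using tree.par_not_below[of a] 1 by blast
      then have "\<not> C \<subseteq> A"
        using tree.path_stays_outside[OF bq(2,1) _ bq(3)] C 1 by (auto simp: below_node simp del: par_node)
      then show ?thesis using part_parent[OF 1(1) _ C(1) vC] "3.prems"(5) 1 by simp
    next
      case (2 B)
      \<comment> \<open>The path has come down from the parent of b and does not return there, so
        its last node is a descendant of b.\<close>
      have "hd (b # q) \<in> tree.below b" using tree.below_self[of b] 2 by simp
      moreover have "par b \<notin> set (b # q)" using bq(3) 2 by simp
      ultimately have "node C \<in> tree.below (node B)" using tree.path_stays_below[OF bq(2,1), of b] C(2) 2(2) by simp
      then have "C \<subseteq> B" by (auto simp: below_node[OF 2(1)])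
      then show ?thesis using part_convex[OF vC, of "parent B" B] "3.prems"(5) 2 parent(2)[of B] by auto
    qed
    then have "\<forall>t\<in>set (b # q). v \<in> P t"
      using "3.IH"(2)[OF bq(1) _ bq(2)] "3.prems"(2,4,6) by simp
    then show ?case using "3.prems"(5) by simp
  qed auto
  have "part_side tree.T P s t - part_side tree.T P t s \<noteq> {}" if "adjacent tree.T s t" for s t
    using that
  proof (cases rule: adjacent_cases)
    case (1 X)
    then show ?thesis using \<L>_inner[of X] \<L>_verts[of X] unfolding 1(2,3) part_side_node[OF 1(1)] by (auto simp: closure_def)
  next
    case (2 X)
    obtain C where C: "outer X C" using outer_exists \<L>_inner[OF 2(1)] by blast
    then have "C \<subseteq> verts G - X - closure X" "C \<noteq> {}"
      using outer_subset_side[OF 2(1) C] outer_not_subset_inner[OF C inner_empty] by (auto simp: closure_def)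
    then show ?thesis unfolding 2(2,3) part_side_node[OF 2(1)] by blast
  qed
  moreover have "\<exists>t\<in>verts tree.T. e \<subseteq> P t" if e: "e \<in> edges G" for e
  proof -
    obtain u v where "e = {u, v}" "adjacent G u v" using simple e unfolding simple_graph_def adjacent_def by metis
    then show ?thesis using edge_in_part[of u v] by auto
  qed
  moreover have "\<forall>t\<in>set p. P (hd p) \<inter> P (last p) \<subseteq> P t" if "is_path tree.T p" for p
    using conv[of p] that by (auto simp: is_path_def)
  ultimately show ?thesis
    using tree.tree_T Union_part unfolding tree_decomposition_def by (auto simp: image_image)
qed

lemma displays_T: "displays G tree.T P (rays G)"
proof -
  have "ecard (part_side tree.T P s t \<inter> part_side tree.T P t s) \<le> enat k" if "adjacent tree.T s t" for s t
    using that
  proof (cases rule: adjacent_cases)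
    case (1 X)
    then show ?thesis unfolding 1(2,3) part_side_node[OF 1(1)] closure_Int[OF 1(1)]
      using \<L>_inner[OF 1(1)] by (simp add: ecard_def inner_def)
  next
    case (2 X)
    then show ?thesis unfolding 2(2,3) part_side_node[OF 2(1)] Int_commute[of "verts G - X"] closure_Int[OF 2(1)]
      using \<L>_inner[OF 2(1)] by (simp add: ecard_def inner_def)
  qed
  then have "adhesion tree.T P \<le> enat k" unfolding adhesion_def by (intro SUP_least) auto
  then have "adhesion tree.T P \<noteq> \<infinity>" by (metis enat.distinct(2) enat_ile)
  moreover have "end_lies_in G (rays G) (part_side tree.T P s t) (part_side tree.T P t s)"
    if st: "adjacent tree.T s t" and ev: "\<forall>r\<in>rays tree.T. eventually_in r (tree_side tree.T t s)" for s t
    using st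
  proof (cases rule: adjacent_cases)
    case (1 X)
    obtain C where C: "outer X C" using outer_exists \<L>_inner[OF 1(1)] by blast
    have "\<forall>r\<in>rays G. eventually_in r C" using C by (simp add: outer_def eventually_in_def)
    moreover have "C \<subseteq> verts G - X - closure X" using outer_subset_side[OF 1(1) C] by (auto simp: closure_def)
    ultimately show ?thesis
      unfolding end_lies_in_def 1(2,3) part_side_node[OF 1(1)] closure_Int[OF 1(1)] using outer_component[OF C] by blast
  next
    case (2 X)
    have n: "node X \<in> node ` \<L>" using 2(1) by blast
    \<comment> \<open>This orientation does not point to the end of the tree: the ray climbing from
      X leaves the descendants of X at its first step.\<close>
    let ?r = "\<lambda>n. (par ^^ n) (node X)"
    have "finite {n. ?r n \<notin> tree.below (node X)}"
      using bspec[OF ev tree.pow_ray[OF n]] unfolding 2(2,3) tree.tree_side_below[OF n] eventually_in_def .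
    moreover have "?r (Suc n) \<notin> tree.below (node X)" for n
    proof
      assume "?r (Suc n) \<in> tree.below (node X)"
      then have "lev (set_of (?r (Suc n))) \<le> lev (set_of (node X))" by (rule tree.below_lev)
      then show False using tree.lev_pow[OF n, of "Suc n"] by simp
    qed
    then have "range Suc \<subseteq> {n. ?r n \<notin> tree.below (node X)}" by blast
    ultimately have "finite (range Suc)" using finite_subset by blast
    then show ?thesis using finite_imageD[of Suc UNIV] by simp
  qed
  ultimately show ?thesis unfolding displays_def using tree.ends_T by blast
qed

end


section \<open>The main theorem\<close>

lemma component_in_eq:
  assumes "z \<in> component_in G X x" "z \<in> component_in G X y"
  shows "component_in G X x = component_in G X y"
proof -
  have xz: "reach G X x z" and yz: "reach G X y z" using assms by (simp_all add: component_in_def)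
  have "reach G X x y" "reach G X y x"
    by (rule reach_trans[OF xz reach_sym[OF yz]], rule reach_trans[OF yz reach_sym[OF xz]])
  then have "reach G X x w \<longleftrightarrow> reach G X y w" for w by (metis reach_trans)
  then show ?thesis by (simp add: component_in_def)
qed

lemma ray_eventually_in_component:
  assumes r: "r \<in> rays G" and S: "finite S"
  shows "\<exists>C\<in>components (delete_verts G S). eventually_in r C"
proof -
  have inj: "inj r" and rV: "\<And>n. r n \<in> verts G" and adj: "\<And>n. adjacent G (r n) (r (Suc n))"
    using r by (auto simp: rays_def)
  have "finite {n. r n \<in> S}" using finite_vimageI[OF S inj] by (simp add: vimage_def)
  then obtain m where m: "\<And>n. r n \<in> S \<Longrightarrow> n < m" using finite_nat_set_iff_bounded by auto
  have out: "r (m + n) \<in> verts G - S" for n using rV m[of "m + n"] by auto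
  have "r (m + n) \<in> component_in G (verts G - S) (r m)" for n
  proof (induction n)
    case (Suc n)
    then show ?case using component_in_step[OF Suc _ _ adj[of "m + n"]] out[of 0] out[of "Suc n"] by simp
  qed (simp add: component_in_self)
  then have "{n. r n \<notin> component_in G (verts G - S) (r m)} \<subseteq> {..<m}"
    by (metis (mono_tags, lifting) lessThan_iff mem_Collect_eq not_le le_iff_add subsetI)
  then have "eventually_in r (component_in G (verts G - S) (r m))"
    unfolding eventually_in_def by (rule finite_subset) simp
  then show ?thesis unfolding components_delete_verts using out[of 0] by auto
qed

lemma one_ended_rays:
  assumes "one_ended G" "\<omega> \<in> ends G"
  shows "\<omega> = rays G" "\<And>r s. r \<in> rays G \<Longrightarrow> s \<in> rays G \<Longrightarrow> (r, s) \<in> end_equiv G" "rays G \<noteq> {}"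
proof -
  \<comment> \<open>Every ray determines an element of the quotient, and there is only one;
    reflexivity, shown next, then puts each ray into it.\<close>
  have cls: "end_equiv G `` {r} = \<omega>" if "r \<in> rays G" for r
    using assms that unfolding one_ended_def ends_def by (metis quotientI)
  have self: "r \<in> \<omega>" if r: "r \<in> rays G" for r
  proof -
    have "(r, r) \<in> end_equiv G" using r ray_eventually_in_component[OF r] by (simp add: end_equiv_def)
    then show ?thesis using cls[OF r] by blast
  qed
  have sub: "\<omega> \<subseteq> rays G" using assms(2) by (auto simp: ends_def quotient_def end_equiv_def)
  show "\<omega> = rays G" using self sub by blast
  show "(r, s) \<in> end_equiv G" if "r \<in> rays G" "s \<in> rays G" for r s
    using cls[OF that(1)] self[OF that(2)] by blast
  show "rays G \<noteq> {}" using assms(2) by (auto simp: ends_def quotient_def)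
qed

lemma component_of_rays:
  assumes "\<And>r s. r \<in> rays G \<Longrightarrow> s \<in> rays G \<Longrightarrow> (r, s) \<in> end_equiv G" "rays G \<noteq> {}"
    and S: "finite S" "S \<subseteq> verts G"
  shows "\<exists>C \<subseteq> verts G - S. conn G C \<and> nbhd G C \<subseteq> S \<and> (\<forall>r\<in>rays G. finite {n. r n \<notin> C})"
proof -
  obtain r where r: "r \<in> rays G" using assms(2) by blast
  obtain C where C: "C \<in> components (delete_verts G S)" "eventually_in r C"
    using ray_eventually_in_component[OF r S(1)] by blast
  obtain x where x: "x \<in> verts G - S" "C = component_in G (verts G - S) x"
    using C(1) unfolding components_delete_verts by blast
  have "eventually_in s C" if s: "s \<in> rays G" for s
  proof -
    obtain C' where C': "C' \<in> components (delete_verts G S)" "eventually_in r C'" "eventually_in s C'"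
      using assms(1)[OF r s] S unfolding end_equiv_def by blast
    obtain y where y: "C' = component_in G (verts G - S) y" using C'(1) unfolding components_delete_verts by blast
    \<comment> \<open>The ray r is eventually in both components, so they share a vertex and
      coincide.\<close>
    have "finite ({n. r n \<notin> C} \<union> {n. r n \<notin> C'})" using C(2) C'(2) by (simp add: eventually_in_def)
    then have "{n. r n \<notin> C} \<union> {n. r n \<notin> C'} \<noteq> UNIV" using infinite_UNIV_nat by metis
    then obtain n where "r n \<in> C" "r n \<in> C'" by blast
    then have "C = C'" unfolding x(2) y by (rule component_in_eq)
    then show ?thesis using C'(3) by simp
  qed
  moreover have "nbhd G C \<subseteq> S"
    using component_in_step[of _ G "verts G - S" x] x unfolding nbhd_def by blast
  ultimately show ?thesis
    using component_in_subset[OF x(1), of G] component_in_conn[OF x(1)] unfolding x(2) eventually_in_def by blast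
qed

text \<open>A separation witnessing that v does not dominate the end has v on its far side, whose
  neighbours lie in the finite set of common vertices.\<close>

lemma undominated_inner:
  assumes "undominated G (rays G)" "v \<in> verts G"
  shows "\<exists>F. inner G F \<and> v \<in> F"
proof -
  obtain A B C where AB: "separation G A B" "finite (A \<inter> B)" "v \<in> A - B"
    and C: "\<forall>r\<in>rays G. eventually_in r C" "C \<subseteq> B - A"
    using assms unfolding undominated_def dominates_def end_lies_in_def by blast
  have V: "A \<union> B = verts G" and no: "\<And>u v. u \<in> A - B \<Longrightarrow> v \<in> B - A \<Longrightarrow> \<not> adjacent G u v"
    using AB(1) by (auto simp: separation_def)
  have "nbhd G (A - B) \<subseteq> A \<inter> B"
  proof
    fix w assume "w \<in> nbhd G (A - B)"
    then obtain u where "u \<in> A - B" "adjacent G u w" "w \<in> verts G" "w \<notin> A - B" by (rule nbhdE)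
    then show "w \<in> A \<inter> B" using no[of u w] V by blast
  qed
  then have "finite (nbhd G (A - B))" using AB(2) finite_subset by blast
  moreover have "finite {n. r n \<in> A - B}" if "r \<in> rays G" for r
    by (rule finite_subset[of _ "{n. r n \<notin> C}"]) (use C that in \<open>auto simp: eventually_in_def\<close>)
  ultimately have "inner G (A - B)" using V by (auto simp: inner_def)
  then show ?thesis using AB(3) by blast
qed

theorem theorem1p1:
  fixes G :: "'a graph" and \<omega> :: "(nat \<Rightarrow> 'a) set"
  assumes "simple_graph G" and "connected_graph G"
    and "one_ended G" and "\<omega> \<in> ends G"
    and "undominated G \<omega>" and "vertex_degree \<omega> \<noteq> \<infinity>"
  shows "\<exists>(T :: 'a tree_node graph) (P :: 'a tree_node \<Rightarrow> 'a set).
    tree_decomposition G T P \<and> displays G T P \<omega> \<and> Aut_invariant G T P"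
proof -
  note \<omega> = one_ended_rays[OF assms(3,4)]
  interpret one_end G
  proof
    show "simple_graph G" by (rule assms(1))
    show "conn G (verts G)" using assms(2) by (simp add: connected_graph_iff)
    show "rays G \<noteq> {}" by (rule \<omega>(3))
    show "\<exists>C \<subseteq> verts G - S. conn G C \<and> nbhd G C \<subseteq> S \<and> (\<forall>r\<in>rays G. finite {n. r n \<notin> C})"
      if "finite S" "S \<subseteq> verts G" for S
      by (rule component_of_rays[OF \<omega>(2,3) that])
    show "\<exists>F. inner G F \<and> v \<in> F" if "v \<in> verts G" for v
      using undominated_inner[OF _ that] assms(5) \<omega>(1) by simp
  qed
  define bound where "bound m \<longleftrightarrow>
    (\<forall>X. finite X \<longrightarrow> X \<subseteq> verts G \<longrightarrow> (\<exists>F. inner G F \<and> X \<subseteq> F \<and> card (nbhd G F) \<le> m))" for m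
  define k where "k = (LEAST m. bound m)"
  have "\<exists>m. bound m" using inner_card_bound assms(6) \<omega>(1) unfolding bound_def by simp
  then have k: "bound k" unfolding k_def by (rule LeastI_ex)
  interpret one_end_crit G k
  proof
    show "\<exists>F. inner G F \<and> X \<subseteq> F \<and> card (nbhd G F) \<le> k" if "finite X" "X \<subseteq> verts G" for X
      using k that by (simp add: bound_def)
    show "\<exists>X. finite X \<and> X \<subseteq> verts G \<and> (\<forall>F. inner G F \<longrightarrow> X \<subseteq> F \<longrightarrow> k \<le> card (nbhd G F))"
    proof (cases k)
      case 0
      then show ?thesis by (intro exI[of _ "{}"]) simp
    next
      case (Suc j)
      \<comment> \<open>By leastness of k, the number k - 1 fails for some finite set, and this set
        forces at least k neighbours.\<close>
      then have "\<not> bound j" using not_less_Least[of j bound] by (simp add: k_def)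
      then obtain X where "finite X" "X \<subseteq> verts G" "\<And>F. inner G F \<Longrightarrow> X \<subseteq> F \<Longrightarrow> \<not> card (nbhd G F) \<le> j"
        unfolding bound_def by blast
      then show ?thesis using Suc by (intro exI[of _ X]) (simp add: not_le Suc_le_eq)
    qed
  qed
  obtain \<L> lev where L: "\<L> \<noteq> {}" "\<forall>X\<in>\<L>. inner G X \<and> X \<noteq> {} \<and> card (nbhd G X) \<le> k"
    "\<forall>X\<in>\<L>. \<forall>\<phi>. automorphism G \<phi> \<longrightarrow> \<phi> ` X \<in> \<L>"
    "\<forall>X\<in>\<L>. \<forall>Y\<in>\<L>. X \<subset> Y \<longrightarrow> lev X < (lev Y :: nat)"
    "\<forall>X\<in>\<L>. \<forall>Y\<in>\<L>. away G X Y \<or> X \<subseteq> Y \<or> Y \<subseteq> X"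
    "\<forall>v\<in>verts G. \<exists>X\<in>\<L>. v \<in> X" "\<forall>X\<in>\<L>. \<forall>Y\<in>\<L>. \<exists>Z\<in>\<L>. X \<subset> Z \<and> Y \<subset> Z"
    using laminar_family by (elim exE conjE) (rule that)
  interpret laminar G k \<L> lev
    by unfold_locales (simp_all add: L)
  have "displays G tree.T P \<omega>" using displays_T \<omega>(1) by simp
  with tree_decomposition_T Aut_invariant_T show ?thesis by (intro exI[of _ tree.T] exI[of _ P] conjI)
qed

end
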